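(* Let $W$ and $W'$ be graphons over probability spaces $(\Omega,\mathcal F,\pi)$ and $(\Omega',\mathcal F',\pi')$, respectively. Assume $n\rho_n\to\infty$ and that either $\rho_n\max\{\|W\|_\infty,\|W'\|_\infty\}\le1$ or $\rho_n\to0$. Then the sequences $(G_n(\rho_nW))_{n\ge0}$ and $(G_n(\rho_nW'))_{n\ge0}$ are identically distributed (i.e., $G_n(\rho_nW)$ and $G_n(\rho_nW')$ have the same distribution for every $n$) if and only if $W$ and $W'$ are equivalent.
   Context: A graphon over $(\Omega,\mathcal F,\pi)$ is a measurable symmetric $W:\Omega\times\Omega\to[0,\infty)$ with $\int W\,d\pi\,d\pi<\infty$. $G_n(\rho W)$: choose $x_1,\dots,x_n$ i.i.d. from $\pi$ and include each edge $\{i,j\}$ of a graph on $[n]$ independently with probability $\min\{1,\rho W(x_i,x_j)\}$. For a measurable map $\phi:\Omega\to\Omega''$ and a graphon $U$ on $\Omega''$, $U^\phi(x,y)=U(\phi(x),\phi(y))$. $W$ and $W'$ are equivalent if there exist a probability space $(\Omega'',\mathcal F'',\pi'')$, a graphon $U$ on it, and measure-preserving maps $\phi:\Omega\to\Omega''$, $\phi':\Omega'\to\Omega''$ with $W=U^\phi$ and $W'=U^{\phi'}$ almost everywhere. *)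

theory Defs
  imports "HOL-Probability.Probability"
begin

definition graphon :: "'a measure \<Rightarrow> ('a \<Rightarrow> 'a \<Rightarrow> real) \<Rightarrow> bool" where
  "graphon M W \<longleftrightarrow> prob_space M
     \<and> (\<lambda>z. W (fst z) (snd z)) \<in> borel_measurable (M \<Otimes>\<^sub>M M)
     \<and> (\<forall>x\<in>space M. \<forall>y\<in>space M. 0 \<le> W x y \<and> W x y = W y x)
     \<and> integrable (M \<Otimes>\<^sub>M M) (\<lambda>z. W (fst z) (snd z))"

definition graphon_sup_norm :: "'a measure \<Rightarrow> ('a \<Rightarrow> 'a \<Rightarrow> real) \<Rightarrow> ereal" where
  "graphon_sup_norm M W = esssup (M \<Otimes>\<^sub>M M) (\<lambda>z. ereal \<bar>W (fst z) (snd z)\<bar>)"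

text \<open>Potential edges of a graph on the vertex set [n] = {0..<n}, each unordered
  edge {i,j} represented by the pair (i,j) with i < j.\<close>
definition pot_edges :: "nat \<Rightarrow> (nat \<times> nat) set" where
  "pot_edges n = {(i, j). i < j \<and> j < n}"

text \<open>The probability that the random graph G_n(rho W) equals the graph on [n]
  with edge set H (H \<subseteq> pot_edges n): sample x_0..x_{n-1} i.i.d. from M, then
  include each edge {i,j} independently with probability min 1 (rho * W x_i x_j).\<close>
definition G_prob :: "'a measure \<Rightarrow> ('a \<Rightarrow> 'a \<Rightarrow> real) \<Rightarrow> real \<Rightarrow> nat \<Rightarrow> (nat \<times> nat) set \<Rightarrow> real" where
  "G_prob M W \<rho> n H =
     (\<integral>x. (\<Prod>e\<in>pot_edges n.
              let p = min 1 (\<rho> * W (x (fst e)) (x (snd e)))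
              in if e \<in> H then p else 1 - p)
        \<partial>(PiM {..<n} (\<lambda>_. M)))"

definition same_G_dist ::
  "'a measure \<Rightarrow> ('a \<Rightarrow> 'a \<Rightarrow> real) \<Rightarrow> 'b measure \<Rightarrow> ('b \<Rightarrow> 'b \<Rightarrow> real) \<Rightarrow> real \<Rightarrow> nat \<Rightarrow> bool" where
  "same_G_dist M W M' W' \<rho> n \<longleftrightarrow>
     (\<forall>H. H \<subseteq> pot_edges n \<longrightarrow> G_prob M W \<rho> n H = G_prob M' W' \<rho> n H)"

definition meas_pres :: "'a measure \<Rightarrow> 'c measure \<Rightarrow> ('a \<Rightarrow> 'c) \<Rightarrow> bool" where
  "meas_pres M N \<phi> \<longleftrightarrow> \<phi> \<in> measurable M N \<and> distr M N \<phi> = N"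

definition pullback_ae :: "'a measure \<Rightarrow> ('a \<Rightarrow> 'a \<Rightarrow> real) \<Rightarrow> ('c \<Rightarrow> 'c \<Rightarrow> real) \<Rightarrow> ('a \<Rightarrow> 'c) \<Rightarrow> bool" where
  "pullback_ae M W U \<phi> \<longleftrightarrow>
     (AE z in M \<Otimes>\<^sub>M M. W (fst z) (snd z) = U (\<phi> (fst z)) (\<phi> (snd z)))"

definition equiv_via ::
  "'a measure \<Rightarrow> ('a \<Rightarrow> 'a \<Rightarrow> real) \<Rightarrow> 'b measure \<Rightarrow> ('b \<Rightarrow> 'b \<Rightarrow> real) \<Rightarrow>
   'c measure \<Rightarrow> ('c \<Rightarrow> 'c \<Rightarrow> real) \<Rightarrow> ('a \<Rightarrow> 'c) \<Rightarrow> ('b \<Rightarrow> 'c) \<Rightarrow> bool" where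
  "equiv_via M W M' W' M'' U \<phi> \<phi>' \<longleftrightarrow>
     prob_space M'' \<and> graphon M'' U \<and> meas_pres M M'' \<phi> \<and> meas_pres M' M'' \<phi>'
     \<and> pullback_ae M W U \<phi> \<and> pullback_ae M' W' U \<phi>'"

end

theory Submission
  imports Defs
begin

text \<open>If the graphons are equivalent, measure-preserving maps carry the i.i.d. samples to i.i.d. samples
  and the edge probabilities agree almost surely.

  Conversely, approximate W and W' in L1 by step functions over countably many measurable sets, so that
  points may be replaced by 0-1 sequences. A union bound over the at most \<open>4^n\<close> cuts, which is where
  \<open>n * rho n\<close> tending to infinity enters, shows that with probability above 1/2 the rescaled graph is
  close in cut norm to the matrix \<open>W (x i) (x j)\<close> of its sample. As the two graph laws agree, some graph is
  typical for both graphons; pairing its two samples vertex by vertex gives an empirical coupling for which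
  the two kernels are close in cut norm. A weak limit of these couplings on the Cantor space is a coupling
  \<open>\<mu>\<close> under which the two kernels have the same integral over every rectangle, hence agree almost everywhere.

  Finally the sets that are, up to null sets, preimages under both projections of \<open>\<mu>\<close> form a
  sigma-algebra. All functions obtained by integrating the common kernel in one variable are measurable for it,
  hence so is the kernel itself in both variables, and it factors through a common quotient.\<close>

section \<open>Approximation by finite sums of rectangles\<close>

text \<open>The probability spaces are arbitrary and the kernels may be unbounded, so there is
  neither a standard Borel structure nor a compact space of kernels to work in. Countably many bits
  restore compactness: after embedding the Cantor space in the real line, tightness supplies the
  weak limit. A graph divided by \<open>\<rho>\<close> has conditional mean
  \<open>min (1/\<rho>) W\<close>, not \<open>W\<close>. The two alternatives in the hypotheses are
  two ways for this truncation to vanish in L1. For a typical sample, the number of edges in one cut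
  has mean and variance at most of order \<open>\<rho> * n^2\<close>, so a Chernoff bound fails with
  probability about \<open>exp (- \<kappa> * \<rho> * n^2)\<close> per cut. This beats
  \<open>4^n\<close> once \<open>n * \<rho>\<close> exceeds a constant that depends on the
  precision. Two events of probability above 1/2 under one law must meet, so Markov's inequality is
  strong enough for all other estimates on the sample. A coupling is not yet a common quotient: its
  projections need not be invertible. What equality of the kernels does give is that every integral
  over one variable is a function of either coordinate alone.\<close>

definition rect_sum :: "(real \<times> 'a set \<times> 'b set) list \<Rightarrow> 'a \<times> 'b \<Rightarrow> real" where
  "rect_sum xs z = (\<Sum>(r, A, B)\<leftarrow>xs. r * indicator A (fst z) * indicator B (snd z))"

lemma rect_sum_simps [simp]:
  "rect_sum [] z = 0"
  "rect_sum ((r, A, B) # xs) z = r * indicator A (fst z) * indicator B (snd z) + rect_sum xs z"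
  "rect_sum (xs @ ys) z = rect_sum xs z + rect_sum ys z"
  by (auto simp: rect_sum_def)

lemma rect_sum_scale:
  "rect_sum (map (\<lambda>(r, A, B). (c * r, A, B)) xs) z = c * rect_sum xs z"
  by (induction xs) (auto simp: algebra_simps)

lemma integrable_rect_sum:
  assumes "prob_space M" "prob_space N" "set xs \<subseteq> UNIV \<times> sets M \<times> sets N"
  shows "integrable (M \<Otimes>\<^sub>M N) (rect_sum xs)"
proof -
  interpret pair_prob_space M N using assms by (simp add: pair_prob_space_def pair_sigma_finite_def prob_space_imp_sigma_finite)
  show ?thesis using assms(3)
  proof (induction xs)
    case Nil then show ?case by (simp add: rect_sum_def[abs_def])
  next
    case (Cons x xs)
    obtain r A B where x: "x = (r, A, B)" by (cases x)
    with Cons have [measurable]: "A \<in> sets M" "B \<in> sets N" by auto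
    have "integrable (M \<Otimes>\<^sub>M N) (\<lambda>z. r * indicator A (fst z) * indicator B (snd z))"
      by (rule integrable_const_bound[where B="\<bar>r\<bar>"]) (auto simp: abs_mult indicator_def)
    with Cons show ?case unfolding x rect_sum_simps[abs_def] by (auto intro!: Bochner_Integration.integrable_add)
  qed
qed

text \<open>Membership in the L1 closure of the rectangle sums. Integrability is part of it because
  the Bochner integral of a nonintegrable error is 0 and would say nothing.\<close>

definition rect_approx :: "'a measure \<Rightarrow> 'b measure \<Rightarrow> ('a \<times> 'b \<Rightarrow> real) \<Rightarrow> bool" where
  "rect_approx M N f \<longleftrightarrow> integrable (M \<Otimes>\<^sub>M N) f \<and> (\<forall>\<epsilon>>0. \<exists>xs. set xs \<subseteq> UNIV \<times> sets M \<times> sets N \<and>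
     (\<integral>z. \<bar>f z - rect_sum xs z\<bar> \<partial>(M \<Otimes>\<^sub>M N)) < \<epsilon>)"

lemma rect_approx_limit:
  assumes "prob_space M" "prob_space N" "integrable (M \<Otimes>\<^sub>M N) f"
    and "\<And>\<epsilon>. \<epsilon> > 0 \<Longrightarrow> \<exists>g. rect_approx M N g \<and> (\<integral>z. \<bar>f z - g z\<bar> \<partial>(M \<Otimes>\<^sub>M N)) < \<epsilon>"
  shows "rect_approx M N f"
  unfolding rect_approx_def
proof (intro conjI allI impI)
  fix \<epsilon> :: real assume e: "\<epsilon> > 0"
  obtain g where g: "rect_approx M N g" "(\<integral>z. \<bar>f z - g z\<bar> \<partial>(M \<Otimes>\<^sub>M N)) < \<epsilon>/2"
    using assms(4)[of "\<epsilon>/2"] e by auto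
  then obtain xs where xs: "set xs \<subseteq> UNIV \<times> sets M \<times> sets N"
      "(\<integral>z. \<bar>g z - rect_sum xs z\<bar> \<partial>(M \<Otimes>\<^sub>M N)) < \<epsilon>/2"
    unfolding rect_approx_def using half_gt_zero[OF e] by blast
  note [simp] = assms(3) integrable_rect_sum[OF assms(1,2) xs(1)]
  have [simp]: "integrable (M \<Otimes>\<^sub>M N) g" using g by (simp add: rect_approx_def)
  have "(\<integral>z. \<bar>f z - rect_sum xs z\<bar> \<partial>(M \<Otimes>\<^sub>M N)) \<le> (\<integral>z. \<bar>f z - g z\<bar> + \<bar>g z - rect_sum xs z\<bar> \<partial>(M \<Otimes>\<^sub>M N))"
    by (rule integral_mono) auto
  also have "\<dots> = (\<integral>z. \<bar>f z - g z\<bar> \<partial>(M \<Otimes>\<^sub>M N)) + (\<integral>z. \<bar>g z - rect_sum xs z\<bar> \<partial>(M \<Otimes>\<^sub>M N))"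
    by (rule Bochner_Integration.integral_add) auto
  also have "\<dots> < \<epsilon>" using g(2) xs(2) by simp
  finally show "\<exists>xs. set xs \<subseteq> UNIV \<times> sets M \<times> sets N \<and> (\<integral>z. \<bar>f z - rect_sum xs z\<bar> \<partial>(M \<Otimes>\<^sub>M N)) < \<epsilon>"
    using xs(1) by blast
qed fact

lemma rect_approx_add:
  assumes "prob_space M" "prob_space N" "rect_approx M N f" "rect_approx M N g"
  shows "rect_approx M N (\<lambda>z. f z + g z)"
  unfolding rect_approx_def
proof (intro conjI allI impI)
  fix \<epsilon> :: real assume e: "\<epsilon> > 0"
  obtain xs where xs: "set xs \<subseteq> UNIV \<times> sets M \<times> sets N"
      "(\<integral>z. \<bar>f z - rect_sum xs z\<bar> \<partial>(M \<Otimes>\<^sub>M N)) < \<epsilon>/2"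
    using assms(3) unfolding rect_approx_def using half_gt_zero[OF e] by blast
  obtain ys where ys: "set ys \<subseteq> UNIV \<times> sets M \<times> sets N"
      "(\<integral>z. \<bar>g z - rect_sum ys z\<bar> \<partial>(M \<Otimes>\<^sub>M N)) < \<epsilon>/2"
    using assms(4) unfolding rect_approx_def using half_gt_zero[OF e] by blast
  have [simp]: "integrable (M \<Otimes>\<^sub>M N) f" "integrable (M \<Otimes>\<^sub>M N) g" using assms by (simp_all add: rect_approx_def)
  note [simp] = integrable_rect_sum[OF assms(1,2) xs(1)] integrable_rect_sum[OF assms(1,2) ys(1)]
  have "(\<integral>z. \<bar>f z + g z - rect_sum (xs @ ys) z\<bar> \<partial>(M \<Otimes>\<^sub>M N)) \<le> (\<integral>z. \<bar>f z - rect_sum xs z\<bar> + \<bar>g z - rect_sum ys z\<bar> \<partial>(M \<Otimes>\<^sub>M N))"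
    by (rule integral_mono) auto
  also have "\<dots> = (\<integral>z. \<bar>f z - rect_sum xs z\<bar> \<partial>(M \<Otimes>\<^sub>M N)) + (\<integral>z. \<bar>g z - rect_sum ys z\<bar> \<partial>(M \<Otimes>\<^sub>M N))"
    by (rule Bochner_Integration.integral_add) auto
  also have "\<dots> < \<epsilon>" using xs(2) ys(2) by simp
  finally show "\<exists>xs. set xs \<subseteq> UNIV \<times> sets M \<times> sets N \<and> (\<integral>z. \<bar>f z + g z - rect_sum xs z\<bar> \<partial>(M \<Otimes>\<^sub>M N)) < \<epsilon>"
    using xs(1) ys(1) by (intro exI[of _ "xs @ ys"]) auto
qed (use assms in \<open>auto simp: rect_approx_def\<close>)

lemma rect_approx_scale:
  assumes "rect_approx M N f"
  shows "rect_approx M N (\<lambda>z. c * f z)"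
  unfolding rect_approx_def
proof (intro conjI allI impI)
  fix \<epsilon> :: real assume e: "\<epsilon> > 0"
  \<comment> \<open>The added 1 covers the case \<open>c = 0\<close>.\<close>
  define d where "d = \<epsilon> / (\<bar>c\<bar> + 1)"
  have d: "d > 0" using e by (simp add: d_def add_nonneg_pos)
  obtain xs where xs: "set xs \<subseteq> UNIV \<times> sets M \<times> sets N"
      "(\<integral>z. \<bar>f z - rect_sum xs z\<bar> \<partial>(M \<Otimes>\<^sub>M N)) < d"
    using assms d unfolding rect_approx_def by blast
  let ?ys = "map (\<lambda>(r, A, B). (c * r, A, B)) xs"
  have "(\<integral>z. \<bar>c * f z - rect_sum ?ys z\<bar> \<partial>(M \<Otimes>\<^sub>M N)) = (\<integral>z. \<bar>c\<bar> * \<bar>f z - rect_sum xs z\<bar> \<partial>(M \<Otimes>\<^sub>M N))"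
    unfolding rect_sum_scale abs_mult[symmetric] right_diff_distrib ..
  also have "\<dots> = \<bar>c\<bar> * (\<integral>z. \<bar>f z - rect_sum xs z\<bar> \<partial>(M \<Otimes>\<^sub>M N))" by simp
  also have "\<dots> \<le> \<bar>c\<bar> * d" using xs(2) by (intro mult_left_mono) auto
  also have "\<dots> < (\<bar>c\<bar> + 1) * d" using d by (simp add: algebra_simps)
  also have "\<dots> = \<epsilon>" by (simp add: d_def add_nonneg_pos)
  finally show "\<exists>xs. set xs \<subseteq> UNIV \<times> sets M \<times> sets N \<and> (\<integral>z. \<bar>c * f z - rect_sum xs z\<bar> \<partial>(M \<Otimes>\<^sub>M N)) < \<epsilon>"
    using xs(1) by (intro exI[of _ ?ys]) auto
qed (use assms in \<open>auto simp: rect_approx_def\<close>)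

lemma rect_approx_rect:
  assumes "prob_space M" "prob_space N" "A \<in> sets M" "B \<in> sets N"
  shows "rect_approx M N (\<lambda>z. indicator (A \<times> B) z)"
proof -
  have *: "rect_sum [(1, A, B)] z = indicator (A \<times> B) z" for z
    by (cases z) (auto simp: indicator_def)
  then have "rect_sum [(1, A, B)] = indicator (A \<times> B)" by auto
  with integrable_rect_sum[OF assms(1,2), of "[(1, A, B)]"] assms(3,4)
  have "integrable (M \<Otimes>\<^sub>M N) (indicator (A \<times> B) :: _ \<Rightarrow> real)" by simp
  then show ?thesis unfolding rect_approx_def using assms(3,4) *
    by (auto intro!: exI[of _ "[(1, A, B)]"])
qed

lemma L1_dominated_convergence:
  fixes f :: "'a \<Rightarrow> real"
  assumes "integrable M f" "\<And>i. integrable M (s i)" "integrable M w"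
    "\<And>x. x \<in> space M \<Longrightarrow> (\<lambda>i. s i x) \<longlonglongrightarrow> f x" "\<And>i x. x \<in> space M \<Longrightarrow> \<bar>s i x\<bar> \<le> w x"
  shows "(\<lambda>i. \<integral>x. \<bar>f x - s i x\<bar> \<partial>M) \<longlonglongrightarrow> 0"
proof -
  have "(\<lambda>i. \<integral>x. \<bar>f x - s i x\<bar> \<partial>M) \<longlonglongrightarrow> (\<integral>x. 0 \<partial>M)"
  proof (rule integral_dominated_convergence[where w="\<lambda>x. \<bar>f x\<bar> + w x"])
    show "AE x in M. (\<lambda>i. \<bar>f x - s i x\<bar>) \<longlonglongrightarrow> 0"
    proof (rule AE_I2)
      fix x assume "x \<in> space M"
      from tendsto_rabs[OF tendsto_diff[OF tendsto_const assms(4)[OF this], of "f x"]]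
      show "(\<lambda>i. \<bar>f x - s i x\<bar>) \<longlonglongrightarrow> 0" by simp
    qed
    show "AE x in M. norm \<bar>f x - s i x\<bar> \<le> \<bar>f x\<bar> + w x" for i
    proof (rule AE_I2)
      fix x assume "x \<in> space M"
      from assms(5)[OF this, of i] show "norm \<bar>f x - s i x\<bar> \<le> \<bar>f x\<bar> + w x" by simp
    qed
  qed (use assms in \<open>auto intro!: borel_measurable_integrable\<close>)
  then show ?thesis by simp
qed

lemma rect_approx_LIMSEQ:
  assumes "prob_space M" "prob_space N" "integrable (M \<Otimes>\<^sub>M N) f"
    and "\<And>i. rect_approx M N (s i)"
    and "(\<lambda>i. \<integral>x. \<bar>f x - s i x\<bar> \<partial>(M \<Otimes>\<^sub>M N)) \<longlonglongrightarrow> 0"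
  shows "rect_approx M N f"
proof (rule rect_approx_limit[OF assms(1-3)])
  fix \<epsilon> :: real assume "\<epsilon> > 0"
  from order_tendstoD(2)[OF assms(5) this] obtain i where "(\<integral>x. \<bar>f x - s i x\<bar> \<partial>(M \<Otimes>\<^sub>M N)) < \<epsilon>"
    by (auto simp: eventually_sequentially)
  then show "\<exists>g. rect_approx M N g \<and> (\<integral>z. \<bar>f z - g z\<bar> \<partial>(M \<Otimes>\<^sub>M N)) < \<epsilon>"
    using assms(4) by blast
qed

lemma rect_approx_sum:
  assumes "prob_space M" "prob_space N" "finite I" "\<And>i. i \<in> I \<Longrightarrow> rect_approx M N (f i)"
  shows "rect_approx M N (\<lambda>z. \<Sum>i\<in>I. f i z)"
  using assms(3,4)
proof (induction I rule: finite_induct)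
  case empty
  show ?case using rect_approx_scale[OF rect_approx_rect[OF assms(1,2) sets.top sets.top], of 0] by simp
next
  case (insert i I)
  then show ?case using rect_approx_add[OF assms(1,2)] by simp
qed

text \<open>Dynkin argument from the rectangles: complements follow by linearity, and a countable
  disjoint union is the L1 limit of its finite partial unions.\<close>

lemma rect_approx_set:
  assumes M: "prob_space M" and N: "prob_space N" and E: "E \<in> sets (M \<Otimes>\<^sub>M N)"
  shows "rect_approx M N (\<lambda>z. indicator E z)"
proof -
  interpret pair_prob_space M N using assms by (simp add: pair_prob_space_def pair_sigma_finite_def prob_space_imp_sigma_finite)
  have int: "integrable (M \<Otimes>\<^sub>M N) (\<lambda>z. indicator E z :: real)" if "E \<in> sets (M \<Otimes>\<^sub>M N)" for E
    using that by (intro integrable_const_bound[where B=1]) (auto simp: indicator_def)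
  let ?G = "{a \<times> b | a b. a \<in> sets M \<and> b \<in> sets N}"
  have "E \<in> sigma_sets (space M \<times> space N) ?G"
    using E by (simp add: sets_pair_measure)
  with Int_stable_pair_measure_generator[of M N] pair_measure_closed[of M N] show ?thesis
  proof (induct rule: sigma_sets_induct_disjoint)
    case (basic A) then show ?case by (auto intro: rect_approx_rect[OF M N])
  next
    case empty then show ?case using rect_approx_sum[OF M N, of "{}"] by simp
  next
    case (compl A)
    then have A: "A \<in> sets (M \<Otimes>\<^sub>M N)" by (simp add: sets_pair_measure)
    from sets.sets_into_space[OF this] have sub: "A \<subseteq> space M \<times> space N" by (simp add: space_pair_measure)
    have "(\<lambda>z. indicator (space M \<times> space N - A) z) = (\<lambda>z. indicator (space M \<times> space N) z + (-1::real) * indicator A z)"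
      using sub by (auto simp: indicator_def fun_eq_iff)
    then show ?case
      using rect_approx_add[OF M N rect_approx_rect[OF M N sets.top sets.top] rect_approx_scale[OF compl(2), of "-1"]] by simp
  next
    case (union A)
    then have A: "\<And>i. A i \<in> sets (M \<Otimes>\<^sub>M N)" by (auto simp: sets_pair_measure)
    have UA: "(\<Union>i. A i) \<in> sets (M \<Otimes>\<^sub>M N)" using A by auto
    define s where "s n z = (\<Sum>i<n. indicator (A i) z :: real)" for n z
    have s: "s n z = indicator (\<Union>i<n. A i) z" for n z
      unfolding s_def using union(1)
      by (subst indicator_UN_disjoint) (auto simp: disjoint_family_on_def)
    show ?case
    proof (rule rect_approx_LIMSEQ[OF M N int[OF UA]])
      show "rect_approx M N (s i)" for i
        unfolding s_def[abs_def] using union by (intro rect_approx_sum[OF M N]) auto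
      show "(\<lambda>i. \<integral>x. \<bar>indicator (\<Union>i. A i) x - s i x\<bar> \<partial>(M \<Otimes>\<^sub>M N)) \<longlonglongrightarrow> 0"
      proof (rule L1_dominated_convergence[where w="\<lambda>_. 1"])
        show "integrable (M \<Otimes>\<^sub>M N) (s i)" for i
          unfolding s[abs_def] using A by (intro int) auto
        show "(\<lambda>i. s i x) \<longlonglongrightarrow> indicator (\<Union>i. A i) x" for x
          unfolding s by (rule LIMSEQ_indicator_UN)
      qed (use int[OF UA] in \<open>auto simp: s indicator_def\<close>)
    qed
  qed
qed

lemma rect_approx_integrable:
  assumes M: "prob_space M" and N: "prob_space N" and f: "integrable (M \<Otimes>\<^sub>M N) f"
  shows "rect_approx M N f"
  using f
proof induct
  case (base A c)
  then show ?case using rect_approx_scale[OF rect_approx_set[OF M N], of A c] by (simp add: mult.commute)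
next
  case (add f g)
  then show ?case using rect_approx_add[OF M N] by blast
next
  case (lim f s)
  show ?case
  proof (rule rect_approx_LIMSEQ[OF M N])
    show "(\<lambda>i. \<integral>x. \<bar>f x - s i x\<bar> \<partial>(M \<Otimes>\<^sub>M N)) \<longlonglongrightarrow> 0"
      by (rule L1_dominated_convergence[where w="\<lambda>x. 2 * \<bar>f x\<bar>"]) (use lim in auto)
  qed (use lim in auto)
qed

text \<open>L1 convergence gives an a.e. convergent subsequence, and a pointwise limit of functions
  of \<open>\<phi> x\<close> is again one. Taking \<open>lim\<close> at every point, with its
  default value where the sequence diverges, keeps \<open>h\<close> measurable on all of
  \<open>Y\<close>.\<close>

lemma L1_limit_factors:
  fixes f :: "'a \<Rightarrow> real"
  assumes f: "integrable M f" and [measurable]: "\<phi> \<in> measurable M Y" "\<And>l. g l \<in> borel_measurable Y"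
    and int: "\<And>l. integrable M (\<lambda>x. g l (\<phi> x))"
    and lim: "(\<lambda>l. \<integral>x. \<bar>f x - g l (\<phi> x)\<bar> \<partial>M) \<longlonglongrightarrow> 0"
  shows "\<exists>h \<in> borel_measurable Y. AE x in M. f x = h (\<phi> x)"
proof -
  have "\<exists>r::nat\<Rightarrow>nat. strict_mono r \<and> (AE x in M. (\<lambda>n. g (r n) (\<phi> x) - f x) \<longlonglongrightarrow> 0)"
    using f int lim by (intro tendsto_L1_AE_subseq) (auto simp: abs_minus_commute)
  then obtain r :: "nat \<Rightarrow> nat" where r: "AE x in M. (\<lambda>n. g (r n) (\<phi> x) - f x) \<longlonglongrightarrow> 0" by blast
  define h where "h y = lim (\<lambda>n. g (r n) y)" for y
  have "h \<in> borel_measurable Y" unfolding h_def by measurable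
  moreover have "AE x in M. f x = h (\<phi> x)"
    using r
  proof eventually_elim
    case (elim x)
    then have "(\<lambda>n. g (r n) (\<phi> x)) \<longlonglongrightarrow> f x" by (simp add: LIM_zero_iff)
    then show ?case unfolding h_def by (simp add: limI)
  qed
  ultimately show ?thesis by blast
qed

section \<open>Coding points by 0-1 sequences\<close>

definition cantor_space :: "(nat \<Rightarrow> bool) measure" where
  "cantor_space = PiM UNIV (\<lambda>_. count_space UNIV)"

definition code :: "(nat \<Rightarrow> 'a set) \<Rightarrow> 'a \<Rightarrow> nat \<Rightarrow> bool" where
  "code B x = (\<lambda>i. x \<in> B i)"

text \<open>A rectangle sum with the sets replaced by bit positions. One list can thus be evaluated
  on codes of samples, under empirical measures and under their limit; since each term is a product
  of two bits, its averages over pairs are products of frequencies.\<close>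

definition step_fun :: "(real \<times> nat \<times> nat) list \<Rightarrow> (nat \<Rightarrow> bool) \<times> (nat \<Rightarrow> bool) \<Rightarrow> real" where
  "step_fun xs z = (\<Sum>(r, i, j)\<leftarrow>xs. r * of_bool (fst z i) * of_bool (snd z j))"

lemma step_fun_simps [simp]:
  "step_fun [] z = 0"
  "step_fun ((r, i, j) # xs) z = r * of_bool (fst z i) * of_bool (snd z j) + step_fun xs z"
  by (auto simp: step_fun_def)

lemma space_cantor_space [simp]: "space cantor_space = UNIV"
  by (simp add: cantor_space_def space_PiM PiE_def)

lemma cantor_coord [measurable]: "(\<lambda>z. z i) \<in> measurable cantor_space (count_space UNIV)"
  unfolding cantor_space_def by measurable

lemma measurable_cantorI:
  assumes "\<And>i. {x \<in> space M. f x i} \<in> sets M"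
  shows "f \<in> measurable M cantor_space"
  unfolding cantor_space_def
proof (rule measurable_PiM_single')
  show "(\<lambda>x. f x i) \<in> measurable M (count_space UNIV)" for i
    using assms[of i] by (simp add: pred_def)
qed auto

lemma measurable_code [measurable]:
  assumes "\<And>i. B i \<in> sets M"
  shows "code B \<in> measurable M cantor_space"
proof (rule measurable_cantorI)
  fix i
  have "{x \<in> space M. code B x i} = B i" using sets.sets_into_space[OF assms[of i]] by (auto simp: code_def)
  with assms show "{x \<in> space M. code B x i} \<in> sets M" by simp
qed

lemma measurable_step_fun [measurable]:
  "step_fun xs \<in> borel_measurable (cantor_space \<Otimes>\<^sub>M cantor_space)"
proof (induction xs)
  case (Cons x xs)
  note [measurable] = Cons
  obtain r i j where x: "x = (r, i, j)" by (cases x)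
  show ?case unfolding x step_fun_simps[abs_def] by measurable
qed (simp add: step_fun_def[abs_def])

lemma step_fun_bounded: "\<bar>step_fun xs z\<bar> \<le> (\<Sum>(r, i, j)\<leftarrow>xs. \<bar>r\<bar>)"
proof (induction xs)
  case (Cons x xs)
  obtain r i j where x: "x = (r, i, j)" by (cases x)
  have "\<bar>r * of_bool (fst z i) * of_bool (snd z j)\<bar> \<le> \<bar>r\<bar>" by auto
  with Cons show ?case unfolding x by simp
qed simp

lemma integrable_step_fun:
  assumes "finite_measure M" "\<phi> \<in> measurable M (cantor_space \<Otimes>\<^sub>M cantor_space)"
  shows "integrable M (\<lambda>x. step_fun xs (\<phi> x))"
proof -
  interpret finite_measure M by fact
  note assms(2)[measurable]
  show ?thesis by (rule integrable_const_bound[where B="\<Sum>(r, i, j)\<leftarrow>xs. \<bar>r\<bar>"]) (auto intro: step_fun_bounded)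
qed

definition code_pair where "code_pair B z = (code B (fst z), code B (snd z))"

lemma measurable_code_pair [measurable]:
  assumes "\<And>i. B i \<in> sets M"
  shows "code_pair B \<in> measurable (M \<Otimes>\<^sub>M M) (cantor_space \<Otimes>\<^sub>M cantor_space)"
proof -
  note measurable_code[where B=B, OF assms, measurable]
  show ?thesis unfolding code_pair_def by measurable
qed

text \<open>A single sequence \<open>B\<close> serves all accuracies at once: countably many finite
  sums mention only countably many sets.\<close>

lemma step_fun_approximation:
  assumes M: "prob_space M" and W: "integrable (M \<Otimes>\<^sub>M M) W" and e: "\<And>l. \<epsilon> l > (0::real)"
  obtains B \<gamma> where "\<And>i. B i \<in> sets M"
    "\<And>l::nat. (\<integral>z. \<bar>W z - step_fun (\<gamma> l) (code_pair B z)\<bar> \<partial>(M \<Otimes>\<^sub>M M)) < \<epsilon> l"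
proof -
  have "\<forall>l. \<exists>xs. set xs \<subseteq> UNIV \<times> sets M \<times> sets M \<and> (\<integral>z. \<bar>W z - rect_sum xs z\<bar> \<partial>(M \<Otimes>\<^sub>M M)) < \<epsilon> l"
    using rect_approx_integrable[OF M M W] e by (auto simp: rect_approx_def)
  then obtain xs where xs: "\<And>l::nat. set (xs l) \<subseteq> UNIV \<times> sets M \<times> sets M"
      "\<And>l. (\<integral>z. \<bar>W z - rect_sum (xs l) z\<bar> \<partial>(M \<Otimes>\<^sub>M M)) < \<epsilon> l" by metis
  \<comment> \<open>The empty set keeps \<open>D\<close> nonempty, so that all values of
    \<open>from_nat_into\<close> lie in \<open>D\<close>.\<close>
  define D where "D = insert {} (\<Union>l. \<Union>(r, A, B)\<in>set (xs l). {A, B})"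
  have "countable (\<Union>(r, A, B)\<in>set (xs l). {A, B})" for l
    by (rule countable_finite) auto
  then have D: "countable D" "D \<noteq> {}"
    unfolding D_def by auto
  have "A \<in> sets M \<and> B \<in> sets M" if "(r, A, B) \<in> set (xs l)" for r A B l
    using subsetD[OF xs(1) that] by simp
  then have "D \<subseteq> sets M" unfolding D_def by auto
  note D = D this
  define B where "B = from_nat_into D"
  define \<gamma> where "\<gamma> l = map (\<lambda>(r, A, B). (r, to_nat_on D A, to_nat_on D B)) (xs l)" for l
  have B: "B i \<in> sets M" for i
    unfolding B_def using from_nat_into[OF D(2), of i] D(3) by auto
  have "step_fun (\<gamma> l) (code_pair B z) = rect_sum (xs l) z" for l z
  proof -
    have *: "set ys \<subseteq> UNIV \<times> D \<times> D \<Longrightarrow> step_fun (map (\<lambda>(r, A, B). (r, to_nat_on D A, to_nat_on D B)) ys) (code_pair B z)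
      = rect_sum ys z" for ys
      by (induction ys) (auto simp: code_pair_def code_def B_def D(1) indicator_def)
    have "set (xs l) \<subseteq> UNIV \<times> D \<times> D" unfolding D_def by fastforce
    from *[OF this] show ?thesis by (simp add: \<gamma>_def)
  qed
  then show ?thesis using that[of B \<gamma>] B xs(2) by simp
qed

text \<open>Applied later to the sigma-algebra of common sets, where it turns a kernel into a
  function of countably many common events.\<close>

lemma factors_through_cantor:
  fixes W :: "'a \<times> 'a \<Rightarrow> real"
  assumes M: "prob_space M" and W: "integrable (M \<Otimes>\<^sub>M M) W"
  obtains B V where "\<And>i. B i \<in> sets M" "V \<in> borel_measurable (cantor_space \<Otimes>\<^sub>M cantor_space)"
    "AE z in M \<Otimes>\<^sub>M M. W z = V (code_pair B z)"
proof -
  interpret pair_prob_space M M using assms by (simp add: pair_prob_space_def pair_sigma_finite_def prob_space_imp_sigma_finite)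
  obtain B \<gamma> where B: "\<And>i. B i \<in> sets M" and
    \<gamma>: "\<And>l::nat. (\<integral>z. \<bar>W z - step_fun (\<gamma> l) (code_pair B z)\<bar> \<partial>(M \<Otimes>\<^sub>M M)) < (1/2)^l"
    using step_fun_approximation[OF M W, of "\<lambda>l. (1/2)^l"] by auto
  note measurable_code_pair[where B=B, OF B, measurable]
  have "\<exists>V \<in> borel_measurable (cantor_space \<Otimes>\<^sub>M cantor_space). AE z in M \<Otimes>\<^sub>M M. W z = V (code_pair B z)"
  proof (rule L1_limit_factors[where g="\<lambda>l. step_fun (\<gamma> l)", OF W])
    show "integrable (M \<Otimes>\<^sub>M M) (\<lambda>x. step_fun (\<gamma> l) (code_pair B x))" for l
      by (rule integrable_step_fun) (auto intro: finite_measure_axioms)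
    show "(\<lambda>l. \<integral>x. \<bar>W x - step_fun (\<gamma> l) (code_pair B x)\<bar> \<partial>(M \<Otimes>\<^sub>M M)) \<longlonglongrightarrow> 0"
    proof (rule tendsto_sandwich[OF _ _ tendsto_const LIMSEQ_realpow_zero])
      show "\<forall>\<^sub>F l in sequentially. (\<integral>x. \<bar>W x - step_fun (\<gamma> l) (code_pair B x)\<bar> \<partial>(M \<Otimes>\<^sub>M M)) \<le> (1/2)^l"
        by (intro always_eventually allI less_imp_le \<gamma>)
    qed auto
  qed auto
  then show ?thesis using that B by blast
qed

section \<open>Common factors of coupled kernels\<close>

lemma pair_prob_spaceI: "prob_space M \<Longrightarrow> prob_space N \<Longrightarrow> pair_prob_space M N"
  by (simp add: pair_prob_space_def pair_sigma_finite_def prob_space_imp_sigma_finite)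

lemma meas_pres_pair:
  assumes "prob_space N" "meas_pres M N \<phi>"
  shows "meas_pres (M \<Otimes>\<^sub>M M) (N \<Otimes>\<^sub>M N) (\<lambda>z. (\<phi> (fst z), \<phi> (snd z)))"
proof -
  have [measurable]: "\<phi> \<in> measurable M N" and d: "distr M N \<phi> = N" using assms by (auto simp: meas_pres_def)
  have "distr M N \<phi> \<Otimes>\<^sub>M distr M N \<phi> = distr (M \<Otimes>\<^sub>M M) (N \<Otimes>\<^sub>M N) (\<lambda>(x, y). (\<phi> x, \<phi> y))"
    by (rule pair_measure_distr) (auto simp: d assms prob_space_imp_sigma_finite)
  then show ?thesis by (simp add: meas_pres_def d split_beta')
qed

lemma AE_meas_pres:
  assumes "meas_pres M N \<phi>" "AE y in N. P y"
  shows "AE x in M. P (\<phi> x)"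
  using AE_distrD[of \<phi> M N P] assms unfolding meas_pres_def by metis

lemma AE_meas_pres_iff:
  assumes "meas_pres M N \<phi>" "{y \<in> space N. P y} \<in> sets N"
  shows "(AE y in N. P y) \<longleftrightarrow> (AE x in M. P (\<phi> x))"
  using AE_distr_iff[of \<phi> M N P] assms unfolding meas_pres_def by metis

lemma prob_space_meas_pres: "meas_pres M N \<phi> \<Longrightarrow> prob_space M \<Longrightarrow> prob_space N"
  using prob_space.prob_space_distr[of M \<phi> N] by (simp add: meas_pres_def)

text \<open>Dynkin argument followed by uniqueness of densities. \<open>space M \<in> G\<close>
  makes the total integral 0, which is what the complement step subtracts from.\<close>

lemma AE_zero_if_integrals_zero:
  fixes f :: "'a \<Rightarrow> real"
  assumes f: "integrable M f" and G: "Int_stable G" "G \<subseteq> Pow (space M)" "sets M = sigma_sets (space M) G" "space M \<in> G"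
    and zero: "\<And>A. A \<in> G \<Longrightarrow> (\<integral>x. indicator A x * f x \<partial>M) = 0"
  shows "AE x in M. f x = 0"
proof -
  have int: "integrable M (\<lambda>x. indicator A x * f x)" if "A \<in> sets M" for A
    using integrable_mult_indicator[OF that f] by simp
  have "(\<integral>x. indicator A x * f x \<partial>M) = 0" if "A \<in> sets M" for A
    using G(1,2) that[unfolded G(3)]
  proof (induct rule: sigma_sets_induct_disjoint)
    case (basic A) then show ?case by (rule zero)
  next
    case (compl A)
    have "A \<in> sets M" using compl G(3) by simp
    have "(\<integral>x. indicator (space M - A) x * f x \<partial>M) = (\<integral>x. indicator (space M) x * f x - indicator A x * f x \<partial>M)"
      by (rule Bochner_Integration.integral_cong) (auto simp: indicator_def)
    also have "\<dots> = 0"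
      using compl(2) zero[OF G(4)] int[OF sets.top] int[OF \<open>A \<in> sets M\<close>] by simp
    finally show ?case .
  next
    case (union A)
    then have A[measurable]: "\<And>i. A i \<in> sets M" using G(3) by auto
    have s: "(\<Sum>i<n. indicator (A i) x) = (indicator (\<Union>i<n. A i) x :: real)" for n x
      using union(1) by (subst indicator_UN_disjoint) (auto simp: disjoint_family_on_def)
    have "(\<lambda>n. \<integral>x. indicator (\<Union>i<n. A i) x * f x \<partial>M) \<longlonglongrightarrow> (\<integral>x. indicator (\<Union>i. A i) x * f x \<partial>M)"
    proof (rule integral_dominated_convergence[where w="\<lambda>x. \<bar>f x\<bar>"])
      show "AE x in M. (\<lambda>n. indicator (\<Union>i<n. A i) x * f x) \<longlonglongrightarrow> indicator (\<Union>i. A i) x * f x"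
        by (intro AE_I2 tendsto_intros LIMSEQ_indicator_UN)
    qed (use f in \<open>auto simp: indicator_def\<close>)
    moreover have "(\<integral>x. indicator (\<Union>i<n. A i) x * f x \<partial>M) = 0" for n
    proof -
      have "(\<integral>x. indicator (\<Union>i<n. A i) x * f x \<partial>M) = (\<integral>x. (\<Sum>i<n. indicator (A i) x * f x) \<partial>M)"
        unfolding s[symmetric] sum_distrib_right ..
      also have "\<dots> = (\<Sum>i<n. \<integral>x. indicator (A i) x * f x \<partial>M)"
        by (rule Bochner_Integration.integral_sum) (use int[OF A] in auto)
      also have "\<dots> = 0" using union(3) by simp
      finally show ?thesis .
    qed
    ultimately show ?case by (simp add: LIMSEQ_const_iff)
  qed simp
  then have "AE x in M. f x = (\<lambda>_. 0) x"
    by (intro density_unique_real f) (auto simp: set_lebesgue_integral_def)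
  then show ?thesis by simp
qed

text \<open>With \<open>g\<close> fixed, the inner integral over \<open>t\<close> is
  \<open>G\<close>-measurable in \<open>s\<close>, so it sees only the conditional expectation of
  \<open>f\<close>. The roles are then exchanged, with \<open>f\<close> already replaced.\<close>

lemma cond_exp_bilinear:
  fixes K :: "'a \<times> 'a \<Rightarrow> real"
  assumes M: "prob_space M" and sub: "subalgebra M G"
    and K[measurable]: "K \<in> borel_measurable (M \<Otimes>\<^sub>M M)" and bd: "\<And>z. \<bar>K z\<bar> \<le> 1"
    and T1: "\<And>g. g \<in> borel_measurable M \<Longrightarrow> (\<lambda>s. \<integral>t. g t * K (s, t) \<partial>M) \<in> borel_measurable G"
    and T2: "\<And>g. g \<in> borel_measurable M \<Longrightarrow> (\<lambda>t. \<integral>s. g s * K (s, t) \<partial>M) \<in> borel_measurable G"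
    and f: "integrable M f" and g: "integrable M g"
  shows "(\<integral>z. f (fst z) * g (snd z) * K z \<partial>(M \<Otimes>\<^sub>M M)) =
    (\<integral>z. real_cond_exp M G f (fst z) * real_cond_exp M G g (snd z) * K z \<partial>(M \<Otimes>\<^sub>M M))"
proof -
  interpret M: prob_space M by fact
  interpret pair_prob_space M M by (intro pair_prob_spaceI M)
  interpret G: finite_measure_subalgebra M G by unfold_locales (rule sub)
  have int: "integrable (M \<Otimes>\<^sub>M M) (\<lambda>(s, t). a s * b t * K (s, t))" if "integrable M a" "integrable M b" for a b
  proof -
    have [measurable]: "a \<in> borel_measurable M" "b \<in> borel_measurable M" using that by auto
    have "integrable (M \<Otimes>\<^sub>M M) (\<lambda>(s, t). a s * b t)"
    proof (rule Fubini_integrable)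
      show "integrable M (\<lambda>x. \<integral>y. norm (case (x, y) of (s, t) \<Rightarrow> a s * b t) \<partial>M)"
        using that by (simp add: abs_mult)
    qed (use that in auto)
    then have "integrable (M \<Otimes>\<^sub>M M) (\<lambda>z. a (fst z) * b (snd z))" by (simp add: split_beta')
    then have "integrable (M \<Otimes>\<^sub>M M) (\<lambda>z. a (fst z) * b (snd z) * K z)"
    proof (rule Bochner_Integration.integrable_bound)
      show "AE z in M \<Otimes>\<^sub>M M. norm (a (fst z) * b (snd z) * K z) \<le> norm (a (fst z) * b (snd z))"
        using mult_left_mono[OF bd, of "\<bar>a (fst z) * b (snd z)\<bar>" for z] by (auto simp: abs_mult)
    qed measurable
    then show ?thesis by (simp add: split_beta')
  qed
  have I1: "(\<integral>z. a (fst z) * b (snd z) * K z \<partial>(M \<Otimes>\<^sub>M M)) = (\<integral>s. (\<integral>t. b t * K (s, t) \<partial>M) * a s \<partial>M)"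
    and J1: "integrable M (\<lambda>s. (\<integral>t. b t * K (s, t) \<partial>M) * a s)"
    if "integrable M a" "integrable M b" for a b
  proof -
    have e: "(\<integral>t. a s * b t * K (s, t) \<partial>M) = (\<integral>t. b t * K (s, t) \<partial>M) * a s" for s
      by (subst integral_mult_left_zero[symmetric]) (simp add: ac_simps)
    show "(\<integral>z. a (fst z) * b (snd z) * K z \<partial>(M \<Otimes>\<^sub>M M)) = (\<integral>s. (\<integral>t. b t * K (s, t) \<partial>M) * a s \<partial>M)"
      "integrable M (\<lambda>s. (\<integral>t. b t * K (s, t) \<partial>M) * a s)"
      using integral_fst[OF int[OF that]] integrable_fst[OF int[OF that]]
      unfolding e by (simp_all add: split_beta')
  qed
  have I2: "(\<integral>z. a (fst z) * b (snd z) * K z \<partial>(M \<Otimes>\<^sub>M M)) = (\<integral>t. (\<integral>s. a s * K (s, t) \<partial>M) * b t \<partial>M)"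
    and J2: "integrable M (\<lambda>t. (\<integral>s. a s * K (s, t) \<partial>M) * b t)"
    if "integrable M a" "integrable M b" for a b
  proof -
    have e: "(\<integral>s. a s * b t * K (s, t) \<partial>M) = (\<integral>s. a s * K (s, t) \<partial>M) * b t" for t
      by (subst integral_mult_left_zero[symmetric]) (simp add: ac_simps)
    show "(\<integral>z. a (fst z) * b (snd z) * K z \<partial>(M \<Otimes>\<^sub>M M)) = (\<integral>t. (\<integral>s. a s * K (s, t) \<partial>M) * b t \<partial>M)"
      "integrable M (\<lambda>t. (\<integral>s. a s * K (s, t) \<partial>M) * b t)"
      using integral_snd[OF int[OF that]] integrable_snd[OF int[OF that]]
      unfolding e by (simp_all add: split_beta')
  qed
  have a: "integrable M (real_cond_exp M G f)" and b: "integrable M (real_cond_exp M G g)"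
    using G.real_cond_exp_int f g by auto
  have [measurable]: "f \<in> borel_measurable M" "g \<in> borel_measurable M" using f g by auto
  have "(\<integral>z. f (fst z) * g (snd z) * K z \<partial>(M \<Otimes>\<^sub>M M)) = (\<integral>z. real_cond_exp M G f (fst z) * g (snd z) * K z \<partial>(M \<Otimes>\<^sub>M M))"
    unfolding I1[OF f g] I1[OF a g] by (rule G.real_cond_exp_intg(2)[symmetric]) (use J1[OF f g] T1 in auto)
  also have "\<dots> = (\<integral>z. real_cond_exp M G f (fst z) * real_cond_exp M G g (snd z) * K z \<partial>(M \<Otimes>\<^sub>M M))"
    unfolding I2[OF a g] I2[OF a b] by (rule G.real_cond_exp_intg(2)[symmetric]) (use J2[OF a g] T2 in auto)
  finally show ?thesis .
qed

text \<open>Conditioning both indicators of a rectangle turns the test function into one measurable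
  for \<open>G \<Otimes>\<^sub>M G\<close>, and such a function cannot distinguish \<open>K\<close>
  from its conditional expectation. Undoing the conditioning for \<open>L\<close> shows that
  \<open>K\<close> and \<open>L\<close> have the same integral over every rectangle.\<close>

lemma measurable_wrt_product_subalgebra:
  fixes K :: "'a \<times> 'a \<Rightarrow> real"
  assumes M: "prob_space M" and sub: "subalgebra M G"
    and K[measurable]: "K \<in> borel_measurable (M \<Otimes>\<^sub>M M)" and bd: "\<And>z. \<bar>K z\<bar> \<le> 1"
    and T1: "\<And>g. g \<in> borel_measurable M \<Longrightarrow> (\<lambda>s. \<integral>t. g t * K (s, t) \<partial>M) \<in> borel_measurable G"
    and T2: "\<And>g. g \<in> borel_measurable M \<Longrightarrow> (\<lambda>t. \<integral>s. g s * K (s, t) \<partial>M) \<in> borel_measurable G"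
  obtains L where "L \<in> borel_measurable (G \<Otimes>\<^sub>M G)" "\<And>z. \<bar>L z\<bar> \<le> 1" "AE z in M \<Otimes>\<^sub>M M. K z = L z"
proof -
  interpret M: prob_space M by fact
  interpret pair_prob_space M M by (intro pair_prob_spaceI M)
  interpret G: finite_measure_subalgebra M G by unfold_locales (rule sub)
  have spG: "space G = space M" and setsG: "sets G \<subseteq> sets M" using sub by (auto simp: subalgebra_def)
  have idG: "(\<lambda>x. x) \<in> measurable M G" using spG setsG by (auto simp: measurable_def)
  have "(\<lambda>z. (fst z, snd z)) \<in> measurable (M \<Otimes>\<^sub>M M) (G \<Otimes>\<^sub>M G)"
    using idG by measurable
  then have idGG: "(\<lambda>z. z) \<in> measurable (M \<Otimes>\<^sub>M M) (G \<Otimes>\<^sub>M G)" by simp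
  have sub2: "subalgebra (M \<Otimes>\<^sub>M M) (G \<Otimes>\<^sub>M G)"
    unfolding subalgebra_def
  proof
    show "sets (G \<Otimes>\<^sub>M G) \<subseteq> sets (M \<Otimes>\<^sub>M M)"
    proof
      fix A assume A: "A \<in> sets (G \<Otimes>\<^sub>M G)"
      have "A \<subseteq> space (M \<Otimes>\<^sub>M M)" using sets.sets_into_space[OF A] spG by (simp add: space_pair_measure)
      with measurable_sets[OF idGG A] show "A \<in> sets (M \<Otimes>\<^sub>M M)" by (simp add: Int_absorb2)
    qed
  qed (simp add: space_pair_measure spG)
  interpret GG: finite_measure_subalgebra "M \<Otimes>\<^sub>M M" "G \<Otimes>\<^sub>M G" by unfold_locales (rule sub2)
  have Kint: "integrable (M \<Otimes>\<^sub>M M) K"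
    by (rule integrable_const_bound[where B=1]) (use bd in auto)
  define L0 where "L0 = real_cond_exp (M \<Otimes>\<^sub>M M) (G \<Otimes>\<^sub>M G) K"
  \<comment> \<open>Clamping alters \<open>L0\<close> on a null set only, and makes the bound hold
    at every point, as \<open>cond_exp_bilinear\<close> demands of its kernel.\<close>
  define L where "L z = max (-1) (min 1 (L0 z))" for z
  have L0[measurable]: "L0 \<in> borel_measurable (G \<Otimes>\<^sub>M G)" unfolding L0_def by measurable
  have LG[measurable]: "L \<in> borel_measurable (G \<Otimes>\<^sub>M G)" unfolding L_def by measurable
  have LM[measurable]: "L \<in> borel_measurable (M \<Otimes>\<^sub>M M)" by (rule measurable_from_subalg[OF sub2 LG])
  have L0M[measurable]: "L0 \<in> borel_measurable (M \<Otimes>\<^sub>M M)" by (rule measurable_from_subalg[OF sub2 L0])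
  have Lbd: "\<bar>L z\<bar> \<le> 1" for z by (auto simp: L_def)
  have "AE z in M \<Otimes>\<^sub>M M. L0 z \<le> 1"
    unfolding L0_def using Kint bd by (intro GG.real_cond_exp_le_c) (auto simp: abs_le_iff)
  moreover have "AE z in M \<Otimes>\<^sub>M M. L0 z \<ge> -1"
    unfolding L0_def using Kint bd by (intro GG.real_cond_exp_ge_c) (auto simp: abs_le_iff minus_le_iff)
  ultimately have L0L: "AE z in M \<Otimes>\<^sub>M M. L0 z = L z"
    by eventually_elim (auto simp: L_def)
  have Lint: "integrable (M \<Otimes>\<^sub>M M) L"
    by (rule integrable_const_bound[where B=1]) (use Lbd in auto)
  have idMG: "(\<lambda>z. (fst z, snd z)) \<in> measurable (G \<Otimes>\<^sub>M M) (G \<Otimes>\<^sub>M G)" "(\<lambda>z. (fst z, snd z)) \<in> measurable (M \<Otimes>\<^sub>M G) (G \<Otimes>\<^sub>M G)"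
    using idG by measurable
  \<comment> \<open>\<open>L\<close> is also measurable for the two mixed products, so its partial
    integrals against \<open>M\<close>-measurable functions are \<open>G\<close>-measurable: it
    satisfies the hypotheses that were made for \<open>K\<close>.\<close>
  have L1: "L \<in> borel_measurable (G \<Otimes>\<^sub>M M)" and L2: "L \<in> borel_measurable (M \<Otimes>\<^sub>M G)"
    using measurable_compose[OF idMG(1) LG] measurable_compose[OF idMG(2) LG] by simp_all
  have T1': "(\<lambda>s. \<integral>t. g t * L (s, t) \<partial>M) \<in> borel_measurable G" if [measurable]: "g \<in> borel_measurable M" for g
    using L1 by measurable
  have T2': "(\<lambda>t. \<integral>s. g s * L (s, t) \<partial>M) \<in> borel_measurable G" if [measurable]: "g \<in> borel_measurable M" for g
  proof -
    have "(\<lambda>z. (snd z, fst z)) \<in> measurable (G \<Otimes>\<^sub>M M) (M \<Otimes>\<^sub>M G)" by measurable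
    from measurable_compose[OF this L2] have [measurable]: "(\<lambda>z. L (snd z, fst z)) \<in> borel_measurable (G \<Otimes>\<^sub>M M)" .
    have "(\<lambda>(t, s). g s * L (s, t)) \<in> borel_measurable (G \<Otimes>\<^sub>M M)" by (simp add: split_beta')
    then show ?thesis by (rule M.borel_measurable_lebesgue_integral)
  qed
  have "AE z in M \<Otimes>\<^sub>M M. K z - L z = 0"
  proof (rule AE_zero_if_integrals_zero)
    show "integrable (M \<Otimes>\<^sub>M M) (\<lambda>z. K z - L z)" using Kint Lint by auto
    show "Int_stable {a \<times> b |a b. a \<in> sets M \<and> b \<in> sets M}" by (rule Int_stable_pair_measure_generator)
    show "{a \<times> b |a b. a \<in> sets M \<and> b \<in> sets M} \<subseteq> Pow (space (M \<Otimes>\<^sub>M M))"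
      using pair_measure_closed[of M M] by (simp add: space_pair_measure)
    show "sets (M \<Otimes>\<^sub>M M) = sigma_sets (space (M \<Otimes>\<^sub>M M)) {a \<times> b |a b. a \<in> sets M \<and> b \<in> sets M}"
      by (simp add: sets_pair_measure space_pair_measure)
    show "space (M \<Otimes>\<^sub>M M) \<in> {a \<times> b |a b. a \<in> sets M \<and> b \<in> sets M}"
      by (auto simp: space_pair_measure)
    fix E assume "E \<in> {a \<times> b |a b. a \<in> sets M \<and> b \<in> sets M}"
    then obtain A B where E: "E = A \<times> B" and [measurable]: "A \<in> sets M" "B \<in> sets M" by auto
    let ?a = "real_cond_exp M G (indicator A)" and ?b = "real_cond_exp M G (indicator B)"
    have iA: "integrable M (indicator A :: _ \<Rightarrow> real)" and iB: "integrable M (indicator B :: _ \<Rightarrow> real)"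
      by (auto intro!: M.integrable_const_bound[where B=1] simp: indicator_def)
    have [measurable]: "(\<lambda>z. ?a (fst z) * ?b (snd z)) \<in> borel_measurable (G \<Otimes>\<^sub>M G)" by measurable
    have abs_ab: "AE x in M. \<bar>?a x\<bar> \<le> 1" "AE x in M. \<bar>?b x\<bar> \<le> 1"
    proof -
      have *: "AE x in M. \<bar>real_cond_exp M G (indicator C) x\<bar> \<le> 1" if "C \<in> sets M" for C
      proof -
        have i: "integrable M (indicator C :: _ \<Rightarrow> real)" using that
          by (auto intro!: M.integrable_const_bound[where B=1] simp: indicator_def)
        have "AE x in M. real_cond_exp M G (indicator C) x \<le> 1" "AE x in M. real_cond_exp M G (indicator C) x \<ge> 0"
          using i by (auto intro!: G.real_cond_exp_le_c G.real_cond_exp_ge_c simp: indicator_def)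
        then show ?thesis by eventually_elim auto
      qed
      show "AE x in M. \<bar>?a x\<bar> \<le> 1" "AE x in M. \<bar>?b x\<bar> \<le> 1" using *[of A] *[of B] by auto
    qed
    have ab1: "AE z in M \<Otimes>\<^sub>M M. \<bar>?a (fst z) * ?b (snd z)\<bar> \<le> 1"
    proof (rule AE_pair_measure)
      show "AE x in M. AE y in M. \<bar>?a (fst (x, y)) * ?b (snd (x, y))\<bar> \<le> 1"
        using abs_ab(1)
      proof eventually_elim
        case (elim x)
        from abs_ab(2) show ?case
          by eventually_elim (use elim in \<open>auto simp: abs_mult intro!: mult_le_one\<close>)
      qed
    qed measurable
    have abK: "integrable (M \<Otimes>\<^sub>M M) (\<lambda>z. ?a (fst z) * ?b (snd z) * K z)"
    proof (rule integrable_const_bound[where B=1])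
      show "AE z in M \<Otimes>\<^sub>M M. norm (?a (fst z) * ?b (snd z) * K z) \<le> 1"
        using ab1 by eventually_elim (use bd in \<open>auto simp: abs_mult[of _ "K _"] intro!: mult_le_one\<close>)
    qed measurable
    \<comment> \<open>Condition the indicators, exchange \<open>K\<close> for its conditional
      expectation, clamp, and undo the conditioning.\<close>
    have "(\<integral>z. indicator A (fst z) * indicator B (snd z) * K z \<partial>(M \<Otimes>\<^sub>M M)) = (\<integral>z. ?a (fst z) * ?b (snd z) * K z \<partial>(M \<Otimes>\<^sub>M M))"
      by (rule cond_exp_bilinear[OF M sub K bd T1 T2 iA iB])
    also have "\<dots> = (\<integral>z. ?a (fst z) * ?b (snd z) * L0 z \<partial>(M \<Otimes>\<^sub>M M))"
      unfolding L0_def by (rule GG.real_cond_exp_intg(2)[symmetric]) (use abK in auto)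
    also have "\<dots> = (\<integral>z. ?a (fst z) * ?b (snd z) * L z \<partial>(M \<Otimes>\<^sub>M M))"
      by (rule integral_cong_AE) (use L0L in auto)
    also have "\<dots> = (\<integral>z. indicator A (fst z) * indicator B (snd z) * L z \<partial>(M \<Otimes>\<^sub>M M))"
      by (rule cond_exp_bilinear[OF M sub LM Lbd T1' T2' iA iB, symmetric])
    finally have eq: "(\<integral>z. indicator A (fst z) * indicator B (snd z) * K z \<partial>(M \<Otimes>\<^sub>M M)) =
        (\<integral>z. indicator A (fst z) * indicator B (snd z) * L z \<partial>(M \<Otimes>\<^sub>M M))" .
    have ind: "indicator E z = (indicator A (fst z) * indicator B (snd z) :: real)" for z
      unfolding E by (cases z) (auto simp: indicator_def)
    have "E \<in> sets (M \<Otimes>\<^sub>M M)" unfolding E by measurable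
    then have "integrable (M \<Otimes>\<^sub>M M) (\<lambda>z. indicator E z * K z)" "integrable (M \<Otimes>\<^sub>M M) (\<lambda>z. indicator E z * L z)"
      using integrable_mult_indicator[OF _ Kint] integrable_mult_indicator[OF _ Lint] by auto
    then show "(\<integral>z. indicator E z * (K z - L z) \<partial>(M \<Otimes>\<^sub>M M)) = 0"
      using eq by (simp add: ind right_diff_distrib)
  qed
  then have "AE z in M \<Otimes>\<^sub>M M. K z = L z" by simp
  then show ?thesis using that LG Lbd by blast
qed

section \<open>The sigma-algebra shared by two factors of a coupling\<close>

locale coupled_factors =
  fixes M :: "'a measure" and N :: "'b measure" and N' :: "'c measure" and p p'
  assumes M: "prob_space M" and p: "meas_pres M N p" and p': "meas_pres M N' p'"
begin

text \<open>Null sets must be ignored: a function of \<open>p s\<close> will be compared with a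
  function of \<open>p' s\<close> that agrees with it only almost everywhere.\<close>

definition common_sets :: "'a set set" where
  "common_sets = {S \<in> sets M. \<exists>A \<in> sets N. \<exists>A' \<in> sets N'.
     (AE s in M. s \<in> S \<longleftrightarrow> p s \<in> A) \<and> (AE s in M. s \<in> S \<longleftrightarrow> p' s \<in> A')}"

definition common_alg :: "'a measure" where
  "common_alg = sigma (space M) common_sets"

lemma p_measurable [measurable]: "p \<in> measurable M N" "p' \<in> measurable M N'"
  using p p' by (auto simp: meas_pres_def)

lemma sigma_algebra_common_sets: "sigma_algebra (space M) common_sets"
  unfolding sigma_algebra_iff2
proof (intro conjI ballI allI impI)
  show "common_sets \<subseteq> Pow (space M)" using sets.sets_into_space by (auto simp: common_sets_def)
  show "{} \<in> common_sets" by (auto simp: common_sets_def intro!: bexI[of _ "{}"])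
next
  fix S assume "S \<in> common_sets"
  then obtain A A' where A: "S \<in> sets M" "A \<in> sets N" "A' \<in> sets N'"
    "AE s in M. s \<in> S \<longleftrightarrow> p s \<in> A" "AE s in M. s \<in> S \<longleftrightarrow> p' s \<in> A'" by (auto simp: common_sets_def)
  have "AE s in M. s \<in> space M - S \<longleftrightarrow> p s \<in> space N - A"
    using A(4) AE_space by eventually_elim (use measurable_space[OF p_measurable(1)] in auto)
  moreover have "AE s in M. s \<in> space M - S \<longleftrightarrow> p' s \<in> space N' - A'"
    using A(5) AE_space by eventually_elim (use measurable_space[OF p_measurable(2)] in auto)
  ultimately show "space M - S \<in> common_sets"
    unfolding common_sets_def using A(1-3) by blast
next
  fix S :: "nat \<Rightarrow> 'a set" assume "range S \<subseteq> common_sets"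
  then have S: "S i \<in> common_sets" for i by auto
  have "\<forall>i. \<exists>A. A \<in> sets N \<and> (AE s in M. s \<in> S i \<longleftrightarrow> p s \<in> A)" using S by (auto simp: common_sets_def)
  from choice[OF this] obtain A where A: "\<And>i. A i \<in> sets N" "\<And>i. AE s in M. s \<in> S i \<longleftrightarrow> p s \<in> A i" by blast
  have "\<forall>i. \<exists>A'. A' \<in> sets N' \<and> (AE s in M. s \<in> S i \<longleftrightarrow> p' s \<in> A')" using S by (auto simp: common_sets_def)
  from choice[OF this] obtain A' where A': "\<And>i. A' i \<in> sets N'" "\<And>i. AE s in M. s \<in> S i \<longleftrightarrow> p' s \<in> A' i" by blast
  have SM: "S i \<in> sets M" for i using S by (auto simp: common_sets_def)
  have "AE s in M. \<forall>i. s \<in> S i \<longleftrightarrow> p s \<in> A i" "AE s in M. \<forall>i. s \<in> S i \<longleftrightarrow> p' s \<in> A' i"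
    using A(2) A'(2) by (simp_all add: AE_all_countable)
  then have "AE s in M. s \<in> (\<Union>i. S i) \<longleftrightarrow> p s \<in> (\<Union>i. A i)" "AE s in M. s \<in> (\<Union>i. S i) \<longleftrightarrow> p' s \<in> (\<Union>i. A' i)"
    by (eventually_elim, auto)+
  moreover have "(\<Union>i. S i) \<in> sets M" "(\<Union>i. A i) \<in> sets N" "(\<Union>i. A' i) \<in> sets N'" using A A' SM by auto
  ultimately show "(\<Union>i. S i) \<in> common_sets"
    unfolding common_sets_def by blast
qed

lemma space_common_alg: "space common_alg = space M"
  and sets_common_alg: "sets common_alg = common_sets"
proof -
  interpret sigma_algebra "space M" common_sets by (rule sigma_algebra_common_sets)
  show "space common_alg = space M" "sets common_alg = common_sets"
    unfolding common_alg_def using space_closed by (simp_all add: sets_measure_of_eq)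
qed

lemma subalgebra_common_alg: "subalgebra M common_alg"
  by (auto simp: subalgebra_def space_common_alg sets_common_alg common_sets_def)

lemma measurable_common_alg:
  fixes f :: "'a \<Rightarrow> real"
  assumes [measurable]: "f \<in> borel_measurable M" "k \<in> borel_measurable N" "k' \<in> borel_measurable N'"
    and "AE s in M. f s = k (p s)" "AE s in M. f s = k' (p' s)"
  shows "f \<in> borel_measurable common_alg"
proof (rule measurableI)
  fix A :: "real set" assume [measurable]: "A \<in> sets borel"
  have "AE s in M. s \<in> f -` A \<inter> space M \<longleftrightarrow> p s \<in> k -` A \<inter> space N"
    using assms(4) AE_space by eventually_elim (use measurable_space[OF p_measurable(1)] in auto)
  moreover have "AE s in M. s \<in> f -` A \<inter> space M \<longleftrightarrow> p' s \<in> k' -` A \<inter> space N'"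
    using assms(5) AE_space by eventually_elim (use measurable_space[OF p_measurable(2)] in auto)
  moreover have "f -` A \<inter> space M \<in> sets M" "k -` A \<inter> space N \<in> sets N" "k' -` A \<inter> space N' \<in> sets N'"
    by measurable
  ultimately show "f -` A \<inter> space common_alg \<in> sets common_alg"
    unfolding space_common_alg sets_common_alg common_sets_def by blast
qed auto

text \<open>Integrating the kernel over \<open>t\<close> gives a function of \<open>p s\<close> that
  is almost everywhere a function of \<open>p' s\<close>, so the kernel is measurable for the common
  sigma-algebra in both variables and depends on countably many common sets \<open>B i\<close>. Each
  of them is an event \<open>A i\<close> of \<open>N\<close> and an event \<open>A' i\<close> of
  \<open>N'\<close> up to null sets; the codes by \<open>A\<close> and by \<open>A'\<close> have the
  same law because each has the law of \<open>code B\<close> under \<open>M\<close>.\<close>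

lemma common_kernel:
  fixes V :: "'b \<times> 'b \<Rightarrow> real" and V' :: "'c \<times> 'c \<Rightarrow> real"
  assumes [measurable]: "V \<in> borel_measurable (N \<Otimes>\<^sub>M N)" "V' \<in> borel_measurable (N' \<Otimes>\<^sub>M N')"
    and sym: "\<And>x y. V (x, y) = V (y, x)" and bd: "\<And>z. \<bar>V z\<bar> \<le> 1"
    and eq: "AE z in M \<Otimes>\<^sub>M M. V (p (fst z), p (snd z)) = V' (p' (fst z), p' (snd z))"
  obtains A A' U where "\<And>i::nat. A i \<in> sets N" "\<And>i::nat. A' i \<in> sets N'"
    "U \<in> borel_measurable (cantor_space \<Otimes>\<^sub>M cantor_space)"
    "distr N cantor_space (code A) = distr N' cantor_space (code A')"
    "AE z in N \<Otimes>\<^sub>M N. V z = U (code_pair A z)" "AE z in N' \<Otimes>\<^sub>M N'. V' z = U (code_pair A' z)"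
proof -
  interpret M: prob_space M by (rule M)
  interpret MM: pair_prob_space M M by (intro pair_prob_spaceI M)
  define K where "K z = V (p (fst z), p (snd z))" for z
  have K[measurable]: "K \<in> borel_measurable (M \<Otimes>\<^sub>M M)" unfolding K_def by measurable
  have Kbd: "\<bar>K z\<bar> \<le> 1" for z unfolding K_def by (rule bd)
  have T1: "(\<lambda>s. \<integral>t. g t * K (s, t) \<partial>M) \<in> borel_measurable common_alg" if [measurable]: "g \<in> borel_measurable M" for g
  proof (rule measurable_common_alg)
    show "(\<lambda>x. \<integral>t. g t * V (x, p t) \<partial>M) \<in> borel_measurable N" by measurable
    show "(\<lambda>x. \<integral>t. g t * V' (x, p' t) \<partial>M) \<in> borel_measurable N'" by measurable
    have "AE s in M. AE t in M. K (s, t) = V' (p' s, p' t)"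
      using MM.AE_pair[OF eq] by (simp add: K_def)
    then show "AE s in M. (\<integral>t. g t * K (s, t) \<partial>M) = (\<integral>t. g t * V' (p' s, p' t) \<partial>M)"
      using AE_space
    proof eventually_elim
      case (elim s)
      have [measurable]: "(\<lambda>t. K (s, t)) \<in> borel_measurable M" "(\<lambda>t. V' (p' s, p' t)) \<in> borel_measurable M"
        using elim(2) measurable_space[OF p_measurable(2) elim(2)] by measurable
      show ?case by (rule integral_cong_AE) (use elim(1) in \<open>auto elim: AE_mp\<close>)
    qed
  qed (auto simp: K_def)
  have T2: "(\<lambda>t. \<integral>s. g s * K (s, t) \<partial>M) \<in> borel_measurable common_alg" if "g \<in> borel_measurable M" for g
    using T1[OF that] by (simp add: K_def sym)
  obtain L where L: "L \<in> borel_measurable (common_alg \<Otimes>\<^sub>M common_alg)" "\<And>z. \<bar>L z\<bar> \<le> 1" "AE z in M \<Otimes>\<^sub>M M. K z = L z"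
    using measurable_wrt_product_subalgebra[OF M subalgebra_common_alg K Kbd T1 T2] by blast
  \<comment> \<open>The measure is restricted to the common sigma-algebra so that the sets
    \<open>B i\<close> found by approximation are themselves common sets.\<close>
  define R where "R = restr_to_subalg M common_alg"
  have R: "prob_space R" unfolding R_def by (rule prob_space_restr_to_subalg[OF subalgebra_common_alg M])
  have setsR: "sets R = common_sets" unfolding R_def by (simp add: sets_restr_to_subalg[OF subalgebra_common_alg] sets_common_alg)
  interpret RR: pair_prob_space R R by (intro pair_prob_spaceI R)
  have "sets (R \<Otimes>\<^sub>M R) = sets (common_alg \<Otimes>\<^sub>M common_alg)"
    by (intro sets_pair_measure_cong) (simp_all add: setsR sets_common_alg)
  then have LR[measurable]: "L \<in> borel_measurable (R \<Otimes>\<^sub>M R)" using L(1) by (simp cong: measurable_cong_sets)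
  have "integrable (R \<Otimes>\<^sub>M R) L"
    by (rule RR.integrable_const_bound[where B=1]) (use L in auto)
  from factors_through_cantor[OF R this] obtain B U where B: "\<And>i. B i \<in> sets R"
    and U[measurable]: "U \<in> borel_measurable (cantor_space \<Otimes>\<^sub>M cantor_space)"
    and LU: "AE z in R \<Otimes>\<^sub>M R. L z = U (code_pair B z)" by blast
  \<comment> \<open>The identity preserves measure from \<open>M\<close> to \<open>R\<close>, and
    hence carries the a.e. statement about \<open>R\<close> back to \<open>M\<close>.\<close>
  have id: "meas_pres M R (\<lambda>x. x)"
    unfolding meas_pres_def
  proof
    show m: "(\<lambda>x. x) \<in> measurable M R"
      by (auto simp: measurable_def setsR R_def space_restr_to_subalg) (auto simp: setsR[unfolded R_def] common_sets_def)
    show "distr M R (\<lambda>x. x) = R"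
    proof (rule measure_eqI)
      fix A assume "A \<in> sets (distr M R (\<lambda>x. x))"
      then have A: "A \<in> sets R" by simp
      then have "A \<subseteq> space M" using sets.sets_into_space[OF A] by (simp add: R_def space_restr_to_subalg)
      with A show "emeasure (distr M R (\<lambda>x. x)) A = emeasure R A"
        by (simp add: emeasure_distr[OF m] Int_absorb2)
          (simp add: R_def emeasure_restr_to_subalg[OF subalgebra_common_alg] sets_common_alg setsR[unfolded R_def])
    qed simp
  qed
  have "AE z in M \<Otimes>\<^sub>M M. L z = U (code_pair B z)"
    using AE_meas_pres[OF meas_pres_pair[OF R id] LU] by simp
  with L(3) have KU: "AE z in M \<Otimes>\<^sub>M M. K z = U (code_pair B z)" by eventually_elim simp
  have "\<forall>i. \<exists>A. A \<in> sets N \<and> (AE s in M. s \<in> B i \<longleftrightarrow> p s \<in> A)" using B by (auto simp: setsR common_sets_def)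
  from choice[OF this] obtain A where A[measurable]: "\<And>i. A i \<in> sets N" and BA: "\<And>i. AE s in M. s \<in> B i \<longleftrightarrow> p s \<in> A i" by blast
  have "\<forall>i. \<exists>A'. A' \<in> sets N' \<and> (AE s in M. s \<in> B i \<longleftrightarrow> p' s \<in> A')" using B by (auto simp: setsR common_sets_def)
  from choice[OF this] obtain A' where A'[measurable]: "\<And>i. A' i \<in> sets N'" and BA': "\<And>i. AE s in M. s \<in> B i \<longleftrightarrow> p' s \<in> A' i" by blast
  have BM[measurable]: "B i \<in> sets M" for i using B by (auto simp: setsR common_sets_def)
  have "AE s in M. \<forall>i. s \<in> B i \<longleftrightarrow> p s \<in> A i" "AE s in M. \<forall>i. s \<in> B i \<longleftrightarrow> p' s \<in> A' i"
    using BA BA' by (simp_all add: AE_all_countable)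
  then have cp: "AE s in M. code B s = code A (p s)" and cp': "AE s in M. code B s = code A' (p' s)"
    by (eventually_elim, auto simp: code_def)+
  have pull: "AE z in M \<Otimes>\<^sub>M M. P (fst z) \<and> P (snd z)" if ae: "AE s in M. P s" for P
  proof -
    obtain X where X: "{x \<in> space M. \<not> P x} \<subseteq> X" "emeasure M X = 0" "X \<in> sets M"
      using AE_E[OF ae] by blast
    then have n: "AE s in M. s \<notin> X" by (intro AE_not_in) auto
    note X(3)[measurable]
    have "AE z in M \<Otimes>\<^sub>M M. fst z \<notin> X \<and> snd z \<notin> X"
    proof (rule MM.AE_pair_measure)
      show "AE x in M. AE y in M. fst (x, y) \<notin> X \<and> snd (x, y) \<notin> X"
        using n by eventually_elim (use n in auto)
    qed measurable
    then show ?thesis using AE_space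
      by eventually_elim (use X(1) in \<open>auto simp: space_pair_measure\<close>)
  qed
  have [measurable]: "code_pair A \<in> measurable (N \<Otimes>\<^sub>M N) (cantor_space \<Otimes>\<^sub>M cantor_space)"
    "code_pair A' \<in> measurable (N' \<Otimes>\<^sub>M N') (cantor_space \<Otimes>\<^sub>M cantor_space)" 
    "code A \<in> measurable N cantor_space" "code A' \<in> measurable N' cantor_space" "code B \<in> measurable M cantor_space"
    by (auto intro!: measurable_code_pair measurable_code)
  have N: "prob_space N" "prob_space N'" using prob_space_meas_pres p p' M by auto
  have 1: "AE z in N \<Otimes>\<^sub>M N. V z = U (code_pair A z)"
  proof (subst AE_meas_pres_iff[OF meas_pres_pair[OF N(1) p]])
    show "AE z in M \<Otimes>\<^sub>M M. V (p (fst z), p (snd z)) = U (code_pair A (p (fst z), p (snd z)))"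
      using KU pull[OF cp] by eventually_elim (simp add: K_def code_pair_def)
  qed measurable
  have 2: "AE z in N' \<Otimes>\<^sub>M N'. V' z = U (code_pair A' z)"
  proof (subst AE_meas_pres_iff[OF meas_pres_pair[OF N(2) p']])
    show "AE z in M \<Otimes>\<^sub>M M. V' (p' (fst z), p' (snd z)) = U (code_pair A' (p' (fst z), p' (snd z)))"
      using KU pull[OF cp'] eq by eventually_elim (simp add: K_def code_pair_def)
  qed measurable
  have "distr N cantor_space (code A) = distr M cantor_space (\<lambda>s. code A (p s))"
    using p distr_distr[of "code A" N cantor_space p M] by (simp add: meas_pres_def comp_def)
  also have "\<dots> = distr M cantor_space (\<lambda>s. code A' (p' s))"
    by (rule distr_cong_AE) (use cp cp' in auto)
  also have "\<dots> = distr N' cantor_space (code A')"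
    using p' distr_distr[of "code A'" N' cantor_space p' M] by (simp add: meas_pres_def comp_def)
  finally have 3: "distr N cantor_space (code A) = distr N' cantor_space (code A')" .
  show ?thesis by (rule that[OF A A' U 3 1 2])
qed

end

section \<open>Compactness of empirical measures on the Cantor space\<close>

text \<open>The ternary embedding, with bits as digits 0 and 2. It brings the Cantor space into the
  real line, where tightness gives weakly convergent subsequences.\<close>

definition cantor_embed :: "(nat \<Rightarrow> bool) \<Rightarrow> real" where
  "cantor_embed z = (\<Sum>i. 2 * of_bool (z i) * (1/3) ^ Suc i)"

text \<open>On embedded points this is the first bit: it is 0 up to 1/3, 1 from 2/3 on, and linear
  across the removed middle third. Reading bits by continuous functions is what lets them pass
  through a weak limit.\<close>

definition first_digit :: "real \<Rightarrow> real" where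
  "first_digit t = max 0 (min 1 (3 * t - 1))"

definition digit_shift :: "real \<Rightarrow> real" where
  "digit_shift t = 3 * t - 2 * first_digit t"

definition digit :: "nat \<Rightarrow> real \<Rightarrow> real" where
  "digit i t = first_digit ((digit_shift ^^ i) t)"

text \<open>Under the limit measure almost all digits turn out to be 0 or 1, so the threshold may be
  anything strictly between.\<close>

definition cantor_digits :: "real \<Rightarrow> nat \<Rightarrow> bool" where
  "cantor_digits t = (\<lambda>i. digit i t \<ge> 1/2)"

lemma summable_cantor_embed: "summable (\<lambda>i. 2 * of_bool (z i) * (1/3::real) ^ Suc i)"
proof (rule summable_comparison_test')
  show "summable (\<lambda>i. 2 * (1/3::real) ^ Suc i)"
    by (intro summable_mult) (simp add: summable_mult summable_geometric)
qed auto

lemma cantor_embed_nonneg: "0 \<le> cantor_embed z"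
  unfolding cantor_embed_def by (rule suminf_nonneg[OF summable_cantor_embed]) auto

lemma cantor_embed_le_1: "cantor_embed z \<le> 1"
proof -
  have s: "(\<lambda>i. 2 * (1/3) * (1/3::real) ^ i) sums (2 * (1/3) * (1 / (1 - 1/3)))"
    by (intro sums_mult geometric_sums) auto
  have "cantor_embed z \<le> (\<Sum>i. 2 * (1/3) * (1/3::real) ^ i)"
    unfolding cantor_embed_def
    by (rule suminf_le[OF _ summable_cantor_embed sums_summable[OF s]]) auto
  also have "\<dots> = 1" using sums_unique[OF s] by simp
  finally show ?thesis .
qed

lemma cantor_embed_rec: "cantor_embed z = (2 * of_bool (z 0) + cantor_embed (\<lambda>i. z (Suc i))) / 3"
proof -
  have "cantor_embed z = (\<Sum>i. 2 * of_bool (z (Suc i)) * (1/3::real) ^ Suc (Suc i)) + 2 * of_bool (z 0) * (1/3)"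
    unfolding cantor_embed_def using suminf_split_head[OF summable_cantor_embed[of z]] by simp
  also have "(\<Sum>i. 2 * of_bool (z (Suc i)) * (1/3::real) ^ Suc (Suc i)) = (\<Sum>i. (1/3) * (2 * of_bool (z (Suc i)) * (1/3::real) ^ Suc i))"
    by (rule suminf_cong) simp
  also have "\<dots> = (1/3) * cantor_embed (\<lambda>i. z (Suc i))"
    unfolding cantor_embed_def by (rule suminf_mult[OF summable_cantor_embed])
  finally show ?thesis by simp
qed

lemma first_digit_embed: "first_digit (cantor_embed z) = of_bool (z 0)"
  using cantor_embed_nonneg[of "\<lambda>i. z (Suc i)"] cantor_embed_le_1[of "\<lambda>i. z (Suc i)"]
  by (subst cantor_embed_rec) (auto simp: first_digit_def)

lemma digit_shift_embed: "digit_shift (cantor_embed z) = cantor_embed (\<lambda>i. z (Suc i))"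
  unfolding digit_shift_def first_digit_embed by (subst cantor_embed_rec) (auto simp: field_simps)

lemma digit_embed: "digit i (cantor_embed z) = of_bool (z i)"
proof -
  have "(digit_shift ^^ i) (cantor_embed z) = cantor_embed (\<lambda>k. z (k + i))"
    by (induction i) (simp_all add: digit_shift_embed)
  then show ?thesis by (simp add: digit_def first_digit_embed)
qed

lemma cantor_digits_embed [simp]: "cantor_digits (cantor_embed z) = z"
  by (simp add: cantor_digits_def digit_embed fun_eq_iff)

lemma continuous_on_digit: "continuous_on UNIV (digit i)"
proof -
  have f: "continuous_on UNIV first_digit" unfolding first_digit_def by (intro continuous_intros)
  then have s: "continuous_on UNIV digit_shift" unfolding digit_shift_def by (intro continuous_intros)
  have "continuous_on UNIV (digit_shift ^^ i)"
  proof (induction i)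
    case (Suc i)
    then show ?case using continuous_on_compose[OF Suc continuous_on_subset[OF s]] by simp
  qed simp
  then show ?thesis unfolding digit_def using continuous_on_compose2[OF f] by auto
qed

lemma digit_nonneg: "0 \<le> digit i t" and digit_le_1: "digit i t \<le> 1"
  by (auto simp: digit_def first_digit_def)

lemma measurable_digit [measurable]: "digit i \<in> borel_measurable borel"
  by (rule borel_measurable_continuous_onI[OF continuous_on_digit])

lemma measurable_cantor_digits [measurable]: "cantor_digits \<in> measurable borel cantor_space"
  by (rule measurable_cantorI) (simp add: cantor_digits_def)

lemma measurable_cantor_embed [measurable]: "cantor_embed \<in> borel_measurable cantor_space"
  unfolding cantor_embed_def by measurable

text \<open>Only positive conditions on bits are counted: these cylinders are closed under
  intersection and generate the sigma-algebra, hence their frequencies determine a law.\<close>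

definition freq :: "nat \<Rightarrow> (nat \<Rightarrow> nat \<Rightarrow> bool) \<Rightarrow> nat set \<Rightarrow> real" where
  "freq n z I = real (card {v. v < n \<and> (\<forall>i\<in>I. z v i)}) / real n"

lemma cantor_cylinder [measurable]: "finite I \<Longrightarrow> {s. \<forall>i\<in>I. s i} \<in> sets cantor_space"
proof -
  assume "finite I"
  then have "{s \<in> space cantor_space. \<forall>i\<in>I. s i} \<in> sets cantor_space" by measurable
  then show ?thesis by simp
qed

text \<open>A frequency is the integral of a product of the continuous functions
  \<open>digit i\<close> under the embedded empirical measure, so weak convergence along one
  subsequence settles all finite \<open>I\<close> at once.\<close>

lemma cantor_empirical_compactness:
  assumes n: "\<And>m. n m > (0::nat)"
  obtains r \<mu> where "strict_mono (r :: nat \<Rightarrow> nat)" "prob_space \<mu>" "sets \<mu> = sets cantor_space"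
    "\<And>I. finite I \<Longrightarrow> (\<lambda>m. freq (n (r m)) (z (r m)) I) \<longlonglongrightarrow> measure \<mu> {s. \<forall>i\<in>I. s i}"
proof -
  define \<nu> where "\<nu> m = distr (measure_pmf (pmf_of_set {..<n m})) borel (\<lambda>v. cantor_embed (z m v))" for m
  have ne: "{..<n m} \<noteq> {}" for m using n[of m] by (auto simp: lessThan_empty_iff)
  have rd: "real_distribution (\<nu> m)" for m
    unfolding \<nu>_def by (intro prob_space.real_distribution_distr measure_pmf.prob_space_axioms) auto
  have int: "integral\<^sup>L (\<nu> m) g = (\<Sum>v<n m. g (cantor_embed (z m v))) / real (n m)"
    if [measurable]: "g \<in> borel_measurable borel" for g :: "real \<Rightarrow> real" and m
    unfolding \<nu>_def by (subst integral_distr) (auto simp: integral_pmf_of_set[OF ne])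
  have "tight \<nu>"
    unfolding tight_def
  proof (intro conjI allI impI rd)
    fix \<epsilon> :: real assume "\<epsilon> > 0"
    \<comment> \<open>Embedded points lie in [0, 1] and include 0; tightness speaks of intervals
      open on the left, so the left end is taken below 0.\<close>
    have "measure (\<nu> m) {-1<..1} = 1" for m
    proof -
      have "measure (\<nu> m) {-1<..1} = measure (measure_pmf (pmf_of_set {..<n m})) ((\<lambda>v. cantor_embed (z m v)) -` {-1<..1} \<inter> UNIV)"
        unfolding \<nu>_def by (subst measure_distr) auto
      also have "(\<lambda>v. cantor_embed (z m v)) -` {-1<..1} \<inter> UNIV = UNIV"
      proof -
        have "-1 < cantor_embed w" for w using cantor_embed_nonneg[of w] by linarith
        then show ?thesis using cantor_embed_le_1 by auto
      qed
      finally show ?thesis by simp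
    qed
    then show "\<exists>a b. a < b \<and> (\<forall>m. 1 - \<epsilon> < measure (\<nu> m) {a<..b})"
      using \<open>\<epsilon> > 0\<close> by (intro exI[of _ "-1"] exI[of _ 1]) auto
  qed
  from tight_imp_convergent_subsubsequence[OF this strict_mono_id]
  obtain r N where r: "strict_mono (r :: nat \<Rightarrow> nat)" and N: "real_distribution N" and wc: "weak_conv_m (\<nu> \<circ> id \<circ> r) N"
    by blast
  interpret N: real_distribution N by fact
  have conv: "(\<lambda>m. integral\<^sup>L (\<nu> (r m)) g) \<longlonglongrightarrow> integral\<^sup>L N g"
    if "continuous_on UNIV g" "\<And>t. \<bar>g t\<bar> \<le> 1" for g :: "real \<Rightarrow> real"
    using weak_conv_imp_integral_bdd_continuous_conv[of "\<nu> \<circ> id \<circ> r" N g 1] rd N wc that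
    by (auto simp: continuous_on_eq_continuous_at)
  \<comment> \<open>\<open>digit i t * (1 - digit i t)\<close> is continuous, nonnegative and 0 at
    every embedded point. Its integral under the weak limit is therefore 0, which forces digits of
    the limit to be bits.\<close>
  have dig: "AE t in N. digit i t = 0 \<or> digit i t = 1" for i
  proof -
    let ?g = "\<lambda>t. digit i t * (1 - digit i t)"
    have g: "0 \<le> ?g t" "\<bar>?g t\<bar> \<le> 1" for t
      using digit_nonneg[of i t] digit_le_1[of i t] by (auto simp: abs_mult intro!: mult_le_one)
    have "(\<lambda>m. integral\<^sup>L (\<nu> (r m)) ?g) \<longlonglongrightarrow> integral\<^sup>L N ?g"
      using g by (intro conv continuous_intros continuous_on_digit)
    moreover have "integral\<^sup>L (\<nu> m) ?g = 0" for m
      by (subst int) (auto simp: digit_embed)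
    ultimately have "integral\<^sup>L N ?g = 0" by (simp add: LIMSEQ_const_iff)
    moreover have "integrable N ?g"
      by (rule N.integrable_const_bound[where B=1]) (use g in auto)
    ultimately have "AE t in N. ?g t = 0"
      using g by (subst (asm) integral_nonneg_eq_0_iff_AE) auto
    then show ?thesis by eventually_elim auto
  qed
  define \<mu> where "\<mu> = distr N cantor_space cantor_digits"
  have cd[measurable]: "cantor_digits \<in> measurable N cantor_space"
    using measurable_cantor_digits by (simp cong: measurable_cong_sets)
  have "prob_space \<mu>" unfolding \<mu>_def by (rule N.prob_space_distr) measurable
  moreover have "sets \<mu> = sets cantor_space" by (simp add: \<mu>_def)
  moreover have "(\<lambda>m. freq (n (r m)) (z (r m)) I) \<longlonglongrightarrow> measure \<mu> {s. \<forall>i\<in>I. s i}" if I: "finite I" for I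
  proof -
    let ?g = "\<lambda>t. \<Prod>i\<in>I. digit i t"
    have g: "\<bar>?g t\<bar> \<le> 1" for t
      by (auto simp: abs_prod digit_nonneg digit_le_1 intro!: prod_le_1)
    have gb: "?g (cantor_embed w) = of_bool (\<forall>i\<in>I. w i)" for w
      using I by (induction I rule: finite_induct) (auto simp: digit_embed)
    have "(\<lambda>m. integral\<^sup>L (\<nu> (r m)) ?g) \<longlonglongrightarrow> integral\<^sup>L N ?g"
      using g by (intro conv continuous_intros continuous_on_digit)
    moreover have "integral\<^sup>L (\<nu> m) ?g = freq (n m) (z m) I" for m
    proof -
      have "(\<Sum>v<n m. ?g (cantor_embed (z m v))) = (\<Sum>v<n m. if \<forall>i\<in>I. z m v i then 1 else 0)"
        unfolding gb by (intro sum.cong) auto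
      also have "\<dots> = real (card {v. v < n m \<and> (\<forall>i\<in>I. z m v i)})"
        by (subst sum.If_cases) (auto intro!: arg_cong[where f=card])
      finally show ?thesis unfolding freq_def by (subst int) auto
    qed
    moreover have "integral\<^sup>L N ?g = measure \<mu> {s. \<forall>i\<in>I. s i}"
    proof -
      have "AE t in N. \<forall>i. digit i t = 0 \<or> digit i t = 1" using dig by (simp add: AE_all_countable)
      then have "AE t in N. ?g t = indicator {t. \<forall>i\<in>I. cantor_digits t i} t"
      proof eventually_elim
        case (elim t)
        show ?case
        proof (cases "\<forall>i\<in>I. cantor_digits t i")
          case True
          then have "digit i t = 1" if "i \<in> I" for i using elim[rule_format, of i] that by (auto simp: cantor_digits_def)
          with True show ?thesis by simp
        next
          case False
          then obtain i where "i \<in> I" "\<not> cantor_digits t i" by auto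
          moreover then have "digit i t = 0" using elim[rule_format, of i] by (auto simp: cantor_digits_def)
          ultimately have "?g t = 0" using I by auto
          with False show ?thesis by simp
        qed
      qed
      moreover have [measurable]: "{t. \<forall>i\<in>I. cantor_digits t i} \<in> sets N"
        using measurable_sets[OF cd cantor_cylinder[OF I]] by (simp add: vimage_def)
      ultimately have "integral\<^sup>L N ?g = integral\<^sup>L N (indicator {t. \<forall>i\<in>I. cantor_digits t i})"
        by (intro integral_cong_AE) auto
      also have "\<dots> = measure N {t. \<forall>i\<in>I. cantor_digits t i}" by simp
      also have "\<dots> = measure \<mu> {s. \<forall>i\<in>I. s i}"
        unfolding \<mu>_def using I by (subst measure_distr) (auto simp: vimage_def)
      finally show ?thesis .
    qed
    ultimately show ?thesis by simp
  qed
  ultimately show ?thesis using that r by blast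
qed

section \<open>Cut-norm concentration of random graphs\<close>

definition graph_weight :: "'e set \<Rightarrow> ('e \<Rightarrow> real) \<Rightarrow> 'e set \<Rightarrow> real" where
  "graph_weight E p H = (\<Prod>e\<in>E. if e \<in> H then p e else 1 - p e)"

text \<open>Multiplying out the right-hand side: \<open>H\<close> is the set of factors from which
  \<open>f\<close> is chosen.\<close>

lemma sum_Pow_prod_if:
  fixes f g :: "'e \<Rightarrow> real"
  assumes "finite E"
  shows "(\<Sum>H\<in>Pow E. \<Prod>e\<in>E. if e \<in> H then f e else g e) = (\<Prod>e\<in>E. f e + g e)"
  using assms
proof (induction E rule: finite_induct)
  case (insert x E)
  have "(\<Sum>H\<in>Pow (insert x E). \<Prod>e\<in>insert x E. if e \<in> H then f e else g e)
    = (\<Sum>H\<in>Pow E. \<Prod>e\<in>insert x E. if e \<in> H then f e else g e)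
    + (\<Sum>H\<in>insert x ` Pow E. \<Prod>e\<in>insert x E. if e \<in> H then f e else g e)"
    unfolding Pow_insert using insert by (intro sum.union_disjoint) auto
  also have "(\<Sum>H\<in>Pow E. \<Prod>e\<in>insert x E. if e \<in> H then f e else g e) = (\<Sum>H\<in>Pow E. g x * (\<Prod>e\<in>E. if e \<in> H then f e else g e))"
    using insert by (intro sum.cong refl) auto
  also have "(\<Sum>H\<in>insert x ` Pow E. \<Prod>e\<in>insert x E. if e \<in> H then f e else g e) =
    (\<Sum>H\<in>Pow E. \<Prod>e\<in>insert x E. if e \<in> insert x H then f e else g e)"
  proof (subst sum.reindex)
    show "inj_on (insert x) (Pow E)" using insert(2) by (auto simp: inj_on_def)
  qed simp
  also have "\<dots> = (\<Sum>H\<in>Pow E. f x * (\<Prod>e\<in>E. if e \<in> H then f e else g e))"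
  proof (intro sum.cong refl)
    fix H assume "H \<in> Pow E"
    have "(\<Prod>e\<in>E. if e \<in> insert x H then f e else g e) = (\<Prod>e\<in>E. if e \<in> H then f e else g e)"
      using insert by (intro prod.cong) auto
    then show "(\<Prod>e\<in>insert x E. if e \<in> insert x H then f e else g e) = f x * (\<Prod>e\<in>E. if e \<in> H then f e else g e)"
      using insert by simp
  qed
  finally show ?case using insert by (simp add: sum_distrib_left[symmetric] algebra_simps)
qed simp

lemma graph_weight_nonneg: "(\<And>e. e \<in> E \<Longrightarrow> 0 \<le> p e \<and> p e \<le> 1) \<Longrightarrow> 0 \<le> graph_weight E p H"
  unfolding graph_weight_def by (intro prod_nonneg) auto

lemma sum_graph_weight: "finite E \<Longrightarrow> (\<Sum>H\<in>Pow E. graph_weight E p H) = 1"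
  unfolding graph_weight_def by (subst sum_Pow_prod_if) auto

lemma exp_le_quadratic:
  fixes s :: real
  assumes "\<bar>s\<bar> \<le> 1"
  shows "exp s \<le> 1 + s + s\<^sup>2"
proof (cases "s \<ge> 0")
  case True
  then show ?thesis using exp_bound[of s] assms by simp
next
  case False
  have "1 - s \<le> exp (- s)" using exp_ge_add_one_self[of "-s"] by simp
  then have "exp s \<le> 1 / (1 - s)" using False by (simp add: exp_minus field_simps)
  also have "\<dots> \<le> 1 + s + s\<^sup>2"
  proof -
    \<comment> \<open>\<open>(1 + s + s^2) * (1 - s) = 1 - s^3\<close>, which is at least 1 for
      negative \<open>s\<close>.\<close>
    have "s ^ 3 \<le> 0" using False by (simp add: power_less_zero_eq less_imp_le)
    then have "1 \<le> (1 + s + s\<^sup>2) * (1 - s)" by (simp add: power2_eq_square power3_eq_cube algebra_simps)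
    then show ?thesis using False by (simp add: field_simps)
  qed
  finally show ?thesis .
qed

text \<open>The exponent carries the factor \<open>p\<close>, the order of the variance. A Hoeffding
  exponent proportional to \<open>s\<^sup>2\<close> alone would ignore that edges are rare, and the
  union bound would then ask for \<open>n * \<rho>^2\<close> instead of \<open>n * \<rho>\<close> to
  be large.\<close>

lemma bernoulli_mgf_bound:
  fixes p s :: real
  assumes "0 \<le> p" "p \<le> 1" "\<bar>s\<bar> \<le> 1"
  shows "p * exp (s * (1 - p)) + (1 - p) * exp (s * (0 - p)) \<le> exp (s\<^sup>2 * p)"
proof -
  have "p * exp (s * (1 - p)) + (1 - p) * exp (s * (0 - p)) = (1 + p * (exp s - 1)) * exp (- (s * p))"
    by (simp add: algebra_simps exp_add exp_diff exp_minus divide_inverse)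
  also have "\<dots> \<le> exp (p * (exp s - 1)) * exp (- (s * p))"
    by (intro mult_right_mono exp_ge_add_one_self) auto
  also have "\<dots> = exp (p * (exp s - 1) - s * p)" by (simp add: exp_diff exp_minus divide_inverse)
  also have "\<dots> \<le> exp (p * (s + s\<^sup>2) - s * p)"
    using exp_le_quadratic[OF assms(3)] assms(1) by (auto intro!: mult_left_mono)
  also have "\<dots> = exp (s\<^sup>2 * p)" by (simp add: algebra_simps)
  finally show ?thesis .
qed

lemma graph_mgf_bound:
  fixes p s :: "'e \<Rightarrow> real"
  assumes "finite E" "\<And>e. e \<in> E \<Longrightarrow> 0 \<le> p e \<and> p e \<le> 1" "\<And>e. e \<in> E \<Longrightarrow> \<bar>s e\<bar> \<le> 1"
  shows "(\<Sum>H\<in>Pow E. graph_weight E p H * exp (\<Sum>e\<in>E. s e * (of_bool (e \<in> H) - p e))) \<le> exp (\<Sum>e\<in>E. (s e)\<^sup>2 * p e)"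
proof -
  have "(\<Sum>H\<in>Pow E. graph_weight E p H * exp (\<Sum>e\<in>E. s e * (of_bool (e \<in> H) - p e)))
    = (\<Sum>H\<in>Pow E. \<Prod>e\<in>E. if e \<in> H then p e * exp (s e * (1 - p e)) else (1 - p e) * exp (s e * (0 - p e)))"
    unfolding graph_weight_def exp_sum[OF assms(1)] prod.distrib[symmetric]
    by (intro sum.cong prod.cong refl) auto
  also have "\<dots> = (\<Prod>e\<in>E. p e * exp (s e * (1 - p e)) + (1 - p e) * exp (s e * (0 - p e)))"
    by (rule sum_Pow_prod_if[OF assms(1)])
  also have "\<dots> \<le> (\<Prod>e\<in>E. exp ((s e)\<^sup>2 * p e))"
    using assms by (intro prod_mono conjI bernoulli_mgf_bound add_nonneg_nonneg mult_nonneg_nonneg) auto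
  also have "\<dots> = exp (\<Sum>e\<in>E. (s e)\<^sup>2 * p e)" by (simp add: exp_sum assms(1))
  finally show ?thesis .
qed

text \<open>Chernoff's method for both signs, with \<open>\<theta>\<close> left free for a later
  choice. As \<open>m\<close> bounds the expected number of edges in all of \<open>E\<close>, the
  estimate is uniform in \<open>F\<close>.\<close>

lemma graph_tail_bound:
  fixes p :: "'e \<Rightarrow> real"
  assumes E: "finite E" "F \<subseteq> E" and p: "\<And>e. e \<in> E \<Longrightarrow> 0 \<le> p e \<and> p e \<le> 1" and l: "0 \<le> \<theta>" "\<theta> \<le> 1"
    and m: "(\<Sum>e\<in>E. p e) \<le> m"
  shows "(\<Sum>H\<in>Pow E. graph_weight E p H * of_bool (\<bar>\<Sum>e\<in>F. of_bool (e \<in> H) - p e\<bar> > a)) \<le> 2 * exp (\<theta>\<^sup>2 * m - \<theta> * a)"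
proof -
  have main: "(\<Sum>H\<in>Pow E. graph_weight E p H * exp (c * (\<Sum>e\<in>F. of_bool (e \<in> H) - p e) - \<theta> * a)) \<le> exp (\<theta>\<^sup>2 * m - \<theta> * a)"
    if c: "\<bar>c\<bar> = \<theta>" for c
  proof -
    define s where "s e = (if e \<in> F then c else 0)" for e
    have eq: "c * (\<Sum>e\<in>F. of_bool (e \<in> H) - p e) = (\<Sum>e\<in>E. s e * (of_bool (e \<in> H) - p e))" for H
    proof -
      have "(\<Sum>e\<in>E. s e * (of_bool (e \<in> H) - p e)) = (\<Sum>e\<in>E. if e \<in> F then c * (of_bool (e \<in> H) - p e) else 0)"
        by (intro sum.cong) (auto simp: s_def)
      also have "\<dots> = (\<Sum>e\<in>F. c * (of_bool (e \<in> H) - p e))"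
        using E by (simp add: sum.inter_restrict[symmetric] Int_absorb1)
      finally show ?thesis by (simp add: sum_distrib_left)
    qed
    have "(\<Sum>H\<in>Pow E. graph_weight E p H * exp (c * (\<Sum>e\<in>F. of_bool (e \<in> H) - p e) - \<theta> * a))
      = (\<Sum>H\<in>Pow E. graph_weight E p H * exp (\<Sum>e\<in>E. s e * (of_bool (e \<in> H) - p e))) * exp (- (\<theta> * a))"
      unfolding eq sum_distrib_right by (intro sum.cong refl) (simp add: exp_diff exp_minus divide_inverse)
    also have "\<dots> \<le> exp (\<Sum>e\<in>E. (s e)\<^sup>2 * p e) * exp (- (\<theta> * a))"
      using p l c by (intro mult_right_mono graph_mgf_bound E) (auto simp: s_def)
    also have "\<dots> \<le> exp (\<theta>\<^sup>2 * m) * exp (- (\<theta> * a))"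
    proof (intro mult_right_mono iffD2[OF exp_le_cancel_iff])
      have "(\<Sum>e\<in>E. (s e)\<^sup>2 * p e) \<le> (\<Sum>e\<in>E. \<theta>\<^sup>2 * p e)"
        using p c by (intro sum_mono mult_right_mono) (auto simp: s_def)
      also have "\<dots> = \<theta>\<^sup>2 * (\<Sum>e\<in>E. p e)" by (simp add: sum_distrib_left)
      also have "\<dots> \<le> \<theta>\<^sup>2 * m" using m by (intro mult_left_mono) auto
      finally show "(\<Sum>e\<in>E. (s e)\<^sup>2 * p e) \<le> \<theta>\<^sup>2 * m" .
    qed auto
    also have "\<dots> = exp (\<theta>\<^sup>2 * m - \<theta> * a)" by (simp add: exp_diff exp_minus divide_inverse)
    finally show ?thesis .
  qed
  have "(\<Sum>H\<in>Pow E. graph_weight E p H * of_bool (\<bar>\<Sum>e\<in>F. of_bool (e \<in> H) - p e\<bar> > a))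
    \<le> (\<Sum>H\<in>Pow E. graph_weight E p H * exp (\<theta> * (\<Sum>e\<in>F. of_bool (e \<in> H) - p e) - \<theta> * a)
        + graph_weight E p H * exp (- \<theta> * (\<Sum>e\<in>F. of_bool (e \<in> H) - p e) - \<theta> * a))"
  proof (intro sum_mono)
    fix H
    let ?X = "\<Sum>e\<in>F. of_bool (e \<in> H) - p e"
    have "of_bool (\<bar>?X\<bar> > a) \<le> exp (\<theta> * ?X - \<theta> * a) + exp (- \<theta> * ?X - \<theta> * a)"
    proof (cases "\<bar>?X\<bar> > a")
      case True
      then have one: "of_bool (\<bar>?X\<bar> > a) = (1::real)" and "a \<le> ?X \<or> a \<le> - ?X" by auto
      from this(2) show ?thesis
      proof
        assume "a \<le> ?X"
        then have "1 \<le> exp (\<theta> * ?X - \<theta> * a)" using l by (simp add: mult_left_mono)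
        moreover have "0 < exp (- \<theta> * ?X - \<theta> * a)" by simp
        ultimately show ?thesis using one by linarith
      next
        assume "a \<le> - ?X"
        then have "\<theta> * a \<le> \<theta> * (- ?X)" using l(1) by (rule mult_left_mono)
        then have "0 \<le> - \<theta> * ?X - \<theta> * a" by simp
        then have "1 \<le> exp (- \<theta> * ?X - \<theta> * a)" by (simp only: one_le_exp_iff)
        moreover have "0 < exp (\<theta> * ?X - \<theta> * a)" by simp
        ultimately show ?thesis using one by linarith
      qed
    qed (simp add: add_nonneg_nonneg)
    from mult_left_mono[OF this graph_weight_nonneg[of E p H, OF p]]
    show "graph_weight E p H * of_bool (\<bar>?X\<bar> > a) \<le> graph_weight E p H * exp (\<theta> * ?X - \<theta> * a) + graph_weight E p H * exp (- \<theta> * ?X - \<theta> * a)"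
      by (simp add: distrib_left)
  qed
  also have "\<dots> \<le> exp (\<theta>\<^sup>2 * m - \<theta> * a) + exp (\<theta>\<^sup>2 * m - \<theta> * a)"
    unfolding sum.distrib using main[of \<theta>] main[of "- \<theta>"] l by (intro add_mono) auto
  finally show ?thesis by simp
qed

text \<open>The smaller endpoint is the one in \<open>S\<close>. A full cut between \<open>S\<close>
  and \<open>T\<close> therefore splits into \<open>cut_edges n S T\<close> and
  \<open>cut_edges n T S\<close>.\<close>

definition cut_edges :: "nat \<Rightarrow> nat set \<Rightarrow> nat set \<Rightarrow> (nat \<times> nat) set" where
  "cut_edges n S T = {e \<in> pot_edges n. fst e \<in> S \<and> snd e \<in> T}"

lemma finite_pot_edges [simp]: "finite (pot_edges n)"
  by (rule finite_subset[of _ "{..<n} \<times> {..<n}"]) (auto simp: pot_edges_def)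

lemma cut_edges_subset: "cut_edges n S T \<subseteq> pot_edges n"
  by (auto simp: cut_edges_def)

lemma cut_edges_Int: "cut_edges n S T = cut_edges n (S \<inter> {..<n}) (T \<inter> {..<n})"
  by (auto simp: cut_edges_def pot_edges_def)

text \<open>Union bound over pairs of subsets of [n]; vertex sets reaching beyond [n] give the same
  cuts as their traces.\<close>

lemma graph_cut_bound:
  assumes p: "\<And>e. e \<in> pot_edges n \<Longrightarrow> 0 \<le> p e \<and> p e \<le> 1" and l: "0 \<le> \<theta>" "\<theta> \<le> 1"
    and m: "(\<Sum>e\<in>pot_edges n. p e) \<le> m"
  shows "(\<Sum>H\<in>Pow (pot_edges n). graph_weight (pot_edges n) p H *
      of_bool (\<exists>S T. \<bar>\<Sum>e\<in>cut_edges n S T. of_bool (e \<in> H) - p e\<bar> > a)) \<le> 4 ^ n * (2 * exp (\<theta>\<^sup>2 * m - \<theta> * a))"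
proof -
  let ?P = "Pow {..<n} \<times> Pow {..<n}"
  have "(\<Sum>H\<in>Pow (pot_edges n). graph_weight (pot_edges n) p H *
      of_bool (\<exists>S T. \<bar>\<Sum>e\<in>cut_edges n S T. of_bool (e \<in> H) - p e\<bar> > a))
    \<le> (\<Sum>H\<in>Pow (pot_edges n). graph_weight (pot_edges n) p H *
      (\<Sum>(S, T)\<in>?P. of_bool (\<bar>\<Sum>e\<in>cut_edges n S T. of_bool (e \<in> H) - p e\<bar> > a)))"
  proof (intro sum_mono mult_left_mono graph_weight_nonneg p)
    fix H
    let ?Q = "\<lambda>S T. \<bar>\<Sum>e\<in>cut_edges n S T. of_bool (e \<in> H) - p e\<bar> > a"
    show "of_bool (\<exists>S T. ?Q S T) \<le> (\<Sum>(S, T)\<in>?P. of_bool (?Q S T) :: real)"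
    proof (cases "\<exists>S T. ?Q S T")
      case True
      then obtain S T where "?Q S T" by blast
      then have Q: "?Q (S \<inter> {..<n}) (T \<inter> {..<n})" using cut_edges_Int[of n S T] by simp
      have "(\<lambda>(S, T). of_bool (?Q S T)) (S \<inter> {..<n}, T \<inter> {..<n}) \<le> (\<Sum>(S, T)\<in>?P. of_bool (?Q S T) :: real)"
        by (rule member_le_sum) auto
      with Q show ?thesis by simp
    qed (auto intro!: sum_nonneg)
  qed
  also have "\<dots> = (\<Sum>(S, T)\<in>?P. \<Sum>H\<in>Pow (pot_edges n). graph_weight (pot_edges n) p H *
      of_bool (\<bar>\<Sum>e\<in>cut_edges n S T. of_bool (e \<in> H) - p e\<bar> > a))"
    unfolding sum_distrib_left by (subst sum.swap) (simp add: split_beta')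
  also have "\<dots> \<le> (\<Sum>(S, T)\<in>?P. 2 * exp (\<theta>\<^sup>2 * m - \<theta> * a))"
    unfolding split_beta' by (intro sum_mono graph_tail_bound cut_edges_subset p l m) auto
  also have "\<dots> = 4 ^ n * (2 * exp (\<theta>\<^sup>2 * m - \<theta> * a))"
    by (simp add: card_cartesian_product card_Pow power_mult_distrib[symmetric])
  finally show ?thesis .
qed

section \<open>Sampling from a graphon\<close>

lemma meas_pres_PiM_pair:
  assumes M: "prob_space M" and I: "finite I" "i \<in> I" "j \<in> I" "i \<noteq> j"
  shows "meas_pres (PiM I (\<lambda>_. M)) (M \<Otimes>\<^sub>M M) (\<lambda>x. (x i, x j))"
proof -
  interpret M: prob_space M by fact
  interpret P: product_prob_space "\<lambda>_. M" I by unfold_locales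
  have m[measurable]: "(\<lambda>x. (x i, x j)) \<in> measurable (PiM I (\<lambda>_. M)) (M \<Otimes>\<^sub>M M)"
    using I by measurable
  have "M \<Otimes>\<^sub>M M = distr (PiM I (\<lambda>_. M)) (M \<Otimes>\<^sub>M M) (\<lambda>x. (x i, x j))"
  proof (rule pair_measure_eqI)
    fix A B assume AB[measurable]: "A \<in> sets M" "B \<in> sets M"
    define X where "X k = (if k = i then A else if k = j then B else space M)" for k
    have "A \<times> B \<in> sets (M \<Otimes>\<^sub>M M)" by measurable
    then have "emeasure (distr (PiM I (\<lambda>_. M)) (M \<Otimes>\<^sub>M M) (\<lambda>x. (x i, x j))) (A \<times> B) =
      emeasure (PiM I (\<lambda>_. M)) ((\<lambda>x. (x i, x j)) -` (A \<times> B) \<inter> space (PiM I (\<lambda>_. M)))"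
      by (rule emeasure_distr[OF m])
    also have "(\<lambda>x. (x i, x j)) -` (A \<times> B) \<inter> space (PiM I (\<lambda>_. M)) = PiE I X"
      using I sets.sets_into_space[OF AB(1)] sets.sets_into_space[OF AB(2)]
      by (auto simp: space_PiM X_def PiE_iff split: if_splits) (metis subsetD)
    also have "emeasure (PiM I (\<lambda>_. M)) (PiE I X) = (\<Prod>k\<in>I. emeasure M (X k))"
      using I AB by (intro P.emeasure_PiM) (auto simp: X_def)
    also have "\<dots> = emeasure M (X i) * (emeasure M (X j) * (\<Prod>k\<in>I - {i} - {j}. emeasure M (X k)))"
      using I by (simp add: prod.remove[of _ i] prod.remove[of _ j])
    also have "(\<Prod>k\<in>I - {i} - {j}. emeasure M (X k)) = 1"
      by (intro prod.neutral) (auto simp: X_def M.emeasure_space_1)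
    finally show "emeasure M A * emeasure M B = emeasure (distr (PiM I (\<lambda>_. M)) (M \<Otimes>\<^sub>M M) (\<lambda>x. (x i, x j))) (A \<times> B)"
      using I by (simp add: X_def)
  qed (auto intro: M.sigma_finite_measure_axioms)
  then show ?thesis using m by (simp add: meas_pres_def)
qed

lemma integral_meas_pres:
  fixes f :: "'b \<Rightarrow> real"
  assumes "meas_pres M N \<phi>" "integrable N f"
  shows "integrable M (\<lambda>x. f (\<phi> x))" "(\<integral>x. f (\<phi> x) \<partial>M) = (\<integral>y. f y \<partial>N)"
proof -
  have m: "\<phi> \<in> measurable M N" and d: "distr M N \<phi> = N" using assms by (auto simp: meas_pres_def)
  show "integrable M (\<lambda>x. f (\<phi> x))" using integrable_distr[OF m, of f] assms(2) d by simp
  show "(\<integral>x. f (\<phi> x) \<partial>M) = (\<integral>y. f y \<partial>N)" using integral_distr[OF m, of f] assms(2) d by simp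
qed

text \<open>The diagonal is left out because \<open>(x i, x i)\<close> does not have the product
  law: nothing integral over \<open>M \<Otimes>\<^sub>M M\<close> controls the values there.\<close>

lemma sample_pair_sum:
  fixes f :: "'a \<times> 'a \<Rightarrow> real"
  assumes M: "prob_space M" and f: "integrable (M \<Otimes>\<^sub>M M) f" and nn: "\<And>z. z \<in> space (M \<Otimes>\<^sub>M M) \<Longrightarrow> 0 \<le> f z"
  shows "integrable (PiM {..<n} (\<lambda>_. M)) (\<lambda>x. \<Sum>i<n. \<Sum>j\<in>{..<n} - {i}. f (x i, x j))"
    "(\<integral>x. (\<Sum>i<n. \<Sum>j\<in>{..<n} - {i}. f (x i, x j)) \<partial>PiM {..<n} (\<lambda>_. M)) \<le> (real n)\<^sup>2 * (\<integral>z. f z \<partial>(M \<Otimes>\<^sub>M M))"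
proof -
  let ?P = "PiM {..<n} (\<lambda>_. M)" and ?I = "\<integral>z. f z \<partial>(M \<Otimes>\<^sub>M M)"
  have ij: "integrable ?P (\<lambda>x. f (x i, x j))" "(\<integral>x. f (x i, x j) \<partial>?P) = ?I" if "i < n" "j \<in> {..<n} - {i}" for i j
    using integral_meas_pres[OF meas_pres_PiM_pair[OF M, of "{..<n}" i j] f] that by auto
  show int: "integrable ?P (\<lambda>x. \<Sum>i<n. \<Sum>j\<in>{..<n} - {i}. f (x i, x j))"
    by (intro Bochner_Integration.integrable_sum ij) auto
  have I0: "0 \<le> ?I" using nn by (intro integral_nonneg_AE AE_I2) auto
  have "(\<integral>x. (\<Sum>i<n. \<Sum>j\<in>{..<n} - {i}. f (x i, x j)) \<partial>?P) = (\<Sum>i<n. \<Sum>j\<in>{..<n} - {i}. \<integral>x. f (x i, x j) \<partial>?P)"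
    by (subst Bochner_Integration.integral_sum; (intro Bochner_Integration.integrable_sum sum.cong refl Bochner_Integration.integral_sum)?) (auto intro!: ij)
  also have "\<dots> = (\<Sum>i<n. \<Sum>j\<in>{..<n} - {i}. ?I)" by (intro sum.cong refl ij) auto
  also have "\<dots> \<le> (\<Sum>i<n. real n * ?I)"
  proof (intro sum_mono)
    fix i show "(\<Sum>j\<in>{..<n} - {i}. ?I) \<le> real n * ?I"
      using I0 card_mono[of "{..<n}" "{..<n} - {i}"] by (auto intro!: mult_right_mono)
  qed
  also have "\<dots> = (real n)\<^sup>2 * ?I" by (simp add: power2_eq_square)
  finally show "(\<integral>x. (\<Sum>i<n. \<Sum>j\<in>{..<n} - {i}. f (x i, x j)) \<partial>?P) \<le> (real n)\<^sup>2 * ?I" .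
qed

text \<open>Centred indicators at different coordinates are uncorrelated, so of the
  \<open>n^2\<close> products only the \<open>n\<close> squares survive, each with mean at most
  1.\<close>

lemma sample_frequency_variance:
  assumes M: "prob_space M" and A[measurable]: "A \<in> sets M" and n: "n > 0"
  shows "integrable (PiM {..<n} (\<lambda>_. M)) (\<lambda>x. ((\<Sum>v<n. indicator A (x v)) / real n - measure M A)\<^sup>2)"
    "(\<integral>x. ((\<Sum>v<n. indicator A (x v)) / real n - measure M A)\<^sup>2 \<partial>PiM {..<n} (\<lambda>_. M)) \<le> 1 / real n"
proof -
  interpret M: prob_space M by fact
  interpret MM: pair_prob_space M M by (intro pair_prob_spaceI M)
  interpret P: prob_space "PiM {..<n} (\<lambda>_. M)" by (intro prob_space_PiM M)
  let ?P = "PiM {..<n} (\<lambda>_. M)"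
  define g where "g y = indicator A y - measure M A" for y
  have g[measurable]: "g \<in> borel_measurable M" unfolding g_def by measurable
  have gb: "\<bar>g y\<bar> \<le> 1" for y
    unfolding g_def indicator_def abs_le_iff using M.prob_le_1[of A] measure_nonneg[of M A]
    by (cases "y \<in> A"; simp only: of_bool_eq simp_thms; linarith)
  have gsq: "g y * g y \<le> 1" for y
    using mult_le_one[OF gb abs_ge_zero gb, of y y] by simp
  have gi: "integrable M g" by (rule M.integrable_const_bound[where B=1]) (use gb in auto)
  have g0: "(\<integral>y. g y \<partial>M) = 0"
    unfolding g_def by (subst Bochner_Integration.integral_diff) (auto simp: M.prob_space intro!: M.integrable_const_bound[where B=1])
  have gg: "integrable (M \<Otimes>\<^sub>M M) (\<lambda>z. g (fst z) * g (snd z))"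
    by (rule MM.integrable_const_bound[where B=1]) (auto simp: abs_mult gb intro!: mult_le_one)
  have "(\<integral>z. g (fst z) * g (snd z) \<partial>(M \<Otimes>\<^sub>M M)) = (\<integral>y. \<integral>y'. g y * g y' \<partial>M \<partial>M)"
    using MM.integral_fst[of "\<lambda>y y'. g y * g y'"] gg by (simp add: split_beta')
  then have gg0: "(\<integral>z. g (fst z) * g (snd z) \<partial>(M \<Otimes>\<^sub>M M)) = 0" by (simp add: g0)
  have eq: "((\<Sum>v<n. indicator A (x v)) / real n - measure M A)\<^sup>2 = (\<Sum>i<n. \<Sum>j<n. g (x i) * g (x j)) / (real n)\<^sup>2" for x
  proof -
    have "(\<Sum>v<n. indicator A (x v)) / real n - measure M A = (\<Sum>v<n. g (x v)) / real n"
      using n by (simp add: g_def sum_subtractf field_simps)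
    then show ?thesis by (simp add: power_divide power2_eq_square sum_product)
  qed
  have ij: "integrable ?P (\<lambda>x. g (x i) * g (x j))" "(\<integral>x. g (x i) * g (x j) \<partial>?P) \<le> of_bool (i = j)" if "i < n" "j < n" for i j
  proof -
    have [measurable]: "(\<lambda>x. g (x k)) \<in> borel_measurable ?P" if "k < n" for k
      by (rule measurable_compose[OF _ g]) (use that in \<open>auto intro!: measurable_component_singleton\<close>)
    show int: "integrable ?P (\<lambda>x. g (x i) * g (x j))"
      using that by (intro P.integrable_const_bound[where B=1]) (auto simp: abs_mult gb intro!: mult_le_one)
    show "(\<integral>x. g (x i) * g (x j) \<partial>?P) \<le> of_bool (i = j)"
    proof (cases "i = j")
      case True
      have "(\<integral>x. g (x i) * g (x j) \<partial>?P) \<le> (\<integral>x. 1 \<partial>?P)"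
        by (intro integral_mono int) (auto simp: True gsq)
      then show ?thesis using True by (simp add: P.prob_space)
    next
      case False
      then show ?thesis
        using integral_meas_pres(2)[OF meas_pres_PiM_pair[OF M, of "{..<n}" i j] gg] that gg0 by simp
    qed
  qed
  show "integrable ?P (\<lambda>x. ((\<Sum>v<n. indicator A (x v)) / real n - measure M A)\<^sup>2)"
    unfolding eq by (intro integrable_divide_zero Bochner_Integration.integrable_sum ij) auto
  have "(\<integral>x. ((\<Sum>v<n. indicator A (x v)) / real n - measure M A)\<^sup>2 \<partial>?P) = (\<Sum>i<n. \<Sum>j<n. \<integral>x. g (x i) * g (x j) \<partial>?P) / (real n)\<^sup>2"
    unfolding eq integral_divide_zero
    by (subst Bochner_Integration.integral_sum; (intro Bochner_Integration.integrable_sum sum.cong refl Bochner_Integration.integral_sum arg_cong2[where f="(/)"])?) (auto intro!: ij)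
  also have "\<dots> \<le> (\<Sum>i<n. \<Sum>j<n. of_bool (i = j)) / (real n)\<^sup>2"
    by (intro divide_right_mono sum_mono ij) auto
  also have "\<dots> = 1 / real n" using n by (simp add: power2_eq_square of_bool_def)
  finally show "(\<integral>x. ((\<Sum>v<n. indicator A (x v)) / real n - measure M A)\<^sup>2 \<partial>?P) \<le> 1 / real n" .
qed

text \<open>\<open>x\<close> explains \<open>H\<close> at precision \<open>L\<close>. The level
  \<open>1/\<rho>\<close> is the cap at 1 divided by \<open>\<rho>\<close>, so the last clause
  compares the rescaled \<open>H\<close> with its conditional mean given \<open>x\<close>; the
  clauses before it concern the sample alone. \<open>L\<close> sets the precision and also how many
  bits and step functions are tested, and will tend to infinity.\<close>

definition good_graph ::
  "'a measure \<Rightarrow> ('a \<Rightarrow> 'a \<Rightarrow> real) \<Rightarrow> (nat \<Rightarrow> 'a set) \<Rightarrow> (nat \<Rightarrow> (real \<times> nat \<times> nat) list) \<Rightarrow> real \<Rightarrow> nat \<Rightarrow> nat \<Rightarrow>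
    (nat \<times> nat) set \<Rightarrow> (nat \<Rightarrow> 'a) \<Rightarrow> bool" where
  "good_graph M W B \<gamma> \<rho> n L H x \<longleftrightarrow> (\<forall>i<n. x i \<in> space M) \<and>
    (\<forall>I\<subseteq>{..<L}. \<bar>freq n (\<lambda>v. code B (x v)) I - measure M {y \<in> space M. \<forall>i\<in>I. code B y i}\<bar> \<le> 1 / real L) \<and>
    (\<forall>l<L. (\<Sum>i<n. \<Sum>j\<in>{..<n} - {i}. \<bar>min (1/\<rho>) (W (x i) (x j)) - step_fun (\<gamma> l) (code B (x i), code B (x j))\<bar>)
        \<le> (real n)\<^sup>2 / 2 ^ l) \<and>
    (\<forall>S T. \<bar>\<Sum>e\<in>cut_edges n S T. of_bool (e \<in> H) / \<rho> - min (1/\<rho>) (W (x (fst e)) (x (snd e)))\<bar> \<le> (real n)\<^sup>2 / real L)"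

text \<open>A graph explained by no sample is in particular not explained by this \<open>x\<close>.
  As \<open>x\<close> satisfies every clause on the sample, some cut of the graph must deviate, and
  the cut bound applies.\<close>

lemma bad_graph_weight:
  assumes W: "\<And>y y'. y \<in> space M \<Longrightarrow> y' \<in> space M \<Longrightarrow> 0 \<le> W y y'" and \<rho>: "\<rho> > 0" and L: "L > 0"
    and x: "\<And>i. i < n \<Longrightarrow> x i \<in> space M"
    and fr: "\<And>I. I \<subseteq> {..<L} \<Longrightarrow> \<bar>freq n (\<lambda>v. code B (x v)) I - measure M {y \<in> space M. \<forall>i\<in>I. code B y i}\<bar> \<le> 1 / real L"
    and st: "\<And>l. l < L \<Longrightarrow> (\<Sum>i<n. \<Sum>j\<in>{..<n} - {i}. \<bar>min (1/\<rho>) (W (x i) (x j)) - step_fun (\<gamma> l) (code B (x i), code B (x j))\<bar>)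
        \<le> (real n)\<^sup>2 / 2 ^ l"
    and mass: "(\<Sum>i<n. \<Sum>j\<in>{..<n} - {i}. W (x i) (x j)) \<le> (real n)\<^sup>2 * C"
    and th: "0 \<le> \<theta>" "\<theta> \<le> 1"
  defines "p \<equiv> \<lambda>e. min 1 (\<rho> * W (x (fst e)) (x (snd e)))"
  shows "(\<Sum>H\<in>{H \<in> Pow (pot_edges n). \<nexists>x. good_graph M W B \<gamma> \<rho> n L H x}. graph_weight (pot_edges n) p H)
    \<le> 4 ^ n * (2 * exp (\<theta>\<^sup>2 * (\<rho> * (real n)\<^sup>2 * C) - \<theta> * (\<rho> * (real n)\<^sup>2 / real L)))"
proof -
  let ?E = "pot_edges n" and ?a = "\<rho> * (real n)\<^sup>2 / real L"
  have We: "0 \<le> W (x (fst e)) (x (snd e))" if "e \<in> ?E" for e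
    using that by (intro W x) (auto simp: pot_edges_def)
  have p: "0 \<le> p e \<and> p e \<le> 1" if "e \<in> ?E" for e
    using We[OF that] \<rho> by (auto simp: p_def)
  have "(\<Sum>e\<in>?E. p e) \<le> (\<Sum>e\<in>?E. \<rho> * W (x (fst e)) (x (snd e)))"
    by (intro sum_mono) (auto simp: p_def)
  also have "\<dots> \<le> (\<Sum>e\<in>(SIGMA i:{..<n}. {..<n} - {i}). \<rho> * W (x (fst e)) (x (snd e)))"
    using \<rho> by (intro sum_mono2) (auto simp: pot_edges_def intro!: mult_nonneg_nonneg W x)
  also have "\<dots> = \<rho> * (\<Sum>i<n. \<Sum>j\<in>{..<n} - {i}. W (x i) (x j))"
    by (subst sum.Sigma) (auto simp: sum_distrib_left split_beta')
  also have "\<dots> \<le> \<rho> * ((real n)\<^sup>2 * C)" using \<rho> mass by (intro mult_left_mono) auto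
  finally have m: "(\<Sum>e\<in>?E. p e) \<le> \<rho> * (real n)\<^sup>2 * C" by (simp add: mult.assoc)
  have *: "\<exists>S T. \<bar>\<Sum>e\<in>cut_edges n S T. of_bool (e \<in> H) - p e\<bar> > ?a" if "\<nexists>x. good_graph M W B \<gamma> \<rho> n L H x" for H
  proof (rule ccontr)
    assume c: "\<not> ?thesis"
    have "\<bar>\<Sum>e\<in>cut_edges n S T. of_bool (e \<in> H) / \<rho> - min (1/\<rho>) (W (x (fst e)) (x (snd e)))\<bar> \<le> (real n)\<^sup>2 / real L" for S T
    proof -
      have "of_bool (e \<in> H) / \<rho> - min (1/\<rho>) (W (x (fst e)) (x (snd e))) = (of_bool (e \<in> H) - p e) / \<rho>" for e
        using \<rho> by (auto simp: p_def min_def field_simps)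
      then have "\<bar>\<Sum>e\<in>cut_edges n S T. of_bool (e \<in> H) / \<rho> - min (1/\<rho>) (W (x (fst e)) (x (snd e)))\<bar>
        = \<bar>\<Sum>e\<in>cut_edges n S T. of_bool (e \<in> H) - p e\<bar> / \<rho>"
        using \<rho> by (simp add: sum_divide_distrib[symmetric] abs_divide)
      also have "\<dots> \<le> ?a / \<rho>" using c \<rho> by (intro divide_right_mono) (auto simp: not_less)
      also have "\<dots> = (real n)\<^sup>2 / real L" using \<rho> by simp
      finally show ?thesis .
    qed
    then have "good_graph M W B \<gamma> \<rho> n L H x"
      unfolding good_graph_def using x fr st by blast
    with that show False by blast
  qed
  have "(\<Sum>H\<in>{H \<in> Pow ?E. \<nexists>x. good_graph M W B \<gamma> \<rho> n L H x}. graph_weight ?E p H)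
    = (\<Sum>H\<in>Pow ?E. graph_weight ?E p H * of_bool (\<nexists>x. good_graph M W B \<gamma> \<rho> n L H x))"
    by (intro sum.mono_neutral_cong_left) auto
  also have "\<dots> \<le> (\<Sum>H\<in>Pow ?E. graph_weight ?E p H * of_bool (\<exists>S T. \<bar>\<Sum>e\<in>cut_edges n S T. of_bool (e \<in> H) - p e\<bar> > ?a))"
  proof (intro sum_mono mult_left_mono graph_weight_nonneg p)
    fix H show "of_bool (\<nexists>x. good_graph M W B \<gamma> \<rho> n L H x) \<le> (of_bool (\<exists>S T. \<bar>\<Sum>e\<in>cut_edges n S T. of_bool (e \<in> H) - p e\<bar> > ?a) :: real)"
      using *[of H] by (auto simp del: not_ex)
  qed
  also have "\<dots> \<le> 4 ^ n * (2 * exp (\<theta>\<^sup>2 * (\<rho> * (real n)\<^sup>2 * C) - \<theta> * ?a))"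
    by (rule graph_cut_bound[OF p th m])
  finally show ?thesis .
qed


section \<open>The law of the random graph as a mixture over samples\<close>

lemma graphonD:
  assumes "graphon M W"
  shows "prob_space M" "(\<lambda>z. W (fst z) (snd z)) \<in> borel_measurable (M \<Otimes>\<^sub>M M)"
    "integrable (M \<Otimes>\<^sub>M M) (\<lambda>z. W (fst z) (snd z))"
    "\<And>x y. x \<in> space M \<Longrightarrow> y \<in> space M \<Longrightarrow> 0 \<le> W x y"
    "\<And>x y. x \<in> space M \<Longrightarrow> y \<in> space M \<Longrightarrow> W x y = W y x"
  using assms by (auto simp: graphon_def)

definition edge_prob :: "('a \<Rightarrow> 'a \<Rightarrow> real) \<Rightarrow> real \<Rightarrow> (nat \<Rightarrow> 'a) \<Rightarrow> nat \<times> nat \<Rightarrow> real" where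
  "edge_prob W \<rho> x e = min 1 (\<rho> * W (x (fst e)) (x (snd e)))"

lemma G_prob_eq_weight:
  "G_prob M W \<rho> n H = (\<integral>x. graph_weight (pot_edges n) (edge_prob W \<rho> x) H \<partial>PiM {..<n} (\<lambda>_. M))"
  unfolding G_prob_def graph_weight_def edge_prob_def Let_def by (rule refl)

lemma edge_prob_bounds:
  assumes "graphon M W" "\<rho> > 0" "x \<in> space (PiM {..<n} (\<lambda>_. M))" "e \<in> pot_edges n"
  shows "0 \<le> edge_prob W \<rho> x e \<and> edge_prob W \<rho> x e \<le> 1"
proof -
  have "x (fst e) \<in> space M" "x (snd e) \<in> space M"
    using assms(3,4) by (auto simp: space_PiM pot_edges_def PiE_iff)
  then show ?thesis using assms(2) graphonD(4)[OF assms(1)] by (auto simp: edge_prob_def)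
qed

lemma integrable_graph_weight:
  assumes G: "graphon M W" and \<rho>: "\<rho> > 0"
  shows "integrable (PiM {..<n} (\<lambda>_. M)) (\<lambda>x. graph_weight (pot_edges n) (edge_prob W \<rho> x) H)"
proof -
  interpret P: prob_space "PiM {..<n} (\<lambda>_. M)" by (intro prob_space_PiM graphonD(1)[OF G])
  have e: "(\<lambda>x. edge_prob W \<rho> x e) \<in> borel_measurable (PiM {..<n} (\<lambda>_. M))" if "e \<in> pot_edges n" for e
  proof -
    have "(\<lambda>x. (x (fst e), x (snd e))) \<in> measurable (PiM {..<n} (\<lambda>_. M)) (M \<Otimes>\<^sub>M M)"
      using that by (intro measurable_Pair measurable_component_singleton) (auto simp: pot_edges_def)
    from measurable_compose[OF this graphonD(2)[OF G]]
    have [measurable]: "(\<lambda>x. W (x (fst e)) (x (snd e))) \<in> borel_measurable (PiM {..<n} (\<lambda>_. M))" by simp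
    show ?thesis unfolding edge_prob_def by measurable
  qed
  show ?thesis
  proof (rule P.integrable_const_bound[where B=1])
    show "(\<lambda>x. graph_weight (pot_edges n) (edge_prob W \<rho> x) H) \<in> borel_measurable (PiM {..<n} (\<lambda>_. M))"
      unfolding graph_weight_def
    proof (rule borel_measurable_prod)
      fix i assume "i \<in> pot_edges n"
      then show "(\<lambda>x. if i \<in> H then edge_prob W \<rho> x i else 1 - edge_prob W \<rho> x i) \<in> borel_measurable (PiM {..<n} (\<lambda>_. M))"
        using e[of i] by (cases "i \<in> H") auto
    qed
    show "AE x in PiM {..<n} (\<lambda>_. M). norm (graph_weight (pot_edges n) (edge_prob W \<rho> x) H) \<le> 1"
    proof (rule AE_I2)
      fix x assume "x \<in> space (PiM {..<n} (\<lambda>_. M))"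
      note b = edge_prob_bounds[OF G \<rho> this]
      have "graph_weight (pot_edges n) (edge_prob W \<rho> x) H \<le> 1"
        unfolding graph_weight_def using b by (intro prod_le_1) auto
      with graph_weight_nonneg[of "pot_edges n" "edge_prob W \<rho> x" H] b
      show "norm (graph_weight (pot_edges n) (edge_prob W \<rho> x) H) \<le> 1" by auto
    qed
  qed
qed

lemma sum_G_prob:
  assumes "graphon M W" "\<rho> > 0"
  shows "(\<Sum>H\<in>Pow (pot_edges n). G_prob M W \<rho> n H) = 1"
proof -
  interpret P: prob_space "PiM {..<n} (\<lambda>_. M)" by (intro prob_space_PiM graphonD(1)[OF assms(1)])
  have "(\<Sum>H\<in>Pow (pot_edges n). G_prob M W \<rho> n H) =
    (\<integral>x. (\<Sum>H\<in>Pow (pot_edges n). graph_weight (pot_edges n) (edge_prob W \<rho> x) H) \<partial>PiM {..<n} (\<lambda>_. M))"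
    unfolding G_prob_eq_weight by (subst Bochner_Integration.integral_sum) (auto intro: integrable_graph_weight assms)
  then show ?thesis by (simp add: sum_graph_weight P.prob_space)
qed

text \<open>\<open>\<theta>\<close> minimises the quadratic exponent, whose minimum is
  \<open>- \<kappa> * \<rho> n * n^2\<close> with \<open>\<kappa> = 1 / (4 * L^2 * C)\<close>. Once
  \<open>\<kappa> * n * \<rho> n\<close> exceeds \<open>ln 4 + 1\<close>, the factor
  \<open>4 ^ n\<close> is absorbed and \<open>exp (- n)\<close> is left over.\<close>

lemma union_bound_exponent:
  fixes \<rho> :: "nat \<Rightarrow> real"
  assumes n\<rho>: "filterlim (\<lambda>n. real n * \<rho> n) at_top sequentially" and L: "L > (0::nat)" and C: "C > 0"
  defines "\<theta> \<equiv> 1 / (2 * real L * C)"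
  shows "\<forall>\<^sub>F n in sequentially. 4 ^ n * (2 * exp (\<theta>\<^sup>2 * (\<rho> n * (real n)\<^sup>2 * C) - \<theta> * (\<rho> n * (real n)\<^sup>2 / real L))) \<le> 1/16"
proof -
  define \<kappa> where "\<kappa> = \<theta> / (2 * real L)"
  have th: "\<theta> > 0" using L C by (simp add: \<theta>_def)
  have k: "\<kappa> > 0" using th L by (simp add: \<kappa>_def)
  have ev: "\<forall>\<^sub>F n in sequentially. real n * \<rho> n \<ge> (ln 4 + 1) / \<kappa>"
    using n\<rho> by (simp add: filterlim_at_top)
  show ?thesis
    \<comment> \<open>From 31 on, \<open>exp n \<ge> n + 1 \<ge> 32\<close>, and the factor 2 leaves
      1/16.\<close>
    using ev eventually_ge_at_top[of 31]
  proof eventually_elim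
    case (elim n)
    have "\<theta>\<^sup>2 * C = \<kappa>" using C L by (simp add: \<kappa>_def \<theta>_def power2_eq_square field_simps)
    then have "\<theta>\<^sup>2 * (\<rho> n * (real n)\<^sup>2 * C) = \<kappa> * (\<rho> n * (real n)\<^sup>2)" by (metis mult.assoc mult.commute)
    moreover have "\<theta> * (\<rho> n * (real n)\<^sup>2 / real L) = 2 * \<kappa> * (\<rho> n * (real n)\<^sup>2)" using L by (simp add: \<kappa>_def)
    ultimately have e: "\<theta>\<^sup>2 * (\<rho> n * (real n)\<^sup>2 * C) - \<theta> * (\<rho> n * (real n)\<^sup>2 / real L) = - (real n * (\<kappa> * (real n * \<rho> n)))"
      by (simp add: power2_eq_square algebra_simps)
    have "ln 4 + 1 \<le> \<kappa> * (real n * \<rho> n)" using elim(1) k by (simp add: field_simps)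
    then have "real n * (ln 4 + 1) \<le> real n * (\<kappa> * (real n * \<rho> n))" by (intro mult_left_mono) auto
    then have le: "- (real n * (\<kappa> * (real n * \<rho> n))) \<le> - (real n * (ln 4 + 1))" by simp
    have "(4::real) ^ n = exp (real n * ln 4)" by (simp add: exp_of_nat_mult)
    then have "4 ^ n * (2 * exp (- (real n * (\<kappa> * (real n * \<rho> n))))) \<le> exp (real n * ln 4) * (2 * exp (- (real n * (ln 4 + 1))))"
      using le by (intro mult_mono) auto
    also have "\<dots> = 2 * exp (- real n)" by (simp add: exp_add[symmetric] algebra_simps)
    also have "\<dots> \<le> 2 * (1 / 32)"
    proof -
      have "32 \<le> exp (real n)" using exp_ge_add_one_self[of "real n"] elim(2) by linarith
      then show ?thesis by (simp add: exp_minus field_simps)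
    qed
    finally show ?case unfolding e by simp
  qed
qed

text \<open>Markov's inequality for an atypical sample and the cut bound for an atypical graph over
  a typical sample, combined in one integral over \<open>x\<close>.\<close>

lemma bad_graph_prob:
  assumes G: "graphon M W" and B: "\<And>i. B i \<in> sets M"
    and \<gamma>: "\<And>l. (\<integral>z. \<bar>W (fst z) (snd z) - step_fun (\<gamma> l) (code_pair B z)\<bar> \<partial>(M \<Otimes>\<^sub>M M)) < (1/4) ^ l / 32"
    and \<rho>: "\<And>n. 0 < \<rho> n" and n\<rho>: "filterlim (\<lambda>n. real n * \<rho> n) at_top sequentially"
    and tail: "(\<lambda>n. \<integral>z. \<bar>W (fst z) (snd z) - min (1 / \<rho> n) (W (fst z) (snd z))\<bar> \<partial>(M \<Otimes>\<^sub>M M)) \<longlonglongrightarrow> 0"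
    and L: "L > 0"
  shows "\<forall>\<^sub>F n in sequentially.
    (\<Sum>H\<in>{H \<in> Pow (pot_edges n). \<nexists>x. good_graph M W B \<gamma> (\<rho> n) n L H x}. G_prob M W (\<rho> n) n H) < 1/2"
proof -
  note W = graphonD[OF G]
  interpret M: prob_space M by (rule W)
  interpret MM: pair_prob_space M M by (intro pair_prob_spaceI W)
  let ?w = "\<lambda>z. W (fst z) (snd z)"
  define c where "c = (\<integral>z. ?w z \<partial>(M \<Otimes>\<^sub>M M))"
  \<comment> \<open>The factor 8 makes the mean of the total weight, in units of
    \<open>n^2 * C\<close>, at most 1/8; the added 1 keeps \<open>C\<close> positive when
    \<open>c = 0\<close>.\<close>
  define C where "C = 8 * (c + 1)"
  define \<theta> where "\<theta> = 1 / (2 * real L * C)"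
  define t where "t n = (\<integral>z. \<bar>?w z - min (1 / \<rho> n) (?w z)\<bar> \<partial>(M \<Otimes>\<^sub>M M))" for n
  define \<delta> where "\<delta> n = 4 ^ n * (2 * exp (\<theta>\<^sup>2 * (\<rho> n * (real n)\<^sup>2 * C) - \<theta> * (\<rho> n * (real n)\<^sup>2 / real L)))" for n
  have w0: "0 \<le> ?w z" if "z \<in> space (M \<Otimes>\<^sub>M M)" for z
    using that W(4) by (auto simp: space_pair_measure)
  have c0: "0 \<le> c" unfolding c_def using w0 by (intro integral_nonneg_AE AE_I2)
  then have C: "C \<ge> 8" "C > 0" by (auto simp: C_def)
  have "1 \<le> 2 * real L * C" using mult_mono[of 1 "real L" 8 C] L C by auto
  then have th: "0 \<le> \<theta>" "\<theta> \<le> 1" using C L by (auto simp: \<theta>_def divide_le_eq)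
  define A where "A I = {y \<in> space M. \<forall>i\<in>I. code B y i}" for I
  have A[measurable]: "A I \<in> sets M" if "finite I" for I
  proof -
    have [measurable]: "code B \<in> measurable M cantor_space" using measurable_code[OF B] .
    show ?thesis unfolding A_def using that by measurable
  qed
  have t0: "0 \<le> t n" for n unfolding t_def by (intro integral_nonneg_AE AE_I2) auto
  define g where "g n l z = \<bar>min (1 / \<rho> n) (?w z) - step_fun (\<gamma> l) (code_pair B z)\<bar>" for n l z
  have si: "integrable (M \<Otimes>\<^sub>M M) (\<lambda>z. step_fun (\<gamma> l) (code_pair B z))" for l
    by (intro integrable_step_fun MM.finite_measure_axioms measurable_code_pair B)
  have mi: "integrable (M \<Otimes>\<^sub>M M) (\<lambda>z. min (1 / \<rho> n) (?w z))" for n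
    using W(3) by (intro integrable_min) auto
  have gi: "integrable (M \<Otimes>\<^sub>M M) (g n l)" for n l
    unfolding g_def using si mi by auto
  have gb: "(\<integral>z. g n l z \<partial>(M \<Otimes>\<^sub>M M)) \<le> (1/4) ^ l / 32 + t n" for n l
  proof -
    have "(\<integral>z. g n l z \<partial>(M \<Otimes>\<^sub>M M)) \<le> (\<integral>z. \<bar>?w z - step_fun (\<gamma> l) (code_pair B z)\<bar> + \<bar>?w z - min (1 / \<rho> n) (?w z)\<bar> \<partial>(M \<Otimes>\<^sub>M M))"
      using gi W(3) si mi by (intro integral_mono) (auto simp: g_def)
    also have "\<dots> = (\<integral>z. \<bar>?w z - step_fun (\<gamma> l) (code_pair B z)\<bar> \<partial>(M \<Otimes>\<^sub>M M)) + t n"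
      unfolding t_def using W(3) si mi by (intro Bochner_Integration.integral_add) auto
    finally show ?thesis using \<gamma>[of l] by linarith
  qed
  \<comment> \<open>A penalty whose summands are scaled to exceed 1 when a condition on the sample
    fails: \<open>\<Psi> n x \<le> 1\<close> implies all of them, and where \<open>\<Psi>\<close>
    exceeds 1 it dominates the bad weight trivially. Hence the bad probability is at most the mean
    of \<open>\<Psi>\<close> plus \<open>\<delta>\<close>.\<close>
  define \<Psi> where "\<Psi> n x = (\<Sum>i<n. \<Sum>j\<in>{..<n} - {i}. ?w (x i, x j)) / ((real n)\<^sup>2 * C)
    + (\<Sum>I\<in>Pow {..<L}. (real L)\<^sup>2 * ((\<Sum>v<n. indicator (A I) (x v)) / real n - measure M (A I))\<^sup>2)
    + (\<Sum>l<L. 2 ^ l / (real n)\<^sup>2 * (\<Sum>i<n. \<Sum>j\<in>{..<n} - {i}. g n l (x i, x j)))" for n x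
  \<comment> \<open>The 3/16 is 1/8 for the total weight and 1/16 for the step errors: these have
    mean below \<open>(1/4) ^ l / 32\<close>, are weighted by \<open>2 ^ l\<close>, and so sum to at
    most 2/32.\<close>
  have \<Psi>: "integrable (PiM {..<n} (\<lambda>_. M)) (\<Psi> n)"
    "(\<integral>x. \<Psi> n x \<partial>PiM {..<n} (\<lambda>_. M)) \<le> 3/16 + 2 ^ L * (real L)\<^sup>2 / real n + 2 ^ L * t n" if n: "n > 0" for n
  proof -
    let ?P = "PiM {..<n} (\<lambda>_. M)"
    have fA: "finite I" if "I \<in> Pow {..<L}" for I using that by (auto intro: finite_subset)
    note w1 = sample_pair_sum[OF W(1,3) w0, of n]
    note g1 = sample_pair_sum[OF W(1) gi, of n l n for l]
    have g1i: "integrable ?P (\<lambda>x. \<Sum>i<n. \<Sum>j\<in>{..<n} - {i}. g n l (x i, x j))" for l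
      by (rule g1) (auto simp: g_def)
    have g1b: "(\<integral>x. (\<Sum>i<n. \<Sum>j\<in>{..<n} - {i}. g n l (x i, x j)) \<partial>?P) \<le> (real n)\<^sup>2 * (\<integral>z. g n l z \<partial>(M \<Otimes>\<^sub>M M))" for l
      by (rule g1) (auto simp: g_def)
    note v1 = sample_frequency_variance[OF W(1) A n]
    have i1: "integrable ?P (\<lambda>x. (\<Sum>i<n. \<Sum>j\<in>{..<n} - {i}. ?w (x i, x j)) / ((real n)\<^sup>2 * C))"
      using w1(1) by (intro integrable_divide_zero) auto
    have i2: "integrable ?P (\<lambda>x. (real L)\<^sup>2 * ((\<Sum>v<n. indicator (A I) (x v)) / real n - measure M (A I))\<^sup>2)"
      if "I \<in> Pow {..<L}" for I
      using v1(1)[OF fA[OF that]] by (intro integrable_mult_right) auto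
    have i3: "integrable ?P (\<lambda>x. 2 ^ l / (real n)\<^sup>2 * (\<Sum>i<n. \<Sum>j\<in>{..<n} - {i}. g n l (x i, x j)))" for l
      using g1i by (intro integrable_mult_right) auto
    show "integrable ?P (\<Psi> n)"
      unfolding \<Psi>_def by (intro Bochner_Integration.integrable_add Bochner_Integration.integrable_sum i1 i2 i3)
    have "(\<integral>x. \<Psi> n x \<partial>?P) = (\<integral>x. (\<Sum>i<n. \<Sum>j\<in>{..<n} - {i}. ?w (x i, x j)) / ((real n)\<^sup>2 * C) \<partial>?P)
      + (\<integral>x. (\<Sum>I\<in>Pow {..<L}. (real L)\<^sup>2 * ((\<Sum>v<n. indicator (A I) (x v)) / real n - measure M (A I))\<^sup>2) \<partial>?P)
      + (\<integral>x. (\<Sum>l<L. 2 ^ l / (real n)\<^sup>2 * (\<Sum>i<n. \<Sum>j\<in>{..<n} - {i}. g n l (x i, x j))) \<partial>?P)"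
      unfolding \<Psi>_def
      by (rule trans[OF Bochner_Integration.integral_add arg_cong2[where f="(+)", OF Bochner_Integration.integral_add refl]];
          intro Bochner_Integration.integrable_add Bochner_Integration.integrable_sum i1 i2 i3)
    also have "(\<integral>x. (\<Sum>i<n. \<Sum>j\<in>{..<n} - {i}. ?w (x i, x j)) / ((real n)\<^sup>2 * C) \<partial>?P) \<le> 1/8"
    proof -
      have "(\<integral>x. (\<Sum>i<n. \<Sum>j\<in>{..<n} - {i}. ?w (x i, x j)) / ((real n)\<^sup>2 * C) \<partial>?P)
        = (\<integral>x. (\<Sum>i<n. \<Sum>j\<in>{..<n} - {i}. ?w (x i, x j)) \<partial>?P) / ((real n)\<^sup>2 * C)" by (rule integral_divide_zero)
      also have "\<dots> \<le> ((real n)\<^sup>2 * c) / ((real n)\<^sup>2 * C)"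
        using w1(2) C by (intro divide_right_mono) (auto simp: c_def)
      also have "\<dots> = c / C" using n by simp
      also have "\<dots> \<le> 1/8" using c0 by (simp add: C_def field_simps)
      finally show ?thesis .
    qed
    also have "(\<integral>x. (\<Sum>I\<in>Pow {..<L}. (real L)\<^sup>2 * ((\<Sum>v<n. indicator (A I) (x v)) / real n - measure M (A I))\<^sup>2) \<partial>?P) \<le> 2 ^ L * (real L)\<^sup>2 / real n"
    proof -
      have "(\<integral>x. (\<Sum>I\<in>Pow {..<L}. (real L)\<^sup>2 * ((\<Sum>v<n. indicator (A I) (x v)) / real n - measure M (A I))\<^sup>2) \<partial>?P)
        = (\<Sum>I\<in>Pow {..<L}. \<integral>x. (real L)\<^sup>2 * ((\<Sum>v<n. indicator (A I) (x v)) / real n - measure M (A I))\<^sup>2 \<partial>?P)"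
        by (rule Bochner_Integration.integral_sum) (rule i2)
      also have "\<dots> \<le> (\<Sum>I\<in>Pow {..<L}. (real L)\<^sup>2 * (1 / real n))"
      proof (rule sum_mono)
        fix I assume "I \<in> Pow {..<L}"
        from v1(2)[OF fA[OF this]]
        show "(\<integral>x. (real L)\<^sup>2 * ((\<Sum>v<n. indicator (A I) (x v)) / real n - measure M (A I))\<^sup>2 \<partial>?P) \<le> (real L)\<^sup>2 * (1 / real n)"
          unfolding integral_mult_right_zero by (rule mult_left_mono) auto
      qed
      also have "\<dots> = 2 ^ L * (real L)\<^sup>2 / real n" by (simp add: card_Pow)
      finally show ?thesis .
    qed
    also have "(\<integral>x. (\<Sum>l<L. 2 ^ l / (real n)\<^sup>2 * (\<Sum>i<n. \<Sum>j\<in>{..<n} - {i}. g n l (x i, x j))) \<partial>?P) \<le> 1/16 + 2 ^ L * t n"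
    proof -
      have "(\<integral>x. (\<Sum>l<L. 2 ^ l / (real n)\<^sup>2 * (\<Sum>i<n. \<Sum>j\<in>{..<n} - {i}. g n l (x i, x j))) \<partial>?P)
        = (\<Sum>l<L. \<integral>x. 2 ^ l / (real n)\<^sup>2 * (\<Sum>i<n. \<Sum>j\<in>{..<n} - {i}. g n l (x i, x j)) \<partial>?P)"
        by (rule Bochner_Integration.integral_sum) (rule i3)
      also have "\<dots> \<le> (\<Sum>l<L. (1/2) ^ l / 32 + 2 ^ l * t n)"
      proof (rule sum_mono)
        fix l
        have "(\<integral>x. 2 ^ l / (real n)\<^sup>2 * (\<Sum>i<n. \<Sum>j\<in>{..<n} - {i}. g n l (x i, x j)) \<partial>?P)
          \<le> 2 ^ l / (real n)\<^sup>2 * ((real n)\<^sup>2 * ((1/4) ^ l / 32 + t n))"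
          unfolding integral_mult_right_zero
          by (intro mult_left_mono order_trans[OF g1b] gb) auto
        also have "\<dots> = 2 ^ l * (1/4) ^ l / 32 + 2 ^ l * t n" using n by (simp add: field_simps)
        also have "2 ^ l * (1/4) ^ l = (1/2::real) ^ l" by (simp add: power_mult_distrib[symmetric])
        finally show "(\<integral>x. 2 ^ l / (real n)\<^sup>2 * (\<Sum>i<n. \<Sum>j\<in>{..<n} - {i}. g n l (x i, x j)) \<partial>?P) \<le> (1/2) ^ l / 32 + 2 ^ l * t n" .
      qed
      also have "\<dots> = (\<Sum>l<L. (1/2) ^ l) / 32 + (\<Sum>l<L. 2 ^ l) * t n"
        by (simp add: sum.distrib sum_divide_distrib sum_distrib_right)
      also have "\<dots> \<le> 2 / 32 + 2 ^ L * t n"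
      proof (intro add_mono divide_right_mono mult_right_mono t0)
        have "(\<Sum>l<L. (1/2::real) ^ l) = 2 * (1 - (1/2) ^ L)" by (subst sum_gp_strict) auto
        then show "(\<Sum>l<L. (1/2::real) ^ l) \<le> 2" by simp
        have "(\<Sum>l<L. 2 ^ l :: real) = 2 ^ L - 1" by (subst sum_gp_strict) auto
        then show "(\<Sum>l<L. 2 ^ l :: real) \<le> 2 ^ L" by simp
      qed auto
      finally show ?thesis by simp
    qed
    finally show "(\<integral>x. \<Psi> n x \<partial>?P) \<le> 3/16 + 2 ^ L * (real L)\<^sup>2 / real n + 2 ^ L * t n" by simp
  qed
  have pointwise: "(\<Sum>H\<in>{H \<in> Pow (pot_edges n). \<nexists>x. good_graph M W B \<gamma> (\<rho> n) n L H x}. graph_weight (pot_edges n) (edge_prob W (\<rho> n) x) H) \<le> \<Psi> n x + \<delta> n"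
    if n: "n > 0" and x: "x \<in> space (PiM {..<n} (\<lambda>_. M))" for n x
  proof -
    have xs: "x i \<in> space M" if "i < n" for i using x that by (auto simp: space_PiM PiE_iff)
    let ?a = "(\<Sum>i<n. \<Sum>j\<in>{..<n} - {i}. ?w (x i, x j)) / ((real n)\<^sup>2 * C)"
    let ?b = "\<lambda>I. (real L)\<^sup>2 * ((\<Sum>v<n. indicator (A I) (x v)) / real n - measure M (A I))\<^sup>2"
    let ?c = "\<lambda>l. 2 ^ l / (real n)\<^sup>2 * (\<Sum>i<n. \<Sum>j\<in>{..<n} - {i}. g n l (x i, x j))"
    have a0: "0 \<le> ?a" using C xs W(4) by (intro divide_nonneg_nonneg sum_nonneg) auto
    have b0: "0 \<le> ?b I" for I by simp
    have c0: "0 \<le> ?c l" for l by (intro mult_nonneg_nonneg sum_nonneg) (auto simp: g_def)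
    have B0: "0 \<le> (\<Sum>I\<in>Pow {..<L}. ?b I)" by (intro sum_nonneg b0)
    have C0: "0 \<le> (\<Sum>l<L. ?c l)" by (intro sum_nonneg c0)
    have \<Psi>x: "\<Psi> n x = ?a + (\<Sum>I\<in>Pow {..<L}. ?b I) + (\<Sum>l<L. ?c l)" by (simp add: \<Psi>_def)
    have \<delta>0: "0 \<le> \<delta> n" by (simp add: \<delta>_def)
    show ?thesis
    proof (cases "\<Psi> n x \<le> 1")
      case False
      have "(\<Sum>H\<in>{H \<in> Pow (pot_edges n). \<nexists>x. good_graph M W B \<gamma> (\<rho> n) n L H x}. graph_weight (pot_edges n) (edge_prob W (\<rho> n) x) H)
        \<le> (\<Sum>H\<in>Pow (pot_edges n). graph_weight (pot_edges n) (edge_prob W (\<rho> n) x) H)"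
        by (intro sum_mono2 graph_weight_nonneg edge_prob_bounds[OF G \<rho> x]) auto
      also have "\<dots> = 1" by (simp add: sum_graph_weight)
      finally show ?thesis using False \<delta>0 by linarith
    next
      case True
      have a1: "?a \<le> 1" using True B0 C0 \<Psi>x by linarith
      have b1: "?b I \<le> 1" if "I \<in> Pow {..<L}" for I
      proof -
        have "?b I \<le> (\<Sum>I\<in>Pow {..<L}. ?b I)" by (rule member_le_sum) (use that in auto)
        then show ?thesis using True a0 C0 \<Psi>x by linarith
      qed
      have c1: "?c l \<le> 1" if "l < L" for l
      proof -
        have "?c l \<le> (\<Sum>l<L. ?c l)" by (rule member_le_sum) (use that c0 in auto)
        then show ?thesis using True a0 B0 \<Psi>x by linarith
      qed
      show ?thesis
      proof (rule order_trans[OF bad_graph_weight[where M=M and W=W and \<rho>="\<rho> n" and L=L and n=n and x=x and B=B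
            and \<gamma>=\<gamma> and C=C and \<theta>=\<theta>, folded edge_prob_def]])
        fix I assume I: "I \<subseteq> {..<L}"
        have "freq n (\<lambda>v. code B (x v)) I = (\<Sum>v<n. indicator (A I) (x v)) / real n"
        proof -
          have "(\<Sum>v<n. indicator (A I) (x v)) = (\<Sum>v<n. if \<forall>i\<in>I. code B (x v) i then 1 else (0::real))"
            using xs by (intro sum.cong) (auto simp: A_def indicator_def)
          also have "\<dots> = real (card {v. v < n \<and> (\<forall>i\<in>I. code B (x v) i)})"
            by (subst sum.If_cases) (auto intro!: arg_cong[where f=card])
          finally show ?thesis by (simp add: freq_def)
        qed
        moreover have "\<bar>(\<Sum>v<n. indicator (A I) (x v)) / real n - measure M (A I)\<bar> \<le> 1 / real L"
        proof -
          have "(real L * \<bar>(\<Sum>v<n. indicator (A I) (x v)) / real n - measure M (A I)\<bar>)\<^sup>2 \<le> 1\<^sup>2"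
            using b1[of I] I by (simp add: power_mult_distrib)
          then have "real L * \<bar>(\<Sum>v<n. indicator (A I) (x v)) / real n - measure M (A I)\<bar> \<le> 1"
            by (rule power2_le_imp_le) simp
          then show ?thesis using L by (simp add: field_simps)
        qed
        ultimately show "\<bar>freq n (\<lambda>v. code B (x v)) I - measure M {y \<in> space M. \<forall>i\<in>I. code B y i}\<bar> \<le> 1 / real L"
          by (simp add: A_def)
      next
        fix l assume "l < L"
        from c1[OF this] show "(\<Sum>i<n. \<Sum>j\<in>{..<n} - {i}. \<bar>min (1/\<rho> n) (W (x i) (x j)) - step_fun (\<gamma> l) (code B (x i), code B (x j))\<bar>) \<le> (real n)\<^sup>2 / 2 ^ l"
          using n by (simp add: g_def code_pair_def field_simps)
      next
        show "(\<Sum>i<n. \<Sum>j\<in>{..<n} - {i}. W (x i) (x j)) \<le> (real n)\<^sup>2 * C"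
          using a1 C n by (simp add: divide_le_eq)
      next
        have "0 \<le> \<Psi> n x" using a0 B0 C0 \<Psi>x by linarith
        then show "4 ^ n * (2 * exp (\<theta>\<^sup>2 * (\<rho> n * (real n)\<^sup>2 * C) - \<theta> * (\<rho> n * (real n)\<^sup>2 / real L))) \<le> \<Psi> n x + \<delta> n"
          by (simp add: \<delta>_def)
      qed (use th W(4) \<rho> L xs in auto)
    qed
  qed
  \<comment> \<open>Three further terms of at most 1/16 each, on top of 3/16, stay below
    1/2.\<close>
  have e1: "\<forall>\<^sub>F n in sequentially. 2 ^ L * (real L)\<^sup>2 / real n < 1/16"
  proof -
    have "(\<lambda>n. 2 ^ L * (real L)\<^sup>2 / real n) \<longlonglongrightarrow> 0" by (rule lim_const_over_n)
    from order_tendstoD(2)[OF this, of "1/16"] show ?thesis by simp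
  qed
  have e2: "\<forall>\<^sub>F n in sequentially. 2 ^ L * t n < 1/16"
  proof -
    have "(\<lambda>n. 2 ^ L * t n) \<longlonglongrightarrow> 2 ^ L * 0" using tail unfolding t_def by (intro tendsto_intros)
    from order_tendstoD(2)[OF this, of "1/16"] show ?thesis by simp
  qed
  have e3: "\<forall>\<^sub>F n in sequentially. \<delta> n \<le> 1/16"
    unfolding \<delta>_def \<theta>_def by (rule union_bound_exponent[OF n\<rho> L C(2)])
  show ?thesis
    using e1 e2 e3 eventually_gt_at_top[of 0]
  proof eventually_elim
    case (elim n)
    let ?P = "PiM {..<n} (\<lambda>_. M)" and ?bad = "{H \<in> Pow (pot_edges n). \<nexists>x. good_graph M W B \<gamma> (\<rho> n) n L H x}"
    interpret P: prob_space ?P by (intro prob_space_PiM W)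
    have "(\<Sum>H\<in>?bad. G_prob M W (\<rho> n) n H) = (\<integral>x. (\<Sum>H\<in>?bad. graph_weight (pot_edges n) (edge_prob W (\<rho> n) x) H) \<partial>?P)"
      unfolding G_prob_eq_weight by (subst Bochner_Integration.integral_sum) (auto intro: integrable_graph_weight G \<rho>)
    also have "\<dots> \<le> (\<integral>x. \<Psi> n x + \<delta> n \<partial>?P)"
      using \<Psi>(1)[OF elim(4)] pointwise[OF elim(4)]
      by (intro integral_mono Bochner_Integration.integrable_sum integrable_graph_weight G \<rho>) auto
    also have "\<dots> = (\<integral>x. \<Psi> n x \<partial>?P) + \<delta> n"
      using \<Psi>(1)[OF elim(4)] by (simp add: P.prob_space)
    also have "\<dots> < 1/2" using \<Psi>(2)[OF elim(4)] elim(1-3) by linarith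
    finally show ?case .
  qed
qed

section \<open>A graph typical for both graphons\<close>

text \<open>Under the sup-norm bound the truncation changes nothing almost everywhere. If
  \<open>\<rho>\<close> tends to 0 the level \<open>1 / \<rho> n\<close> tends to infinity, and
  \<open>W\<close> itself dominates the truncated kernels.\<close>

lemma truncation_tendsto:
  assumes G: "graphon M W" and \<rho>: "\<And>n. 0 < \<rho> n"
    and c: "(\<forall>n. ereal (\<rho> n) * graphon_sup_norm M W \<le> 1) \<or> \<rho> \<longlonglongrightarrow> 0"
  shows "(\<lambda>n. \<integral>z. \<bar>W (fst z) (snd z) - min (1 / \<rho> n) (W (fst z) (snd z))\<bar> \<partial>(M \<Otimes>\<^sub>M M)) \<longlonglongrightarrow> 0"
  using c
proof
  let ?w = "\<lambda>z. W (fst z) (snd z)"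
  assume b: "\<forall>n. ereal (\<rho> n) * graphon_sup_norm M W \<le> 1"
  have "(\<integral>z. \<bar>?w z - min (1 / \<rho> n) (?w z)\<bar> \<partial>(M \<Otimes>\<^sub>M M)) = 0" for n
  proof (rule integral_eq_zero_AE)
    have "AE z in M \<Otimes>\<^sub>M M. ereal \<bar>?w z\<bar> \<le> graphon_sup_norm M W"
      unfolding graphon_sup_norm_def by (rule esssup_AE)
    then show "AE z in M \<Otimes>\<^sub>M M. \<bar>?w z - min (1 / \<rho> n) (?w z)\<bar> = 0"
    proof eventually_elim
      case (elim z)
      have "ereal (\<rho> n) * ereal \<bar>?w z\<bar> \<le> ereal (\<rho> n) * graphon_sup_norm M W"
        using elim \<rho>[of n] by (intro ereal_mult_left_mono) auto
      also have "\<dots> \<le> 1" using b by simp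
      finally have "\<rho> n * \<bar>?w z\<bar> \<le> 1" by (simp add: one_ereal_def)
      moreover have "\<rho> n * ?w z \<le> \<rho> n * \<bar>?w z\<bar>" using \<rho>[of n] by (intro mult_left_mono) auto
      ultimately have "\<rho> n * ?w z \<le> 1" by linarith
      then have "?w z \<le> 1 / \<rho> n" using \<rho>[of n] by (simp add: field_simps)
      then show ?case by simp
    qed
  qed
  then show ?thesis by simp
next
  let ?w = "\<lambda>z. W (fst z) (snd z)"
  assume lim: "\<rho> \<longlonglongrightarrow> 0"
  note W = graphonD[OF G]
  interpret MM: pair_prob_space M M by (intro pair_prob_spaceI W)
  show ?thesis
  proof (rule L1_dominated_convergence[where w="?w"])
    show "integrable (M \<Otimes>\<^sub>M M) (\<lambda>z. min (1 / \<rho> n) (?w z))" for n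
      using W(3) by (intro integrable_min) auto
    show "\<bar>min (1 / \<rho> n) (?w z)\<bar> \<le> ?w z" if "z \<in> space (M \<Otimes>\<^sub>M M)" for n z
      using that W(4)[of "fst z" "snd z"] \<rho>[of n] by (auto simp: space_pair_measure min_def)
    show "(\<lambda>n. min (1 / \<rho> n) (?w z)) \<longlonglongrightarrow> ?w z" if "z \<in> space (M \<Otimes>\<^sub>M M)" for z
    proof (rule tendsto_eventually)
      have "\<forall>\<^sub>F n in sequentially. \<rho> n < 1 / (\<bar>?w z\<bar> + 1)"
        using order_tendstoD(2)[OF lim, of "1 / (\<bar>?w z\<bar> + 1)"] by (simp add: add_nonneg_pos)
      then show "\<forall>\<^sub>F n in sequentially. min (1 / \<rho> n) (?w z) = ?w z"
      proof eventually_elim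
        case (elim n)
        have p: "0 < \<bar>?w z\<bar> + 1" by linarith
        have "\<rho> n * (\<bar>?w z\<bar> + 1) < 1" using elim p by (simp add: field_simps)
        then have "\<bar>?w z\<bar> + 1 < 1 / \<rho> n" using \<rho>[of n] by (simp add: field_simps)
        then show ?case by linarith
      qed
    qed
  qed (use W(3) in auto)
qed

text \<open>Under the common law each exceptional set weighs less than 1/2, so the two cannot cover
  all graphs. \<open>x\<close> and \<open>x'\<close> share only the vertex set and the graph that
  they explain; \<open>n \<ge> L\<close> is recorded so that the diagonal becomes negligible
  later.\<close>

lemma common_good_graph:
  assumes G: "graphon M W" "graphon M' W'" and B: "\<And>i. B i \<in> sets M" "\<And>i. B' i \<in> sets M'"
    and \<gamma>: "\<And>l. (\<integral>z. \<bar>W (fst z) (snd z) - step_fun (\<gamma> l) (code_pair B z)\<bar> \<partial>(M \<Otimes>\<^sub>M M)) < (1/4) ^ l / 32"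
      "\<And>l. (\<integral>z. \<bar>W' (fst z) (snd z) - step_fun (\<gamma>' l) (code_pair B' z)\<bar> \<partial>(M' \<Otimes>\<^sub>M M')) < (1/4) ^ l / 32"
    and \<rho>: "\<And>n. 0 < \<rho> n" and n\<rho>: "filterlim (\<lambda>n. real n * \<rho> n) at_top sequentially"
    and tail: "(\<lambda>n. \<integral>z. \<bar>W (fst z) (snd z) - min (1 / \<rho> n) (W (fst z) (snd z))\<bar> \<partial>(M \<Otimes>\<^sub>M M)) \<longlonglongrightarrow> 0"
      "(\<lambda>n. \<integral>z. \<bar>W' (fst z) (snd z) - min (1 / \<rho> n) (W' (fst z) (snd z))\<bar> \<partial>(M' \<Otimes>\<^sub>M M')) \<longlonglongrightarrow> 0"
    and L: "L > 0" and same: "\<And>n. same_G_dist M W M' W' (\<rho> n) n"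
  shows "\<exists>n H x x'. n \<ge> L \<and> good_graph M W B \<gamma> (\<rho> n) n L H x \<and> good_graph M' W' B' \<gamma>' (\<rho> n) n L H x'"
proof -
  have "\<forall>\<^sub>F n in sequentially. n \<ge> L \<and>
    (\<Sum>H\<in>{H \<in> Pow (pot_edges n). \<nexists>x. good_graph M W B \<gamma> (\<rho> n) n L H x}. G_prob M W (\<rho> n) n H) < 1/2 \<and>
    (\<Sum>H\<in>{H \<in> Pow (pot_edges n). \<nexists>x. good_graph M' W' B' \<gamma>' (\<rho> n) n L H x}. G_prob M' W' (\<rho> n) n H) < 1/2"
    using bad_graph_prob[OF G(1) B(1) \<gamma>(1) \<rho> n\<rho> tail(1) L] bad_graph_prob[OF G(2) B(2) \<gamma>(2) \<rho> n\<rho> tail(2) L]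
      eventually_ge_at_top[of L] by eventually_elim auto
  then obtain n where n: "n \<ge> L"
    "(\<Sum>H\<in>{H \<in> Pow (pot_edges n). \<nexists>x. good_graph M W B \<gamma> (\<rho> n) n L H x}. G_prob M W (\<rho> n) n H) < 1/2"
    "(\<Sum>H\<in>{H \<in> Pow (pot_edges n). \<nexists>x. good_graph M' W' B' \<gamma>' (\<rho> n) n L H x}. G_prob M' W' (\<rho> n) n H) < 1/2"
    by (auto simp: eventually_sequentially)
  let ?b = "{H \<in> Pow (pot_edges n). \<nexists>x. good_graph M W B \<gamma> (\<rho> n) n L H x}"
  let ?b' = "{H \<in> Pow (pot_edges n). \<nexists>x. good_graph M' W' B' \<gamma>' (\<rho> n) n L H x}"
  have G0: "0 \<le> G_prob M W (\<rho> n) n H" for H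
    unfolding G_prob_eq_weight using edge_prob_bounds[OF G(1) \<rho>]
    by (intro integral_nonneg_AE AE_I2 graph_weight_nonneg) auto
  have eq: "(\<Sum>H\<in>?b'. G_prob M' W' (\<rho> n) n H) = (\<Sum>H\<in>?b'. G_prob M W (\<rho> n) n H)"
    using same[of n] by (intro sum.cong) (auto simp: same_G_dist_def)
  have "\<exists>H\<in>Pow (pot_edges n). H \<notin> ?b \<and> H \<notin> ?b'"
  proof (rule ccontr)
    assume "\<not> ?thesis"
    then have "Pow (pot_edges n) \<subseteq> ?b \<union> ?b'" by blast
    have "1 = (\<Sum>H\<in>Pow (pot_edges n). G_prob M W (\<rho> n) n H)" by (rule sum_G_prob[OF G(1) \<rho>, symmetric])
    also have "\<dots> \<le> (\<Sum>H\<in>?b \<union> ?b'. G_prob M W (\<rho> n) n H)"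
      using \<open>Pow (pot_edges n) \<subseteq> ?b \<union> ?b'\<close> by (intro sum_mono2 G0) auto
    also have "\<dots> \<le> (\<Sum>H\<in>?b. G_prob M W (\<rho> n) n H) + (\<Sum>H\<in>?b'. G_prob M W (\<rho> n) n H)"
      using sum.union_inter[of ?b ?b' "G_prob M W (\<rho> n) n"] sum_nonneg[of "?b \<inter> ?b'" "G_prob M W (\<rho> n) n"] G0 by auto
    also have "\<dots> < 1" using n(2,3) eq by linarith
    finally show False by simp
  qed
  then show ?thesis using n(1) by blast
qed

section \<open>Passing from one kernel to the other through the common graph\<close>

lemma off_diagonal_sum:
  fixes D :: "nat \<Rightarrow> nat \<Rightarrow> real"
  assumes sym: "\<And>i j. i < n \<Longrightarrow> j < n \<Longrightarrow> D i j = D j i" and S: "S \<subseteq> {..<n}" "T \<subseteq> {..<n}"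
  shows "(\<Sum>i\<in>S. \<Sum>j\<in>T - {i}. D i j) = (\<Sum>e\<in>cut_edges n S T. D (fst e) (snd e)) + (\<Sum>e\<in>cut_edges n T S. D (fst e) (snd e))"
proof -
  have f: "finite S" "finite T" using S by (auto intro: finite_subset)
  have fc: "finite (cut_edges n S T)" for S T by (rule finite_subset[OF cut_edges_subset]) simp
  have "(\<Sum>i\<in>S. \<Sum>j\<in>T - {i}. D i j) = (\<Sum>e\<in>(SIGMA i:S. T - {i}). D (fst e) (snd e))"
    using f by (subst sum.Sigma) (auto simp: split_beta')
  also have "(SIGMA i:S. T - {i}) = cut_edges n S T \<union> prod.swap ` cut_edges n T S"
    using S by (force simp: cut_edges_def pot_edges_def)
  also have "(\<Sum>e\<in>cut_edges n S T \<union> prod.swap ` cut_edges n T S. D (fst e) (snd e)) =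
    (\<Sum>e\<in>cut_edges n S T. D (fst e) (snd e)) + (\<Sum>e\<in>prod.swap ` cut_edges n T S. D (fst e) (snd e))"
    using fc by (intro sum.union_disjoint) (auto simp: cut_edges_def pot_edges_def)
  also have "(\<Sum>e\<in>prod.swap ` cut_edges n T S. D (fst e) (snd e)) = (\<Sum>e\<in>cut_edges n T S. D (snd e) (fst e))"
    by (subst sum.reindex) (auto simp: inj_on_def)
  also have "\<dots> = (\<Sum>e\<in>cut_edges n T S. D (fst e) (snd e))"
    by (intro sum.cong refl sym) (auto simp: cut_edges_def pot_edges_def)
  finally show ?thesis .
qed

text \<open>Both truncated kernels are close to the same rescaled \<open>H\<close>. The 4 counts two
  graphons times the two halves of a cut, the 2 counts the two step approximations, and the
  diagonal, on which the clauses of \<open>good_graph\<close> say nothing, costs at most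
  \<open>2 * K\<close> per vertex.\<close>

lemma good_graph_step_cut:
  assumes W: "\<And>y y'. y \<in> space M \<Longrightarrow> y' \<in> space M \<Longrightarrow> W y y' = W y' y"
    "\<And>y y'. y \<in> space M' \<Longrightarrow> y' \<in> space M' \<Longrightarrow> W' y y' = W' y' y"
    and g: "good_graph M W B \<gamma> \<rho> n L H x" "good_graph M' W' B' \<gamma>' \<rho> n L H x'"
    and l: "l < L" and S: "S \<subseteq> {..<n}" "T \<subseteq> {..<n}"
    and K: "\<And>z. \<bar>step_fun (\<gamma> l) z\<bar> \<le> K" "\<And>z. \<bar>step_fun (\<gamma>' l) z\<bar> \<le> K"
  shows "\<bar>\<Sum>i\<in>S. \<Sum>j\<in>T. step_fun (\<gamma> l) (code B (x i), code B (x j)) - step_fun (\<gamma>' l) (code B' (x' i), code B' (x' j))\<bar>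
    \<le> (real n)\<^sup>2 * (4 / real L + 2 / 2 ^ l) + real n * (2 * K)"
proof -
  define a where "a i j = step_fun (\<gamma> l) (code B (x i), code B (x j))" for i j
  define a' where "a' i j = step_fun (\<gamma>' l) (code B' (x' i), code B' (x' j))" for i j
  define w where "w i j = min (1/\<rho>) (W (x i) (x j))" for i j
  define w' where "w' i j = min (1/\<rho>) (W' (x' i) (x' j))" for i j
  have f: "finite S" "finite T" using S by (auto intro: finite_subset)
  have x: "x i \<in> space M" "x' i \<in> space M'" if "i < n" for i using g that by (auto simp: good_graph_def)
  have K0: "0 \<le> K" using K(1) abs_ge_zero order_trans by blast
  have e: "(\<Sum>i<n. \<Sum>j\<in>{..<n} - {i}. \<bar>w i j - a i j\<bar>) \<le> (real n)\<^sup>2 / 2 ^ l"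
    "(\<Sum>i<n. \<Sum>j\<in>{..<n} - {i}. \<bar>w' i j - a' i j\<bar>) \<le> (real n)\<^sup>2 / 2 ^ l"
    using g l by (auto simp: good_graph_def a_def w_def a'_def w'_def)
  have sub: "\<bar>\<Sum>i\<in>S. \<Sum>j\<in>T - {i}. d i j\<bar> \<le> (\<Sum>i<n. \<Sum>j\<in>{..<n} - {i}. \<bar>d i j\<bar>)" for d :: "nat \<Rightarrow> nat \<Rightarrow> real"
  proof -
    have "\<bar>\<Sum>i\<in>S. \<Sum>j\<in>T - {i}. d i j\<bar> \<le> (\<Sum>i\<in>S. \<Sum>j\<in>T - {i}. \<bar>d i j\<bar>)"
      by (rule order_trans[OF sum_abs]) (intro sum_mono sum_abs)
    also have "\<dots> \<le> (\<Sum>i\<in>S. \<Sum>j\<in>{..<n} - {i}. \<bar>d i j\<bar>)"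
      using S by (intro sum_mono sum_mono2) auto
    also have "\<dots> \<le> (\<Sum>i<n. \<Sum>j\<in>{..<n} - {i}. \<bar>d i j\<bar>)"
      using S by (intro sum_mono2) (auto intro!: sum_nonneg)
    finally show ?thesis .
  qed
  have cut: "\<bar>\<Sum>e\<in>cut_edges n S T. w (fst e) (snd e) - w' (fst e) (snd e)\<bar> \<le> 2 * (real n)\<^sup>2 / real L" for S T
  proof -
    let ?h = "\<lambda>e. of_bool (e \<in> H) / \<rho>"
    have "(\<Sum>e\<in>cut_edges n S T. w (fst e) (snd e) - w' (fst e) (snd e)) =
      (\<Sum>e\<in>cut_edges n S T. ?h e - w' (fst e) (snd e)) - (\<Sum>e\<in>cut_edges n S T. ?h e - w (fst e) (snd e))"
      by (simp add: sum_subtractf)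
    moreover have "\<bar>\<Sum>e\<in>cut_edges n S T. ?h e - w (fst e) (snd e)\<bar> \<le> (real n)\<^sup>2 / real L"
      "\<bar>\<Sum>e\<in>cut_edges n S T. ?h e - w' (fst e) (snd e)\<bar> \<le> (real n)\<^sup>2 / real L"
      using g unfolding good_graph_def w_def w'_def by blast+
    ultimately show ?thesis by linarith
  qed
  have mid: "\<bar>\<Sum>i\<in>S. \<Sum>j\<in>T - {i}. w i j - w' i j\<bar> \<le> 4 * (real n)\<^sup>2 / real L"
  proof -
    have "(\<Sum>i\<in>S. \<Sum>j\<in>T - {i}. w i j - w' i j) = (\<Sum>e\<in>cut_edges n S T. w (fst e) (snd e) - w' (fst e) (snd e)) + (\<Sum>e\<in>cut_edges n T S. w (fst e) (snd e) - w' (fst e) (snd e))"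
      by (rule off_diagonal_sum[OF _ S]) (use x W in \<open>simp add: w_def w'_def\<close>)
    then show ?thesis using cut[of S T] cut[of T S] by linarith
  qed
  have off: "(\<Sum>i\<in>S. \<Sum>j\<in>T - {i}. a i j - a' i j) =
    (\<Sum>i\<in>S. \<Sum>j\<in>T - {i}. w i j - w' i j) - (\<Sum>i\<in>S. \<Sum>j\<in>T - {i}. w i j - a i j) + (\<Sum>i\<in>S. \<Sum>j\<in>T - {i}. w' i j - a' i j)"
    by (simp add: sum_subtractf)
  have "\<bar>\<Sum>i\<in>S. \<Sum>j\<in>T - {i}. a i j - a' i j\<bar> \<le> 4 * (real n)\<^sup>2 / real L + (real n)\<^sup>2 / 2 ^ l + (real n)\<^sup>2 / 2 ^ l"
    unfolding off using mid order_trans[OF sub[of "\<lambda>i j. w i j - a i j"] e(1)] order_trans[OF sub[of "\<lambda>i j. w' i j - a' i j"] e(2)]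
    by linarith
  moreover have "(\<Sum>i\<in>S. \<Sum>j\<in>T. a i j - a' i j) = (\<Sum>i\<in>S. \<Sum>j\<in>T - {i}. a i j - a' i j) + (\<Sum>i\<in>S \<inter> T. a i i - a' i i)"
  proof -
    have "(\<Sum>j\<in>T. a i j - a' i j) = (\<Sum>j\<in>T - {i}. a i j - a' i j) + (if i \<in> T then a i i - a' i i else 0)" for i
      using f by (auto simp: sum.remove)
    then show ?thesis by (simp add: sum.distrib sum.inter_restrict[OF f(1)])
  qed
  moreover have "\<bar>\<Sum>i\<in>S \<inter> T. a i i - a' i i\<bar> \<le> real n * (2 * K)"
  proof -
    have "\<bar>\<Sum>i\<in>S \<inter> T. a i i - a' i i\<bar> \<le> (\<Sum>i\<in>S \<inter> T. \<bar>a i i - a' i i\<bar>)" by (rule sum_abs)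
    also have "\<dots> \<le> (\<Sum>i\<in>S \<inter> T. 2 * K)"
    proof (rule sum_mono)
      fix i show "\<bar>a i i - a' i i\<bar> \<le> 2 * K"
        using K(1)[of "(code B (x i), code B (x i))"] K(2)[of "(code B' (x' i), code B' (x' i))"]
        unfolding a_def a'_def by linarith
    qed
    also have "\<dots> = real (card (S \<inter> T)) * (2 * K)" by simp
    also have "\<dots> \<le> real n * (2 * K)"
      using K0 S card_mono[of "{..<n}" "S \<inter> T"] by (intro mult_right_mono) auto
    finally show ?thesis .
  qed
  ultimately have "\<bar>\<Sum>i\<in>S. \<Sum>j\<in>T. a i j - a' i j\<bar> \<le> 4 * (real n)\<^sup>2 / real L + (real n)\<^sup>2 / 2 ^ l + (real n)\<^sup>2 / 2 ^ l + real n * (2 * K)"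
    by linarith
  then show ?thesis unfolding a_def a'_def by (simp add: algebra_simps)
qed

section \<open>Cylinders as a determining class\<close>

abbreviation cylinder :: "nat set \<Rightarrow> (nat \<Rightarrow> bool) set" where
  "cylinder I \<equiv> {s. \<forall>i\<in>I. s i}"

lemma sets_cantor_space_eq: "sets cantor_space = sigma_sets UNIV {cylinder I | I. finite I}"
proof
  let ?E = "{cylinder I | I. finite I}"
  have "sigma_sets (space cantor_space) ?E \<subseteq> sets cantor_space"
    by (rule sets.sigma_sets_subset) (auto intro: cantor_cylinder)
  then show "sigma_sets UNIV ?E \<subseteq> sets cantor_space" by simp
  have "(\<lambda>x. x) \<in> measurable (sigma UNIV ?E) cantor_space"
  proof (rule measurable_cantorI)
    fix i
    have "{x. x i} = cylinder {i}" by auto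
    then show "{x \<in> space (sigma UNIV ?E). x i} \<in> sets (sigma UNIV ?E)" by (auto intro!: sigma_sets.Basic)
  qed
  from measurable_sets[OF this] show "sets cantor_space \<subseteq> sigma_sets UNIV ?E" by (auto simp: subset_eq)
qed

lemma sets_cantor_pair_eq:
  "sets (cantor_space \<Otimes>\<^sub>M cantor_space) = sigma_sets UNIV {cylinder I \<times> cylinder J | I J. finite I \<and> finite J}"
proof
  let ?E = "{cylinder I \<times> cylinder J | I J. finite I \<and> finite J}"
  have sp: "space (cantor_space \<Otimes>\<^sub>M cantor_space) = UNIV" by (simp add: space_pair_measure)
  have "sigma_sets (space (cantor_space \<Otimes>\<^sub>M cantor_space)) ?E \<subseteq> sets (cantor_space \<Otimes>\<^sub>M cantor_space)"
    by (rule sets.sigma_sets_subset) (auto intro!: pair_measureI cantor_cylinder)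
  then show "sigma_sets UNIV ?E \<subseteq> sets (cantor_space \<Otimes>\<^sub>M cantor_space)" by (simp add: sp)
  have "fst \<in> measurable (sigma UNIV ?E) cantor_space"
  proof (rule measurable_cantorI)
    fix i
    have "{x::(nat\<Rightarrow>bool)\<times>(nat\<Rightarrow>bool). fst x i} = cylinder {i} \<times> cylinder {}" by auto
    then have "{x::(nat\<Rightarrow>bool)\<times>(nat\<Rightarrow>bool). fst x i} \<in> ?E" by blast
    then show "{x \<in> space (sigma UNIV ?E). fst x i} \<in> sets (sigma UNIV ?E)" by (auto intro!: sigma_sets.Basic)
  qed
  moreover have "snd \<in> measurable (sigma UNIV ?E) cantor_space"
  proof (rule measurable_cantorI)
    fix i
    have "{x::(nat\<Rightarrow>bool)\<times>(nat\<Rightarrow>bool). snd x i} = cylinder {} \<times> cylinder {i}" by auto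
    then have "{x::(nat\<Rightarrow>bool)\<times>(nat\<Rightarrow>bool). snd x i} \<in> ?E" by blast
    then show "{x \<in> space (sigma UNIV ?E). snd x i} \<in> sets (sigma UNIV ?E)" by (auto intro!: sigma_sets.Basic)
  qed
  ultimately have "(\<lambda>x. (fst x, snd x)) \<in> measurable (sigma UNIV ?E) (cantor_space \<Otimes>\<^sub>M cantor_space)"
    by (rule measurable_Pair)
  from measurable_sets[OF this] show "sets (cantor_space \<Otimes>\<^sub>M cantor_space) \<subseteq> sigma_sets UNIV ?E" by (auto simp: subset_eq)
qed

lemma cylinder_Int: "cylinder I \<inter> cylinder J = cylinder (I \<union> J)" by auto

lemma cantor_measure_eqI:
  assumes "prob_space P" "prob_space Q" "sets P = sets cantor_space" "sets Q = sets cantor_space"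
    and eq: "\<And>I. finite I \<Longrightarrow> measure P (cylinder I) = measure Q (cylinder I)"
  shows "P = Q"
\<comment> \<open>The empty cylinder is the whole space and serves as the exhausting
  sequence.\<close>
proof (rule measure_eqI_generator_eq[where E="{cylinder I | I. finite I}" and \<Omega>=UNIV and A="\<lambda>_. cylinder {}"])
  interpret P: prob_space P by fact
  interpret Q: prob_space Q by fact
  show "Int_stable {cylinder I | I. finite I}"
  proof (rule Int_stableI)
    fix a b assume "a \<in> {cylinder I | I. finite I}" "b \<in> {cylinder I | I. finite I}"
    then obtain I J where "a = cylinder I" "b = cylinder J" "finite (I \<union> J)" by blast
    then show "a \<inter> b \<in> {cylinder I | I. finite I}" using cylinder_Int[of I J] by blast
  qed
  show "emeasure P X = emeasure Q X" if "X \<in> {cylinder I | I. finite I}" for X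
    using that eq by (auto simp: P.emeasure_eq_measure Q.emeasure_eq_measure)
  show "emeasure P (cylinder {}) \<noteq> \<infinity>" using P.emeasure_finite by simp
qed (use assms sets_cantor_space_eq in auto)

section \<open>The limiting coupling\<close>

text \<open>Two codes merged into one, so that a coupling is a single law on the Cantor space and
  one compactness argument produces it together with both marginals.\<close>

definition interleave :: "(nat \<Rightarrow> bool) \<Rightarrow> (nat \<Rightarrow> bool) \<Rightarrow> nat \<Rightarrow> bool" where
  "interleave a b i = (if even i then a (i div 2) else b (i div 2))"

definition evens :: "(nat \<Rightarrow> bool) \<Rightarrow> nat \<Rightarrow> bool" where "evens z i = z (2 * i)"

definition odds :: "(nat \<Rightarrow> bool) \<Rightarrow> nat \<Rightarrow> bool" where "odds z i = z (2 * i + 1)"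

lemma evens_interleave [simp]: "evens (interleave a b) = a"
  and odds_interleave [simp]: "odds (interleave a b) = b"
  by (auto simp: evens_def odds_def interleave_def fun_eq_iff)

lemma measurable_evens [measurable]: "evens \<in> measurable cantor_space cantor_space"
  and measurable_odds [measurable]: "odds \<in> measurable cantor_space cantor_space"
  by (rule measurable_cantorI; unfold evens_def odds_def; measurable)+

text \<open>Makes the difference of two step kernels a single step function of the interleaved bits,
  to which one limit theorem applies.\<close>

definition diff_list :: "(real \<times> nat \<times> nat) list \<Rightarrow> (real \<times> nat \<times> nat) list \<Rightarrow> (real \<times> nat \<times> nat) list" where
  "diff_list xs ys = map (\<lambda>(r, i, j). (r, 2 * i, 2 * j)) xs @ map (\<lambda>(r, i, j). (- r, 2 * i + 1, 2 * j + 1)) ys"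

lemma step_fun_append: "step_fun (xs @ ys) z = step_fun xs z + step_fun ys z"
  by (simp add: step_fun_def)

lemma step_fun_diff_list:
  "step_fun (diff_list xs ys) z = step_fun xs (evens (fst z), evens (snd z)) - step_fun ys (odds (fst z), odds (snd z))"
proof -
  have "step_fun (map (\<lambda>(r, i, j). (r, 2 * i, 2 * j)) xs) z = step_fun xs (evens (fst z), evens (snd z))"
    by (induction xs) (auto simp: evens_def)
  moreover have "step_fun (map (\<lambda>(r, i, j). (- r, 2 * i + 1, 2 * j + 1)) ys) z = - step_fun ys (odds (fst z), odds (snd z))"
    by (induction ys) (auto simp: odds_def)
  ultimately show ?thesis by (simp add: diff_list_def step_fun_append)
qed

lemma sum_of_bool_freq:
  assumes "n > 0"
  shows "(\<Sum>i\<in>{i. i < n \<and> z i \<in> cylinder I}. of_bool (z i a)) = real n * freq n z (insert a I)"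
proof -
  have "(\<Sum>i\<in>{i. i < n \<and> z i \<in> cylinder I}. of_bool (z i a)) = real (card ({i. i < n \<and> z i \<in> cylinder I} \<inter> {i. z i a}))"
    by (subst sum_of_bool_eq) auto
  also have "{i. i < n \<and> z i \<in> cylinder I} \<inter> {i. z i a} = {v. v < n \<and> (\<forall>i\<in>insert a I. z v i)}" by auto
  finally show ?thesis using assms by (simp add: freq_def)
qed

text \<open>The double sum, diagonal included, is an integral under the square of the empirical
  measure. Term by term it factors into two frequencies, because a bit restricted to a cylinder is
  the indicator of the cylinder with one more index.\<close>

lemma step_fun_empirical_limit:
  assumes \<mu>: "prob_space \<mu>" "sets \<mu> = sets cantor_space" and n: "\<And>m. n m > (0::nat)"
    and fr: "\<And>I. finite I \<Longrightarrow> (\<lambda>m. freq (n m) (z m) I) \<longlonglongrightarrow> measure \<mu> (cylinder I)"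
    and IJ: "finite I" "finite J"
  shows "(\<lambda>m. (\<Sum>i\<in>{i. i < n m \<and> z m i \<in> cylinder I}. \<Sum>j\<in>{j. j < n m \<and> z m j \<in> cylinder J}. step_fun zs (z m i, z m j)) / (real (n m))\<^sup>2)
    \<longlonglongrightarrow> (\<integral>s. indicator (cylinder I \<times> cylinder J) s * step_fun zs s \<partial>(\<mu> \<Otimes>\<^sub>M \<mu>))"
proof (induction zs)
  case Nil
  then show ?case by simp
next
  case (Cons x xs)
  interpret \<mu>: prob_space \<mu> by fact
  interpret PP: pair_prob_space \<mu> \<mu> by (intro pair_prob_spaceI \<mu>)
  obtain r a b where x: "x = (r, a, b)" by (cases x)
  let ?S = "\<lambda>m I. {i. i < n m \<and> z m i \<in> cylinder I}"
  have cyl[measurable]: "cylinder I \<in> sets \<mu>" if "finite I" for I using cantor_cylinder[OF that] by (simp add: \<mu>)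
  have s2: "sets (\<mu> \<Otimes>\<^sub>M \<mu>) = sets (cantor_space \<Otimes>\<^sub>M cantor_space)" by (intro sets_pair_measure_cong \<mu>)
  have rect: "cylinder I \<times> cylinder J \<in> sets (\<mu> \<Otimes>\<^sub>M \<mu>)" if "finite I" "finite J" for I J
    using cyl that by (intro pair_measureI) auto
  have int: "integrable (\<mu> \<Otimes>\<^sub>M \<mu>) (\<lambda>s. indicator (cylinder I \<times> cylinder J) s * step_fun ys s)" for ys
  proof -
    have "integrable (\<mu> \<Otimes>\<^sub>M \<mu>) (\<lambda>s. step_fun ys s)"
      by (rule integrable_step_fun[OF PP.finite_measure_axioms, of "\<lambda>x. x"]) (simp cong: measurable_cong_sets add: s2)
    from integrable_mult_indicator[OF rect[OF IJ] this] show ?thesis by simp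
  qed
  have e1: "(\<Sum>i\<in>?S m I. \<Sum>j\<in>?S m J. step_fun (x # xs) (z m i, z m j)) / (real (n m))\<^sup>2 =
    r * (freq (n m) (z m) (insert a I) * freq (n m) (z m) (insert b J)) + (\<Sum>i\<in>?S m I. \<Sum>j\<in>?S m J. step_fun xs (z m i, z m j)) / (real (n m))\<^sup>2" for m
  proof -
    have "(\<Sum>i\<in>?S m I. \<Sum>j\<in>?S m J. step_fun (x # xs) (z m i, z m j)) =
      (\<Sum>i\<in>?S m I. \<Sum>j\<in>?S m J. r * (of_bool (z m i a) * of_bool (z m j b))) + (\<Sum>i\<in>?S m I. \<Sum>j\<in>?S m J. step_fun xs (z m i, z m j))"
      unfolding x by (simp add: sum.distrib mult.assoc)
    also have "(\<Sum>i\<in>?S m I. \<Sum>j\<in>?S m J. r * (of_bool (z m i a) * of_bool (z m j b))) =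
      r * ((\<Sum>i\<in>?S m I. of_bool (z m i a)) * (\<Sum>j\<in>?S m J. of_bool (z m j b)))"
      unfolding sum_product by (simp only: sum_distrib_left)
    also have "\<dots> = (real (n m))\<^sup>2 * (r * (freq (n m) (z m) (insert a I) * freq (n m) (z m) (insert b J)))"
      unfolding sum_of_bool_freq[OF n] by (simp add: power2_eq_square)
    finally show ?thesis using n[of m] by (simp add: add_divide_distrib)
  qed
  have e2: "(\<integral>s. indicator (cylinder I \<times> cylinder J) s * step_fun (x # xs) s \<partial>(\<mu> \<Otimes>\<^sub>M \<mu>)) =
    r * (measure \<mu> (cylinder (insert a I)) * measure \<mu> (cylinder (insert b J))) + (\<integral>s. indicator (cylinder I \<times> cylinder J) s * step_fun xs s \<partial>(\<mu> \<Otimes>\<^sub>M \<mu>))"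
  proof -
    have R: "cylinder (insert a I) \<times> cylinder (insert b J) \<in> sets (\<mu> \<Otimes>\<^sub>M \<mu>)" using IJ by (intro rect) auto
    have times: "measure (\<mu> \<Otimes>\<^sub>M \<mu>) (A \<times> C) = measure \<mu> A * measure \<mu> C" if "A \<in> sets \<mu>" "C \<in> sets \<mu>" for A C
      using that by (simp add: measure_def \<mu>.emeasure_pair_measure_Times enn2real_mult)
    have aux: "(\<integral>s. r * indicator R s + indicator (cylinder I \<times> cylinder J) s * step_fun xs s \<partial>(\<mu> \<Otimes>\<^sub>M \<mu>)) =
      r * measure (\<mu> \<Otimes>\<^sub>M \<mu>) R + (\<integral>s. indicator (cylinder I \<times> cylinder J) s * step_fun xs s \<partial>(\<mu> \<Otimes>\<^sub>M \<mu>))"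
      if "R \<in> sets (\<mu> \<Otimes>\<^sub>M \<mu>)" for R
      using that int sets.sets_into_space[OF that]
      by (subst Bochner_Integration.integral_add)
        (auto intro!: integrable_mult_right integrable_real_indicator simp: PP.emeasure_eq_measure Int_absorb2)
    have "(\<integral>s. indicator (cylinder I \<times> cylinder J) s * step_fun (x # xs) s \<partial>(\<mu> \<Otimes>\<^sub>M \<mu>)) =
      (\<integral>s. r * indicator (cylinder (insert a I) \<times> cylinder (insert b J)) s + indicator (cylinder I \<times> cylinder J) s * step_fun xs s \<partial>(\<mu> \<Otimes>\<^sub>M \<mu>))"
      unfolding x by (rule Bochner_Integration.integral_cong) (auto simp: indicator_def)
    also have "\<dots> = r * measure (\<mu> \<Otimes>\<^sub>M \<mu>) (cylinder (insert a I) \<times> cylinder (insert b J)) + (\<integral>s. indicator (cylinder I \<times> cylinder J) s * step_fun xs s \<partial>(\<mu> \<Otimes>\<^sub>M \<mu>))"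
      by (rule aux[OF R])
    also have "measure (\<mu> \<Otimes>\<^sub>M \<mu>) (cylinder (insert a I) \<times> cylinder (insert b J)) = measure \<mu> (cylinder (insert a I)) * measure \<mu> (cylinder (insert b J))"
      using IJ by (intro times cyl) auto
    finally show ?thesis .
  qed
  show ?case unfolding e1 e2 by (intro tendsto_intros fr Cons.IH) (use IJ in auto)
qed


text \<open>\<open>h\<close> gives the position at which bit \<open>i\<close> of the marginal sits
  in the joint sequence; cylinders of the marginal are then cylinders of the joint law, where the
  limit of the frequencies is known.\<close>

lemma meas_pres_cantor_marginal:
  assumes M: "prob_space M" and B: "\<And>i. B i \<in> sets M" and \<mu>: "prob_space \<mu>" "sets \<mu> = sets cantor_space"
    and [measurable]: "p \<in> measurable cantor_space cantor_space"
    and ind: "\<And>I z. (\<forall>i\<in>I. p z i) \<longleftrightarrow> (\<forall>i\<in>h ` I. z i)"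
    and eq: "\<And>I. finite I \<Longrightarrow> measure \<mu> (cylinder (h ` I)) = measure M {y \<in> space M. \<forall>i\<in>I. code B y i}"
  shows "meas_pres \<mu> (distr M cantor_space (code B)) p"
proof -
  have c[measurable]: "code B \<in> measurable M cantor_space" using measurable_code[OF B] .
  have p: "p \<in> measurable \<mu> cantor_space" using \<mu>(2) by (simp cong: measurable_cong_sets)
  have sp: "space \<mu> = UNIV" using sets_eq_imp_space_eq[OF \<mu>(2)] by simp
  have "distr \<mu> cantor_space p = distr M cantor_space (code B)"
  proof (rule cantor_measure_eqI)
    fix I :: "nat set" assume I: "finite I"
    have "p -` cylinder I \<inter> space \<mu> = cylinder (h ` I)"
      by (rule set_eqI) (simp only: vimage_eq Int_iff mem_Collect_eq sp UNIV_I simp_thms ind)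
    then have "measure (distr \<mu> cantor_space p) (cylinder I) = measure \<mu> (cylinder (h ` I))"
      using measure_distr[OF p cantor_cylinder[OF I]] by simp
    also have "\<dots> = measure M {y \<in> space M. \<forall>i\<in>I. code B y i}" by (rule eq[OF I])
    also have "\<dots> = measure (distr M cantor_space (code B)) (cylinder I)"
      using I c by (subst measure_distr) (auto intro!: arg_cong[where f="measure M"])
    finally show "measure (distr \<mu> cantor_space p) (cylinder I) = measure (distr M cantor_space (code B)) (cylinder I)" .
  qed (use M \<mu> p c in \<open>auto intro: prob_space.prob_space_distr\<close>)
  moreover have "distr \<mu> (distr M cantor_space (code B)) p = distr \<mu> cantor_space p"
    by (rule distr_cong) auto
  ultimately show ?thesis using p by (simp add: meas_pres_def)
qed

text \<open>The precision \<open>Suc m\<close> grows along the sequence, so the marginals become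
  exact and the graph and diagonal errors vanish. The level \<open>l\<close> of the step
  approximation stays fixed, which leaves \<open>2 / 2 ^ l\<close>.\<close>

lemma graphon_coupling:
  assumes G: "graphon M W" "graphon M' W'" and B: "\<And>i. B i \<in> sets M" "\<And>i. B' i \<in> sets M'"
    and \<gamma>: "\<And>l. (\<integral>z. \<bar>W (fst z) (snd z) - step_fun (\<gamma> l) (code_pair B z)\<bar> \<partial>(M \<Otimes>\<^sub>M M)) < (1/4) ^ l / 32"
      "\<And>l. (\<integral>z. \<bar>W' (fst z) (snd z) - step_fun (\<gamma>' l) (code_pair B' z)\<bar> \<partial>(M' \<Otimes>\<^sub>M M')) < (1/4) ^ l / 32"
    and \<rho>: "\<And>n. 0 < \<rho> n" and n\<rho>: "filterlim (\<lambda>n. real n * \<rho> n) at_top sequentially"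
    and tail: "(\<lambda>n. \<integral>z. \<bar>W (fst z) (snd z) - min (1 / \<rho> n) (W (fst z) (snd z))\<bar> \<partial>(M \<Otimes>\<^sub>M M)) \<longlonglongrightarrow> 0"
      "(\<lambda>n. \<integral>z. \<bar>W' (fst z) (snd z) - min (1 / \<rho> n) (W' (fst z) (snd z))\<bar> \<partial>(M' \<Otimes>\<^sub>M M')) \<longlonglongrightarrow> 0"
    and same: "\<And>n. same_G_dist M W M' W' (\<rho> n) n"
  obtains \<mu> where "prob_space \<mu>" "sets \<mu> = sets cantor_space"
    "meas_pres \<mu> (distr M cantor_space (code B)) evens" "meas_pres \<mu> (distr M' cantor_space (code B')) odds"
    "\<And>I J l. finite I \<Longrightarrow> finite J \<Longrightarrow> \<bar>\<integral>s. indicator (cylinder I \<times> cylinder J) s *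
       (step_fun (\<gamma> l) (evens (fst s), evens (snd s)) - step_fun (\<gamma>' l) (odds (fst s), odds (snd s))) \<partial>(\<mu> \<Otimes>\<^sub>M \<mu>)\<bar> \<le> 2 / 2 ^ l"
proof -
  have "\<forall>m. \<exists>n H x x'. n \<ge> Suc m \<and> good_graph M W B \<gamma> (\<rho> n) n (Suc m) H x \<and> good_graph M' W' B' \<gamma>' (\<rho> n) n (Suc m) H x'"
    using common_good_graph[OF G B \<gamma> \<rho> n\<rho> tail _ same] by blast
  then obtain n H x x' where n: "\<And>m. n m \<ge> Suc m"
    and g: "\<And>m. good_graph M W B \<gamma> (\<rho> (n m)) (n m) (Suc m) (H m) (x m)"
    and g': "\<And>m. good_graph M' W' B' \<gamma>' (\<rho> (n m)) (n m) (Suc m) (H m) (x' m)"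
    by metis
  have n0: "n m > 0" for m using n[of m] by simp
  define z where "z m v = interleave (code B (x m v)) (code B' (x' m v))" for m v
  obtain r \<mu> where r: "strict_mono (r :: nat \<Rightarrow> nat)" and \<mu>: "prob_space \<mu>" "sets \<mu> = sets cantor_space"
    and fr: "\<And>I. finite I \<Longrightarrow> (\<lambda>m. freq (n (r m)) (z (r m)) I) \<longlonglongrightarrow> measure \<mu> (cylinder I)"
    using cantor_empirical_compactness[of n z, OF n0] by metis
  have rm: "m \<le> r m" for m using r by (rule seq_suble)
  have inv: "(\<lambda>m. c / real (Suc (r m))) \<longlonglongrightarrow> 0" for c :: real
    using LIMSEQ_subseq_LIMSEQ[OF LIMSEQ_Suc[OF lim_const_over_n[of c]] r] by (simp add: comp_def)
  \<comment> \<open>At stage \<open>m\<close> only bits below \<open>Suc m\<close> are controlled,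
    but each finite \<open>I\<close> falls in that range from some stage on.\<close>
  have marg: "measure \<mu> (cylinder (h ` I)) = q I"
    if I: "finite I" and h: "\<And>m v. (\<forall>i\<in>h ` I. z m v i) \<longleftrightarrow> (\<forall>i\<in>I. y m v i)"
      and q: "\<And>m. I \<subseteq> {..<Suc m} \<Longrightarrow> \<bar>freq (n m) (y m) I - q I\<bar> \<le> 1 / real (Suc m)"
    for I h q and y :: "nat \<Rightarrow> nat \<Rightarrow> nat \<Rightarrow> bool"
  proof -
    have f: "freq (n m) (z m) (h ` I) = freq (n m) (y m) I" for m
      unfolding freq_def h ..
    have "(\<lambda>m. freq (n (r m)) (y (r m)) I - q I) \<longlonglongrightarrow> 0"
    proof (rule Lim_null_comparison[OF _ inv[of 1]])
      obtain k where "I \<subseteq> {..<k}" using finite_nat_iff_bounded[of I] I by blast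
      then have k: "I \<subseteq> {..<Suc (r m)}" if "m \<ge> k" for m using that rm[of m] by auto
      show "\<forall>\<^sub>F m in sequentially. norm (freq (n (r m)) (y (r m)) I - q I) \<le> 1 / real (Suc (r m))"
        using eventually_ge_at_top[of k]
      proof eventually_elim
        case (elim m)
        from q[OF k[OF this]] show ?case by simp
      qed
    qed
    then have "(\<lambda>m. freq (n (r m)) (y (r m)) I) \<longlonglongrightarrow> q I" by (simp add: LIM_zero_iff)
    moreover have "(\<lambda>m. freq (n (r m)) (y (r m)) I) \<longlonglongrightarrow> measure \<mu> (cylinder (h ` I))"
      using fr[of "h ` I"] I unfolding f by simp
    ultimately show ?thesis by (rule LIMSEQ_unique[symmetric])
  qed
  have m1: "meas_pres \<mu> (distr M cantor_space (code B)) evens"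
  proof (rule meas_pres_cantor_marginal[where h="\<lambda>i. 2 * i", OF graphonD(1)[OF G(1)] B(1) \<mu>])
    fix I :: "nat set" assume I: "finite I"
    show "measure \<mu> (cylinder ((\<lambda>i. 2 * i) ` I)) = measure M {y \<in> space M. \<forall>i\<in>I. code B y i}"
    proof (rule marg[OF I, where y="\<lambda>m v. code B (x m v)"])
      show "\<bar>freq (n m) (\<lambda>v. code B (x m v)) I - measure M {y \<in> space M. \<forall>i\<in>I. code B y i}\<bar> \<le> 1 / real (Suc m)"
        if "I \<subseteq> {..<Suc m}" for m
        using g[of m] that unfolding good_graph_def by blast
    qed (auto simp: z_def interleave_def)
  qed (auto simp: evens_def)
  have m2: "meas_pres \<mu> (distr M' cantor_space (code B')) odds"
  proof (rule meas_pres_cantor_marginal[where h="\<lambda>i. 2 * i + 1", OF graphonD(1)[OF G(2)] B(2) \<mu>])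
    fix I :: "nat set" assume I: "finite I"
    show "measure \<mu> (cylinder ((\<lambda>i. 2 * i + 1) ` I)) = measure M' {y \<in> space M'. \<forall>i\<in>I. code B' y i}"
    proof (rule marg[OF I, where y="\<lambda>m v. code B' (x' m v)"])
      show "\<bar>freq (n m) (\<lambda>v. code B' (x' m v)) I - measure M' {y \<in> space M'. \<forall>i\<in>I. code B' y i}\<bar> \<le> 1 / real (Suc m)"
        if "I \<subseteq> {..<Suc m}" for m
        using g'[of m] that unfolding good_graph_def by blast
    qed (auto simp: z_def interleave_def)
  qed (auto simp: odds_def)
  have ker: "\<bar>\<integral>s. indicator (cylinder I \<times> cylinder J) s *
       (step_fun (\<gamma> l) (evens (fst s), evens (snd s)) - step_fun (\<gamma>' l) (odds (fst s), odds (snd s))) \<partial>(\<mu> \<Otimes>\<^sub>M \<mu>)\<bar> \<le> 2 / 2 ^ l"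
    if IJ: "finite I" "finite J" for I J l
  proof -
    \<comment> \<open>The cut norm is tested on vertex sets read off from the codes, because these
      are the cuts that survive in the limit.\<close>
    let ?S = "\<lambda>m I. {i. i < n m \<and> z m i \<in> cylinder I}"
    let ?D = "diff_list (\<gamma> l) (\<gamma>' l)"
    let ?X = "\<lambda>m. (\<Sum>i\<in>?S m I. \<Sum>j\<in>?S m J. step_fun ?D (z m i, z m j))"
    define K where "K = (\<Sum>(r, i, j)\<leftarrow>\<gamma> l. \<bar>r\<bar>) + (\<Sum>(r, i, j)\<leftarrow>\<gamma>' l. \<bar>r\<bar>)"
    have nonneg: "0 \<le> (\<Sum>(r, i, j)\<leftarrow>xs. \<bar>r::real\<bar>)" for xs :: "(real \<times> nat \<times> nat) list"
      by (rule order_trans[OF abs_ge_zero step_fun_bounded])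
    have K: "\<bar>step_fun (\<gamma> l) s\<bar> \<le> K" "\<bar>step_fun (\<gamma>' l) s\<bar> \<le> K" for s
      using step_fun_bounded[of "\<gamma> l" s] step_fun_bounded[of "\<gamma>' l" s] nonneg[of "\<gamma> l"] nonneg[of "\<gamma>' l"]
      unfolding K_def by linarith+
    have K0: "0 \<le> K" using nonneg by (simp add: K_def)
    have lim: "(\<lambda>m. ?X (r m) / (real (n (r m)))\<^sup>2) \<longlonglongrightarrow> (\<integral>s. indicator (cylinder I \<times> cylinder J) s * step_fun ?D s \<partial>(\<mu> \<Otimes>\<^sub>M \<mu>))"
      by (rule step_fun_empirical_limit[where n="\<lambda>m. n (r m)" and z="\<lambda>m. z (r m)", OF \<mu> n0 fr IJ])
    have bound: "\<bar>?X m / (real (n m))\<^sup>2\<bar> \<le> (4 + 2 * K) / real (Suc m) + 2 / 2 ^ l" if "l < Suc m" for m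
    proof -
      have "\<bar>?X m\<bar> \<le> (real (n m))\<^sup>2 * (4 / real (Suc m) + 2 / 2 ^ l) + real (n m) * (2 * K)"
        unfolding step_fun_diff_list z_def fst_conv snd_conv evens_interleave odds_interleave
        by (rule good_graph_step_cut[OF graphonD(5)[OF G(1)] graphonD(5)[OF G(2)] g g' that _ _ K]) auto
      then have "\<bar>?X m\<bar> / (real (n m))\<^sup>2 \<le> ((real (n m))\<^sup>2 * (4 / real (Suc m) + 2 / 2 ^ l) + real (n m) * (2 * K)) / (real (n m))\<^sup>2"
        by (rule divide_right_mono) simp
      also have "\<dots> = 4 / real (Suc m) + 2 / 2 ^ l + 2 * K / real (n m)"
        using n0[of m] by (simp add: add_divide_distrib power2_eq_square)
      also have "\<dots> \<le> 4 / real (Suc m) + 2 / 2 ^ l + 2 * K / real (Suc m)"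
        using K0 n[of m] by (intro add_left_mono divide_left_mono) auto
      finally show ?thesis by (simp add: abs_divide add_divide_distrib)
    qed
    have "\<bar>\<integral>s. indicator (cylinder I \<times> cylinder J) s * step_fun ?D s \<partial>(\<mu> \<Otimes>\<^sub>M \<mu>)\<bar> \<le> 0 + 2 / 2 ^ l"
    proof (rule LIMSEQ_le[OF tendsto_rabs[OF lim] tendsto_add[OF inv[of "4 + 2 * K"] tendsto_const]])
      show "\<exists>N. \<forall>m\<ge>N. \<bar>?X (r m) / (real (n (r m)))\<^sup>2\<bar> \<le> (4 + 2 * K) / real (Suc (r m)) + 2 / 2 ^ l"
      proof (intro exI[of _ l] allI impI)
        fix m assume "m \<ge> l"
        then show "\<bar>?X (r m) / (real (n (r m)))\<^sup>2\<bar> \<le> (4 + 2 * K) / real (Suc (r m)) + 2 / 2 ^ l"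
          using rm[of m] by (intro bound) linarith
      qed
    qed
    then show ?thesis unfolding step_fun_diff_list by simp
  qed
  show ?thesis by (rule that[OF \<mu> m1 m2 ker])
qed

section \<open>Equivalence of graphons\<close>

lemma G_prob_pullback:
  assumes G: "graphon M W" "graphon N U" and \<phi>: "meas_pres M N \<phi>" and pb: "pullback_ae M W U \<phi>" and \<rho>: "\<rho> > 0"
  shows "G_prob M W \<rho> n H = G_prob N U \<rho> n H"
proof -
  let ?I = "{..<n}"
  let ?P = "PiM ?I (\<lambda>_. M)" and ?Q = "PiM ?I (\<lambda>_. N)"
  let ?w = "\<lambda>x. graph_weight (pot_edges n) (edge_prob W \<rho> x) H"
  let ?u = "\<lambda>y. graph_weight (pot_edges n) (edge_prob U \<rho> y) H"
  have [measurable]: "\<phi> \<in> measurable M N" and d: "distr M N \<phi> = N" using \<phi> by (auto simp: meas_pres_def)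
  have Q: "distr ?P ?Q (compose ?I \<phi>) = ?Q"
    using distr_PiM_finite_prob_space'[of ?I "\<lambda>_. M" "\<lambda>_. N" \<phi>] graphonD(1)[OF G(1)] graphonD(1)[OF G(2)] by (simp add: d)
  have m: "compose ?I \<phi> \<in> measurable ?P ?Q"
    unfolding compose_def by measurable
  have u[measurable]: "?u \<in> borel_measurable ?Q" using integrable_graph_weight[OF G(2) \<rho>, of n H] by (rule borel_measurable_integrable)
  have w[measurable]: "?w \<in> borel_measurable ?P" using integrable_graph_weight[OF G(1) \<rho>, of n H] by (rule borel_measurable_integrable)
  have "G_prob N U \<rho> n H = (\<integral>y. ?u y \<partial>distr ?P ?Q (compose ?I \<phi>))"
    unfolding G_prob_eq_weight Q ..
  also have "\<dots> = (\<integral>x. ?u (compose ?I \<phi> x) \<partial>?P)" by (rule integral_distr[OF m u])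
  also have "\<dots> = (\<integral>x. ?w x \<partial>?P)"
  proof (rule integral_cong_AE)
    show "(\<lambda>x. ?u (compose ?I \<phi> x)) \<in> borel_measurable ?P" by (rule measurable_compose[OF m u])
    have "AE x in ?P. W (x (fst e)) (x (snd e)) = U (\<phi> (x (fst e))) (\<phi> (x (snd e)))" if "e \<in> pot_edges n" for e
      using AE_meas_pres[OF meas_pres_PiM_pair[OF graphonD(1)[OF G(1)], of ?I "fst e" "snd e"] pb[unfolded pullback_ae_def]] that
      by (auto simp: pot_edges_def)
    then have "AE x in ?P. \<forall>e\<in>pot_edges n. W (x (fst e)) (x (snd e)) = U (\<phi> (x (fst e))) (\<phi> (x (snd e)))"
      by (intro AE_finite_allI) auto
    then show "AE x in ?P. ?u (compose ?I \<phi> x) = ?w x"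
    proof eventually_elim
      case (elim x)
      have "edge_prob U \<rho> (compose ?I \<phi> x) e = edge_prob W \<rho> x e" if "e \<in> pot_edges n" for e
      proof -
        have "fst e < n" "snd e < n" using that by (auto simp: pot_edges_def)
        then show ?thesis using elim that by (simp add: edge_prob_def compose_def)
      qed
      then show ?case unfolding graph_weight_def by (intro prod.cong) auto
    qed
  qed (rule w)
  finally show ?thesis by (simp add: G_prob_eq_weight)
qed

lemma same_G_dist_if_equiv_via:
  assumes "graphon M W" "graphon M' W'" "equiv_via M W M' W' M'' U \<phi> \<phi>'" "\<rho> > 0"
  shows "same_G_dist M W M' W' \<rho> n"
  using assms G_prob_pullback[of M W M'' U \<phi> \<rho> n] G_prob_pullback[of M' W' M'' U \<phi>' \<rho> n]
  unfolding same_G_dist_def equiv_via_def by metis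

section \<open>Normalising kernels and placing the quotient on the real line\<close>

lemma AE_pair_swap:
  assumes M: "prob_space M" and ae: "AE z in M \<Otimes>\<^sub>M M. P z"
  shows "AE z in M \<Otimes>\<^sub>M M. P (snd z, fst z)"
proof -
  interpret pair_prob_space M M by (intro pair_prob_spaceI M)
  have "meas_pres (M \<Otimes>\<^sub>M M) (M \<Otimes>\<^sub>M M) (\<lambda>(x, y). (y, x))"
    unfolding meas_pres_def using distr_pair_swap by auto
  from AE_meas_pres[OF this ae] show ?thesis by (simp add: split_beta')
qed

text \<open>The factor argument is for kernels bounded by 1, while graphons may be unbounded; an
  injective bounded change of values loses no information.\<close>

definition squash :: "real \<Rightarrow> real" where "squash x = x / (1 + \<bar>x\<bar>)"

definition unsquash :: "real \<Rightarrow> real" where "unsquash y = y / (1 - \<bar>y\<bar>)"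

lemma squash_bounded: "\<bar>squash x\<bar> \<le> 1"
  by (simp add: squash_def abs_divide)

lemma unsquash_squash [simp]: "unsquash (squash x) = x"
proof -
  have p: "1 + \<bar>x\<bar> > 0" by linarith
  have "1 - \<bar>squash x\<bar> = 1 / (1 + \<bar>x\<bar>)"
    using p by (simp add: squash_def abs_divide field_simps)
  then show ?thesis using p by (simp add: unsquash_def squash_def)
qed

lemma measurable_squash [measurable]: "squash \<in> borel_measurable borel" "unsquash \<in> borel_measurable borel"
  unfolding squash_def unsquash_def by measurable

text \<open>\<open>V\<close> is an a.e. limit and inherits symmetry only almost everywhere.
  Averaging makes it symmetric at every point, as \<open>common_kernel\<close> demands.\<close>

definition sym_squash :: "('a \<times> 'a \<Rightarrow> real) \<Rightarrow> 'a \<times> 'a \<Rightarrow> real" where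
  "sym_squash V z = squash ((V z + V (snd z, fst z)) / 2)"

text \<open>After \<open>unsquash\<close>, \<open>U\<close> is symmetric and nonnegative only almost
  everywhere. The average and \<open>max 0\<close> repair this at every point, as
  \<open>graphon\<close> demands, and leave the values unchanged almost everywhere.\<close>

definition real_kernel :: "((nat \<Rightarrow> bool) \<times> (nat \<Rightarrow> bool) \<Rightarrow> real) \<Rightarrow> real \<Rightarrow> real \<Rightarrow> real" where
  "real_kernel U u v = max 0 ((unsquash (U (cantor_digits u, cantor_digits v)) + unsquash (U (cantor_digits v, cantor_digits u))) / 2)"

lemma measurable_sym_squash [measurable]:
  assumes [measurable]: "V \<in> borel_measurable (N \<Otimes>\<^sub>M N)"
  shows "sym_squash V \<in> borel_measurable (N \<Otimes>\<^sub>M N)"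
  unfolding sym_squash_def by measurable

lemma measurable_real_kernel:
  assumes [measurable]: "U \<in> borel_measurable (cantor_space \<Otimes>\<^sub>M cantor_space)"
  shows "(\<lambda>z. real_kernel U (fst z) (snd z)) \<in> borel_measurable (borel \<Otimes>\<^sub>M borel)"
  unfolding real_kernel_def by measurable

lemma pullback_real_kernel:
  fixes V U :: "(nat \<Rightarrow> bool) \<times> (nat \<Rightarrow> bool) \<Rightarrow> real"
  assumes G: "graphon M W" and B: "\<And>i. B i \<in> sets M"
    and V: "AE z in M \<Otimes>\<^sub>M M. W (fst z) (snd z) = V (code_pair B z)"
    and U: "AE z in distr M cantor_space (code B) \<Otimes>\<^sub>M distr M cantor_space (code B). sym_squash V z = U (code_pair A z)"
  shows "pullback_ae M W (real_kernel U) (\<lambda>x. cantor_embed (code A (code B x)))"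
proof -
  note W = graphonD[OF G]
  let ?N = "distr M cantor_space (code B)"
  have c: "code B \<in> measurable M cantor_space" using measurable_code[OF B] .
  have N: "prob_space ?N" using prob_space.prob_space_distr[OF W(1) c] .
  have mp: "meas_pres M ?N (code B)" using c by (auto simp: meas_pres_def intro: distr_cong)
  have U1: "AE z in M \<Otimes>\<^sub>M M. sym_squash V (code_pair B z) = U (code_pair A (code_pair B z))"
    using AE_meas_pres[OF meas_pres_pair[OF N mp] U] by (simp add: code_pair_def)
  show ?thesis
    unfolding pullback_ae_def
    \<comment> \<open>The swapped statements account for the second summand in each of the two
      averages.\<close>
    using V AE_pair_swap[OF W(1) V] U1 AE_pair_swap[OF W(1) U1] AE_space
  proof eventually_elim
    case (elim z)
    have sp: "fst z \<in> space M" "snd z \<in> space M" using elim(5) by (auto simp: space_pair_measure)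
    have w: "W (snd z) (fst z) = W (fst z) (snd z)" "0 \<le> W (fst z) (snd z)"
      using W(4,5) sp by auto
    have s: "sym_squash V (code_pair B z) = squash (W (fst z) (snd z))" "sym_squash V (code_pair B (snd z, fst z)) = squash (W (fst z) (snd z))"
      using elim(1,2) w by (simp_all add: sym_squash_def code_pair_def)
    have "unsquash (U (code_pair A (code_pair B z))) = W (fst z) (snd z)" "unsquash (U (code_pair A (code_pair B (snd z, fst z)))) = W (fst z) (snd z)"
      using elim(3,4) s by (metis unsquash_squash)+
    then show ?case using w(2) by (simp add: real_kernel_def code_pair_def)
  qed
qed

text \<open>Integrability is inherited from \<open>W\<close> along the measure-preserving map;
  symmetry and sign hold at every point by construction.\<close>

lemma graphon_real_kernel:
  assumes G: "graphon M W" and \<phi>: "meas_pres M N \<phi>" and N: "sets N = sets borel" and pb: "pullback_ae M W (real_kernel U) \<phi>"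
    and U: "U \<in> borel_measurable (cantor_space \<Otimes>\<^sub>M cantor_space)"
  shows "graphon N (real_kernel U)"
proof -
  note W = graphonD[OF G]
  have pN: "prob_space N" by (rule prob_space_meas_pres[OF \<phi> W(1)])
  let ?f = "\<lambda>z. (\<phi> (fst z), \<phi> (snd z))"
  have mp: "?f \<in> measurable (M \<Otimes>\<^sub>M M) (N \<Otimes>\<^sub>M N)" "distr (M \<Otimes>\<^sub>M M) (N \<Otimes>\<^sub>M N) ?f = N \<Otimes>\<^sub>M N"
    using meas_pres_pair[OF pN \<phi>] by (auto simp: meas_pres_def)
  have "sets (N \<Otimes>\<^sub>M N) = sets (borel \<Otimes>\<^sub>M borel :: (real \<times> real) measure)" by (intro sets_pair_measure_cong N)
  then have k: "(\<lambda>z. real_kernel U (fst z) (snd z)) \<in> borel_measurable (N \<Otimes>\<^sub>M N)"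
    using measurable_real_kernel[OF U] by (simp cong: measurable_cong_sets)
  have "integrable (M \<Otimes>\<^sub>M M) (\<lambda>z. real_kernel U (fst (?f z)) (snd (?f z)))"
  proof (rule integrable_cong_AE_imp[OF W(3)])
    show "(\<lambda>z. real_kernel U (fst (?f z)) (snd (?f z))) \<in> borel_measurable (M \<Otimes>\<^sub>M M)"
      by (rule measurable_compose[OF mp(1) k])
    show "AE z in M \<Otimes>\<^sub>M M. W (fst z) (snd z) = real_kernel U (fst (?f z)) (snd (?f z))"
      using pb unfolding pullback_ae_def by eventually_elim simp
  qed
  then have "integrable (N \<Otimes>\<^sub>M N) (\<lambda>z. real_kernel U (fst z) (snd z))"
    using integrable_distr_eq[OF mp(1) k] mp(2) by simp
  moreover have "real_kernel U u v = real_kernel U v u" "0 \<le> real_kernel U u v" for u v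
    by (simp_all add: real_kernel_def add.commute)
  ultimately show ?thesis unfolding graphon_def using pN k by auto
qed

text \<open>A version of \<open>W\<close> on codes, approximated by the same lists
  \<open>\<gamma>\<close> that enter the coupling, so that the two can be compared.\<close>

lemma cantor_L1_limit:
  assumes G: "graphon M W" and B: "\<And>i. B i \<in> sets M"
    and \<gamma>: "\<And>l. (\<integral>z. \<bar>W (fst z) (snd z) - step_fun (\<gamma> l) (code_pair B z)\<bar> \<partial>(M \<Otimes>\<^sub>M M)) < (1/4) ^ l / 32"
  defines "N \<equiv> distr M cantor_space (code B)"
  obtains V where "V \<in> borel_measurable (cantor_space \<Otimes>\<^sub>M cantor_space)"
    "AE z in M \<Otimes>\<^sub>M M. W (fst z) (snd z) = V (code_pair B z)"
    "integrable (N \<Otimes>\<^sub>M N) V"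
    "\<And>l. (\<integral>z. \<bar>V z - step_fun (\<gamma> l) z\<bar> \<partial>(N \<Otimes>\<^sub>M N)) < (1/4) ^ l / 32"
proof -
  note W = graphonD[OF G]
  interpret MM: pair_prob_space M M by (intro pair_prob_spaceI W)
  have c: "code B \<in> measurable M cantor_space" using measurable_code[OF B] .
  have cp[measurable]: "code_pair B \<in> measurable (M \<Otimes>\<^sub>M M) (cantor_space \<Otimes>\<^sub>M cantor_space)" using measurable_code_pair[OF B] .
  have "\<exists>V \<in> borel_measurable (cantor_space \<Otimes>\<^sub>M cantor_space). AE z in M \<Otimes>\<^sub>M M. W (fst z) (snd z) = V (code_pair B z)"
  proof (rule L1_limit_factors[where g="\<lambda>l. step_fun (\<gamma> l)", OF W(3) cp])
    show "integrable (M \<Otimes>\<^sub>M M) (\<lambda>x. step_fun (\<gamma> l) (code_pair B x))" for l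
      by (rule integrable_step_fun) (auto intro: MM.finite_measure_axioms)
    show "(\<lambda>l. \<integral>x. \<bar>W (fst x) (snd x) - step_fun (\<gamma> l) (code_pair B x)\<bar> \<partial>(M \<Otimes>\<^sub>M M)) \<longlonglongrightarrow> 0"
    proof (rule tendsto_sandwich[OF _ _ tendsto_const])
      show "(\<lambda>l. (1/4::real) ^ l / 32) \<longlonglongrightarrow> 0"
        using tendsto_divide[OF LIMSEQ_realpow_zero[of "1/4::real"] tendsto_const[of 32]] by simp
      show "\<forall>\<^sub>F l in sequentially. (\<integral>x. \<bar>W (fst x) (snd x) - step_fun (\<gamma> l) (code_pair B x)\<bar> \<partial>(M \<Otimes>\<^sub>M M)) \<le> (1/4) ^ l / 32"
        by (intro always_eventually allI less_imp_le \<gamma>)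
    qed auto
  qed auto
  then obtain V where V[measurable]: "V \<in> borel_measurable (cantor_space \<Otimes>\<^sub>M cantor_space)"
    and WV: "AE z in M \<Otimes>\<^sub>M M. W (fst z) (snd z) = V (code_pair B z)" by blast
  have mp: "meas_pres M N (code B)" unfolding N_def using c by (auto simp: meas_pres_def intro: distr_cong)
  have pN: "prob_space N" by (rule prob_space_meas_pres[OF mp W(1)])
  have mp2: "code_pair B \<in> measurable (M \<Otimes>\<^sub>M M) (N \<Otimes>\<^sub>M N)" "distr (M \<Otimes>\<^sub>M M) (N \<Otimes>\<^sub>M N) (code_pair B) = N \<Otimes>\<^sub>M N"
    using meas_pres_pair[OF pN mp] by (auto simp: meas_pres_def code_pair_def[abs_def])
  have "sets (N \<Otimes>\<^sub>M N) = sets (cantor_space \<Otimes>\<^sub>M cantor_space)"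
    by (intro sets_pair_measure_cong) (simp_all add: N_def)
  then have VN: "V \<in> borel_measurable (N \<Otimes>\<^sub>M N)" and sN: "step_fun xs \<in> borel_measurable (N \<Otimes>\<^sub>M N)" for xs
    using V measurable_step_fun[of xs] by (simp_all cong: measurable_cong_sets)
  have "integrable (M \<Otimes>\<^sub>M M) (\<lambda>z. V (code_pair B z))"
    by (rule integrable_cong_AE_imp[OF W(3)]) (use WV in auto)
  then have iV: "integrable (N \<Otimes>\<^sub>M N) V" using integrable_distr_eq[OF mp2(1) VN] mp2(2) by simp
  have "(\<integral>z. \<bar>V z - step_fun (\<gamma> l) z\<bar> \<partial>(N \<Otimes>\<^sub>M N)) < (1/4) ^ l / 32" for l
  proof -
    have m: "(\<lambda>z. \<bar>V z - step_fun (\<gamma> l) z\<bar>) \<in> borel_measurable (N \<Otimes>\<^sub>M N)" using VN sN by measurable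
    have "(\<integral>z. \<bar>V z - step_fun (\<gamma> l) z\<bar> \<partial>(N \<Otimes>\<^sub>M N)) = (\<integral>z. \<bar>V (code_pair B z) - step_fun (\<gamma> l) (code_pair B z)\<bar> \<partial>(M \<Otimes>\<^sub>M M))"
      using integral_distr[OF mp2(1) m] mp2(2) by simp
    also have "\<dots> = (\<integral>z. \<bar>W (fst z) (snd z) - step_fun (\<gamma> l) (code_pair B z)\<bar> \<partial>(M \<Otimes>\<^sub>M M))"
    proof (rule integral_cong_AE)
      show "AE z in M \<Otimes>\<^sub>M M. \<bar>V (code_pair B z) - step_fun (\<gamma> l) (code_pair B z)\<bar> = \<bar>W (fst z) (snd z) - step_fun (\<gamma> l) (code_pair B z)\<bar>"
        using WV by eventually_elim simp
    qed (use W(2) in measurable)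
    finally show ?thesis using \<gamma>[of l] by simp
  qed
  then show ?thesis by (rule that[OF V WV iV])
qed

text \<open>Each kernel is close in L1 to its step functions, and these have nearly equal integrals
  over products of cylinders. Letting \<open>l\<close> grow, the difference integrates to 0 over a
  generating class closed under intersection.\<close>

lemma coupled_kernels_agree:
  fixes V V' :: "(nat \<Rightarrow> bool) \<times> (nat \<Rightarrow> bool) \<Rightarrow> real"
  assumes \<mu>: "prob_space \<mu>" "sets \<mu> = sets cantor_space" and mp: "meas_pres \<mu> N p" "meas_pres \<mu> N' p'"
    and V: "integrable (N \<Otimes>\<^sub>M N) V" "\<And>l. (\<integral>z. \<bar>V z - step_fun (\<gamma> l) z\<bar> \<partial>(N \<Otimes>\<^sub>M N)) < (1/4) ^ l / 32"
    and V': "integrable (N' \<Otimes>\<^sub>M N') V'" "\<And>l. (\<integral>z. \<bar>V' z - step_fun (\<gamma>' l) z\<bar> \<partial>(N' \<Otimes>\<^sub>M N')) < (1/4) ^ l / 32"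
    and sN: "sets N = sets cantor_space" "sets N' = sets cantor_space"
    and cut: "\<And>I J l. finite I \<Longrightarrow> finite J \<Longrightarrow> \<bar>\<integral>s. indicator (cylinder I \<times> cylinder J) s *
       (step_fun (\<gamma> l) (p (fst s), p (snd s)) - step_fun (\<gamma>' l) (p' (fst s), p' (snd s))) \<partial>(\<mu> \<Otimes>\<^sub>M \<mu>)\<bar> \<le> 2 / 2 ^ l"
  shows "AE s in \<mu> \<Otimes>\<^sub>M \<mu>. V (p (fst s), p (snd s)) = V' (p' (fst s), p' (snd s))"
proof -
  interpret PP: pair_prob_space \<mu> \<mu> by (intro pair_prob_spaceI \<mu>)
  let ?P = "\<mu> \<Otimes>\<^sub>M \<mu>"
  let ?f = "\<lambda>s. (p (fst s), p (snd s))" and ?f' = "\<lambda>s. (p' (fst s), p' (snd s))"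
  have N: "prob_space N" "prob_space N'" using prob_space_meas_pres mp \<mu> by auto
  note mp2 = meas_pres_pair[OF N(1) mp(1)] and mp2' = meas_pres_pair[OF N(2) mp(2)]
  have sets2: "sets ?P = sets (cantor_space \<Otimes>\<^sub>M cantor_space)" "sets (N \<Otimes>\<^sub>M N) = sets (cantor_space \<Otimes>\<^sub>M cantor_space)"
    "sets (N' \<Otimes>\<^sub>M N') = sets (cantor_space \<Otimes>\<^sub>M cantor_space)"
    by (intro sets_pair_measure_cong \<mu> sN)+
  have sp: "space ?P = UNIV" using sets_eq_imp_space_eq[OF sets2(1)] by (simp add: space_pair_measure)
  interpret NN: pair_prob_space N N by (intro pair_prob_spaceI N)
  interpret NN': pair_prob_space N' N' by (intro pair_prob_spaceI N)
  have st: "integrable (N \<Otimes>\<^sub>M N) (step_fun xs)" "integrable (N' \<Otimes>\<^sub>M N') (step_fun xs)" for xs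
    using integrable_step_fun[OF NN.finite_measure_axioms, of "\<lambda>x. x"] integrable_step_fun[OF NN'.finite_measure_axioms, of "\<lambda>x. x"]
    by (simp_all cong: measurable_cong_sets add: sets2)
  have i1: "integrable ?P (\<lambda>s. V (?f s))" by (rule integral_meas_pres(1)[OF mp2 V(1)])
  have i1': "integrable ?P (\<lambda>s. V' (?f' s))" by (rule integral_meas_pres(1)[OF mp2' V'(1)])
  have i2: "integrable ?P (\<lambda>s. step_fun xs (?f s))" for xs by (rule integral_meas_pres(1)[OF mp2 st(1)])
  have i2': "integrable ?P (\<lambda>s. step_fun xs (?f' s))" for xs by (rule integral_meas_pres(1)[OF mp2' st(2)])
  have b1: "(\<integral>s. \<bar>V (?f s) - step_fun (\<gamma> l) (?f s)\<bar> \<partial>?P) < (1/4) ^ l / 32" for l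
    using integral_meas_pres(2)[OF mp2, of "\<lambda>z. \<bar>V z - step_fun (\<gamma> l) z\<bar>"] V st by simp
  have b1': "(\<integral>s. \<bar>V' (?f' s) - step_fun (\<gamma>' l) (?f' s)\<bar> \<partial>?P) < (1/4) ^ l / 32" for l
    using integral_meas_pres(2)[OF mp2', of "\<lambda>z. \<bar>V' z - step_fun (\<gamma>' l) z\<bar>"] V' st by simp
  have "AE s in ?P. V (?f s) - V' (?f' s) = 0"
  proof (rule AE_zero_if_integrals_zero)
    let ?E = "{cylinder I \<times> cylinder J | I J. finite I \<and> finite J}"
    show "integrable ?P (\<lambda>s. V (?f s) - V' (?f' s))" using i1 i1' by auto
    show "Int_stable ?E"
    proof (rule Int_stableI)
      fix a b assume "a \<in> ?E" "b \<in> ?E"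
      then obtain I J I' J' where ab: "a = cylinder I \<times> cylinder J" "b = cylinder I' \<times> cylinder J'"
        and f: "finite (I \<union> I')" "finite (J \<union> J')" by blast
      have "a \<inter> b = cylinder (I \<union> I') \<times> cylinder (J \<union> J')" unfolding ab by auto
      with f show "a \<inter> b \<in> ?E" by blast
    qed
    show "sets ?P = sigma_sets (space ?P) ?E" by (simp only: sets2 sp sets_cantor_pair_eq)
    have "UNIV = cylinder {} \<times> cylinder {}" by auto
    then show "space ?P \<in> ?E" unfolding sp by blast
    fix A assume "A \<in> ?E"
    then obtain I J where A: "A = cylinder I \<times> cylinder J" and IJ: "finite I" "finite J" by blast
    have AP: "A \<in> sets ?P" unfolding sets2(1) A by (intro pair_measureI cantor_cylinder IJ)
    \<comment> \<open>Two L1 errors of at most \<open>(1/4) ^ l / 32\<close> and the cut error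
      \<open>2 * (1/2) ^ l\<close>; 3 is a crude total.\<close>
    have b: "\<bar>\<integral>s. indicator A s * (V (?f s) - V' (?f' s)) \<partial>?P\<bar> \<le> 3 * (1/2) ^ l" for l
    proof -
      let ?a = "\<lambda>s. indicator A s * (V (?f s) - step_fun (\<gamma> l) (?f s))"
      let ?b = "\<lambda>s. indicator A s * (V' (?f' s) - step_fun (\<gamma>' l) (?f' s))"
      let ?c = "\<lambda>s. indicator A s * (step_fun (\<gamma> l) (?f s) - step_fun (\<gamma>' l) (?f' s))"
      have ia: "integrable ?P ?a" "integrable ?P ?b" "integrable ?P ?c"
        using integrable_mult_indicator[OF AP Bochner_Integration.integrable_diff[OF i1 i2[of "\<gamma> l"]]]
          integrable_mult_indicator[OF AP Bochner_Integration.integrable_diff[OF i1' i2'[of "\<gamma>' l"]]]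
          integrable_mult_indicator[OF AP Bochner_Integration.integrable_diff[OF i2[of "\<gamma> l"] i2'[of "\<gamma>' l"]]]
        by simp_all
      have "(\<integral>s. indicator A s * (V (?f s) - V' (?f' s)) \<partial>?P) = (\<integral>s. ?a s - ?b s + ?c s \<partial>?P)"
        by (rule Bochner_Integration.integral_cong) (auto simp: algebra_simps)
      also have "\<dots> = (\<integral>s. ?a s \<partial>?P) - (\<integral>s. ?b s \<partial>?P) + (\<integral>s. ?c s \<partial>?P)"
        using ia by simp
      finally have eq: "(\<integral>s. indicator A s * (V (?f s) - V' (?f' s)) \<partial>?P) = (\<integral>s. ?a s \<partial>?P) - (\<integral>s. ?b s \<partial>?P) + (\<integral>s. ?c s \<partial>?P)" .
      have "\<bar>\<integral>s. ?a s \<partial>?P\<bar> \<le> (\<integral>s. \<bar>?a s\<bar> \<partial>?P)" by (rule integral_abs_bound)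
      also have "\<dots> \<le> (\<integral>s. \<bar>V (?f s) - step_fun (\<gamma> l) (?f s)\<bar> \<partial>?P)"
        by (rule integral_mono[OF integrable_abs[OF ia(1)] integrable_abs[OF Bochner_Integration.integrable_diff[OF i1 i2]]])
          (auto simp: indicator_def abs_mult)
      finally have a: "\<bar>\<integral>s. ?a s \<partial>?P\<bar> \<le> (1/4) ^ l / 32" using b1[of l] by linarith
      have "\<bar>\<integral>s. ?b s \<partial>?P\<bar> \<le> (\<integral>s. \<bar>?b s\<bar> \<partial>?P)" by (rule integral_abs_bound)
      also have "\<dots> \<le> (\<integral>s. \<bar>V' (?f' s) - step_fun (\<gamma>' l) (?f' s)\<bar> \<partial>?P)"
        by (rule integral_mono[OF integrable_abs[OF ia(2)] integrable_abs[OF Bochner_Integration.integrable_diff[OF i1' i2']]])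
          (auto simp: indicator_def abs_mult)
      finally have b: "\<bar>\<integral>s. ?b s \<partial>?P\<bar> \<le> (1/4) ^ l / 32" using b1'[of l] by linarith
      have c: "\<bar>\<integral>s. ?c s \<partial>?P\<bar> \<le> 2 * (1/2) ^ l" using cut[OF IJ, of l] unfolding A by (simp add: power_divide)
      have q: "(1/4::real) ^ l \<le> (1/2) ^ l" by (rule power_mono) auto
      have q0: "0 \<le> (1/2::real) ^ l" by simp
      show ?thesis unfolding eq using a b c q q0 by linarith
    qed
    have "(\<lambda>l. 3 * (1/2::real) ^ l) \<longlonglongrightarrow> 3 * 0" by (intro tendsto_intros LIMSEQ_realpow_zero) auto
    then have "\<bar>\<integral>s. indicator A s * (V (?f s) - V' (?f' s)) \<partial>?P\<bar> \<le> 3 * 0"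
      by (rule LIMSEQ_le_const) (use b in blast)
    then show "(\<integral>s. indicator A s * (V (?f s) - V' (?f' s)) \<partial>?P) = 0" by simp
  qed (simp add: sp)
  then show ?thesis by simp
qed

lemma equiv_via_if_same_G_dist:
  fixes M :: "'a measure" and M' :: "'b measure"
  assumes G: "graphon M W" "graphon M' W'" and \<rho>: "\<And>n. 0 < \<rho> n"
    and n\<rho>: "filterlim (\<lambda>n. real n * \<rho> n) at_top sequentially"
    and c: "(\<forall>n. ereal (\<rho> n) * max (graphon_sup_norm M W) (graphon_sup_norm M' W') \<le> 1) \<or> \<rho> \<longlonglongrightarrow> 0"
    and same: "\<And>n. same_G_dist M W M' W' (\<rho> n) n"
  shows "\<exists>(M'' :: real measure) U \<phi> \<phi>'. equiv_via M W M' W' M'' U \<phi> \<phi>'"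
proof -
  note W = graphonD[OF G(1)] and W' = graphonD[OF G(2)]
  have "ereal (\<rho> n) * a \<le> ereal (\<rho> n) * max a b" "ereal (\<rho> n) * b \<le> ereal (\<rho> n) * max a b" for n a b
    using \<rho>[of n] by (auto intro!: ereal_mult_left_mono)
  then have c1: "(\<forall>n. ereal (\<rho> n) * graphon_sup_norm M W \<le> 1) \<or> \<rho> \<longlonglongrightarrow> 0"
    and c2: "(\<forall>n. ereal (\<rho> n) * graphon_sup_norm M' W' \<le> 1) \<or> \<rho> \<longlonglongrightarrow> 0"
    using c order_trans by blast+
  have e: "(1/4::real) ^ l / 32 > 0" for l by simp
  obtain B \<gamma> where B: "\<And>i. B i \<in> sets M"
    and \<gamma>: "\<And>l. (\<integral>z. \<bar>W (fst z) (snd z) - step_fun (\<gamma> l) (code_pair B z)\<bar> \<partial>(M \<Otimes>\<^sub>M M)) < (1/4) ^ l / 32"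
    by (rule step_fun_approximation[OF W(1,3) e]) (rule that)
  obtain B' \<gamma>' where B': "\<And>i. B' i \<in> sets M'"
    and \<gamma>': "\<And>l. (\<integral>z. \<bar>W' (fst z) (snd z) - step_fun (\<gamma>' l) (code_pair B' z)\<bar> \<partial>(M' \<Otimes>\<^sub>M M')) < (1/4) ^ l / 32"
    by (rule step_fun_approximation[OF W'(1,3) e]) (rule that)
  let ?N = "distr M cantor_space (code B)" and ?N' = "distr M' cantor_space (code B')"
  obtain \<mu> where \<mu>: "prob_space \<mu>" "sets \<mu> = sets cantor_space" and mp: "meas_pres \<mu> ?N evens" "meas_pres \<mu> ?N' odds"
    and cut: "\<And>I J l. finite I \<Longrightarrow> finite J \<Longrightarrow> \<bar>\<integral>s. indicator (cylinder I \<times> cylinder J) s *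
       (step_fun (\<gamma> l) (evens (fst s), evens (snd s)) - step_fun (\<gamma>' l) (odds (fst s), odds (snd s))) \<partial>(\<mu> \<Otimes>\<^sub>M \<mu>)\<bar> \<le> 2 / 2 ^ l"
    by (rule graphon_coupling[OF G B B' \<gamma> \<gamma>' \<rho> n\<rho> truncation_tendsto[OF G(1) \<rho> c1] truncation_tendsto[OF G(2) \<rho> c2] same]) (rule that)
  obtain V where V: "V \<in> borel_measurable (cantor_space \<Otimes>\<^sub>M cantor_space)" "AE z in M \<Otimes>\<^sub>M M. W (fst z) (snd z) = V (code_pair B z)"
    "integrable (?N \<Otimes>\<^sub>M ?N) V" "\<And>l. (\<integral>z. \<bar>V z - step_fun (\<gamma> l) z\<bar> \<partial>(?N \<Otimes>\<^sub>M ?N)) < (1/4) ^ l / 32"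
    by (rule cantor_L1_limit[OF G(1) B \<gamma>]) (rule that)
  obtain V' where V': "V' \<in> borel_measurable (cantor_space \<Otimes>\<^sub>M cantor_space)" "AE z in M' \<Otimes>\<^sub>M M'. W' (fst z) (snd z) = V' (code_pair B' z)"
    "integrable (?N' \<Otimes>\<^sub>M ?N') V'" "\<And>l. (\<integral>z. \<bar>V' z - step_fun (\<gamma>' l) z\<bar> \<partial>(?N' \<Otimes>\<^sub>M ?N')) < (1/4) ^ l / 32"
    by (rule cantor_L1_limit[OF G(2) B' \<gamma>']) (rule that)
  have eq: "AE s in \<mu> \<Otimes>\<^sub>M \<mu>. V (evens (fst s), evens (snd s)) = V' (odds (fst s), odds (snd s))"
    by (rule coupled_kernels_agree[OF \<mu> mp V(3,4) V'(3,4) _ _ cut]) auto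
  have eqs: "AE s in \<mu> \<Otimes>\<^sub>M \<mu>. sym_squash V (evens (fst s), evens (snd s)) = sym_squash V' (odds (fst s), odds (snd s))"
    using eq AE_pair_swap[OF \<mu>(1) eq] by eventually_elim (simp add: sym_squash_def)
  interpret F: coupled_factors \<mu> ?N ?N' evens odds
    using \<mu>(1) mp by (rule coupled_factors.intro)
  have Vm: "V \<in> borel_measurable (?N \<Otimes>\<^sub>M ?N)" and Vm': "V' \<in> borel_measurable (?N' \<Otimes>\<^sub>M ?N')"
    using V(3) V'(3) by (simp_all only: borel_measurable_integrable)
  have sym: "sym_squash V (s, t) = sym_squash V (t, s)" for s t
    by (simp add: sym_squash_def add.commute)
  have bd: "\<bar>sym_squash V z\<bar> \<le> 1" for z
    by (simp add: sym_squash_def squash_bounded)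
  obtain A A' U where A: "\<And>i::nat. A i \<in> sets ?N" "\<And>i::nat. A' i \<in> sets ?N'"
    and U: "U \<in> borel_measurable (cantor_space \<Otimes>\<^sub>M cantor_space)"
    and d: "distr ?N cantor_space (code A) = distr ?N' cantor_space (code A')"
    and AU: "AE z in ?N \<Otimes>\<^sub>M ?N. sym_squash V z = U (code_pair A z)"
    and AU': "AE z in ?N' \<Otimes>\<^sub>M ?N'. sym_squash V' z = U (code_pair A' z)"
    by (rule F.common_kernel[OF measurable_sym_squash[OF Vm] measurable_sym_squash[OF Vm'] sym bd eqs]) (rule that)
  \<comment> \<open>The quotient is the law shared by both codes, moved to the real line by a map
    that \<open>cantor_digits\<close> inverts.\<close>
  define M'' where "M'' = distr (distr ?N cantor_space (code A)) borel cantor_embed"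
  let ?\<phi> = "\<lambda>x. cantor_embed (code A (code B x))" and ?\<phi>' = "\<lambda>x. cantor_embed (code A' (code B' x))"
  have mc: "code B \<in> measurable M cantor_space" "code B' \<in> measurable M' cantor_space"
    using measurable_code[OF B] measurable_code[OF B'] by auto
  have ma: "code A \<in> measurable cantor_space cantor_space" "code A' \<in> measurable cantor_space cantor_space"
    using A by (auto intro!: measurable_code)
  have M1: "meas_pres M M'' ?\<phi>"
  proof -
    have m: "?\<phi> \<in> borel_measurable M" using mc ma by measurable
    have "distr M borel ?\<phi> = M''"
      unfolding M''_def using mc ma by (simp add: distr_distr comp_def)
    moreover have "distr M M'' ?\<phi> = distr M borel ?\<phi>" by (rule distr_cong) (auto simp: M''_def)
    ultimately show ?thesis using m by (simp add: meas_pres_def M''_def)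
  qed
  have M2: "meas_pres M' M'' ?\<phi>'"
  proof -
    have m: "?\<phi>' \<in> borel_measurable M'" using mc ma by measurable
    have "distr M' borel ?\<phi>' = M''"
      unfolding M''_def d using mc ma by (simp add: distr_distr comp_def)
    moreover have "distr M' M'' ?\<phi>' = distr M' borel ?\<phi>'" by (rule distr_cong) (auto simp: M''_def)
    ultimately show ?thesis using m by (simp add: meas_pres_def M''_def)
  qed
  have P1: "pullback_ae M W (real_kernel U) ?\<phi>"
    by (rule pullback_real_kernel[OF G(1) B V(2) AU])
  have P2: "pullback_ae M' W' (real_kernel U) ?\<phi>'"
    by (rule pullback_real_kernel[OF G(2) B' V'(2) AU'])
  have "graphon M'' (real_kernel U)"
    by (rule graphon_real_kernel[OF G(1) M1 _ P1 U]) (simp add: M''_def)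
  moreover have "prob_space M''" by (rule prob_space_meas_pres[OF M1 W(1)])
  ultimately show ?thesis unfolding equiv_via_def using M1 M2 P1 P2 by blast
qed

text \<open>One direction always finds its quotient on the real line, the other accepts a quotient
  on any type \<open>'c\<close>. Together they express equivalence with the intermediate space left
  arbitrary.\<close>

theorem theorem2p6:
  fixes M :: "'a measure" and W :: "'a \<Rightarrow> 'a \<Rightarrow> real"
    and M' :: "'b measure" and W' :: "'b \<Rightarrow> 'b \<Rightarrow> real"
    and \<rho> :: "nat \<Rightarrow> real"
  assumes "graphon M W" and "graphon M' W'"
    and "\<And>n. 0 < \<rho> n"
    and "filterlim (\<lambda>n. real n * \<rho> n) at_top sequentially"
    and "(\<forall>n. ereal (\<rho> n) * max (graphon_sup_norm M W) (graphon_sup_norm M' W') \<le> 1)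
         \<or> \<rho> \<longlonglongrightarrow> 0"
  shows "((\<forall>n. same_G_dist M W M' W' (\<rho> n) n) \<longrightarrow>
            (\<exists>(M'' :: real measure) U \<phi> \<phi>'. equiv_via M W M' W' M'' U \<phi> \<phi>'))
       \<and> (\<forall>(M'' :: 'c measure) U \<phi> \<phi>'. equiv_via M W M' W' M'' U \<phi> \<phi>' \<longrightarrow>
            (\<forall>n. same_G_dist M W M' W' (\<rho> n) n))"
  using equiv_via_if_same_G_dist[OF assms] same_G_dist_if_equiv_via[OF assms(1,2) _ assms(3)] by blast

end
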